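(* Let $G$ be a finite group and let $\mathcal{H}$ be a Hartley set of $G$ defined by a full integrated $H$-function $h$ of $G$ (so $\mathcal{H}=HS(h)$). Let $G_{h}=\prod_{p\in\mathbb{P}}G_{h(p)}$ be the $h$-radical of $G$. If $G/G_{h}$ is $\mathfrak{N}$-constrained, then the following statements hold: (1) A subgroup $V$ of $G$ is an $\mathcal{H}$-injector of $G$ if and only if $V/G_{h}$ is a nilpotent injector of $G/G_{h}$. (2) $G$ possesses an $\mathcal{H}$-injector, and any two $\mathcal{H}$-injectors of $G$ are conjugate in $G$. (3) A subgroup $V$ of $G$ is an $\mathcal{H}$-injector of $G$ if and only if $V$ is an $\mathcal{H}$-maximal subgroup of $G$ and $G_{\mathcal{H}}\leq V$.
   Context: All groups are finite; $\mathbb{P}$ is the set of all primes. A Fitting class is a class of groups closed under taking normal subgroups and products of normal subgroups belonging to the class; $G_{\mathfrak{X}}$ is the product of all normal subgroups of $G$ lying in the Fitting class $\mathfrak{X}$. $\mathfrak{N}$ is the class of nilpotent groups, $\mathfrak{N}_p$ the class of $p$-groups, $\mathfrak{E}_{p'}$ the class of all (finite) $p'$-groups. The product of Fitting classes is $\mathfrak{X}\mathfrak{Y}=\{G: G/G_{\mathfrak{X}}\in\mathfrak{Y}\}$; in particular $\mathfrak{E}_{p'}\mathfrak{N}_p$ is the class of $p$-nilpotent groups. $F(G)=G_{\mathfrak{N}}$ is the Fitting subgroup. A group $G$ is $\mathfrak{N}$-constrained if $C_G(F(G))\leq F(G)$. A nonempty set $\mathcal{F}$ of subgroups of $G$ is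 a Fitting set of $G$ if: (i) $T\unlhd S\in\mathcal{F}$ implies $T\in\mathcal{F}$; (ii) $S,T\in\mathcal{F}$ with $S\unlhd ST$ and $T\unlhd ST$ implies $ST\in\mathcal{F}$; (iii) $S\in\mathcal{F}$ and $x\in G$ implies $S^x\in\mathcal{F}$. For $H\leq G$, the $\mathcal{F}$-radical $H_{\mathcal{F}}$ is the product of all normal subgroups of $H$ that belong to $\mathcal{F}$. For a Fitting set $\mathcal{F}$ of $G$ and a nonempty Fitting class $\mathfrak{X}$, $\mathcal{F}\circ\mathfrak{X}=\{H\leq G: H/H_{\mathcal{F}}\in\mathfrak{X}\}$, which is a Fitting set of $G$. An $H$-function of $G$ is a function $h$ from $\mathbb{P}$ to the set of Fitting sets of $G$. Put $HS(h)=\bigcap_{p\in\mathbb{P}}h(p)\circ(\mathfrak{E}_{p'}\mathfrak{N}_{p})$. A Fitting set $\mathcal{H}$ of $G$ is a Hartley set of $G$ if $\mathcal{H}=HS(h)$ for some $H$-function $h$ of $G$ (then $\mathcal{H}$ is said to be defined by $h$, and $h$ is an $H$-function of $\mathcal{H}$). Such an $h$ is integrated if $h(p)\subseteq\mathcal{H}$ for all primes $p$; full if $h(p)\subseteq h(q)\circ\mathfrak{E}_{q'}$ for all different primes $p,q$; full integrated if it is both. For a Fitting set (or Fitting class) $\mathcal{F}$ and a group $N$, a subgroup $U\leq N$ is $\mathcal{F}$-maximal in $N$ if $U\in\mathcal{F}$ and $U=W$ whenever $U\leq W\leq N$ and $W\in\mathcal{F}$. A subgroup $V\leq G$ is an $\mathcal{F}$-injector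 of $G$ if $V\cap N$ is $\mathcal{F}$-maximal in $N$ for every subnormal subgroup $N$ of $G$. A nilpotent injector is an $\mathfrak{N}$-injector. Writing $V/K$ presupposes $K\leq V$. *)

theory Defs
  imports "HOL-Algebra.Generated_Groups" "HOL-Computational_Algebra.Primes"
begin

section \<open>Finite groups\<close>

text \<open>A subgroup of \<open>G\<close> is represented by its carrier \<open>H\<close>; regarded as a group in its own right
  it is \<open>G\<lparr>carrier := H\<rparr>\<close>.\<close>

inductive subnormal :: "('a, 'b) monoid_scheme \<Rightarrow> 'a set \<Rightarrow> bool" for G where
  self: "subnormal G (carrier G)"
| step: "subnormal G K \<Longrightarrow> N \<lhd> G\<lparr>carrier := K\<rparr> \<Longrightarrow> subnormal G N"

definition conj_subgroup :: "('a, 'b) monoid_scheme \<Rightarrow> 'a set \<Rightarrow> 'a \<Rightarrow> 'a set" where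
  "conj_subgroup G S x = (\<lambda>s. inv\<^bsub>G\<^esub> x \<otimes>\<^bsub>G\<^esub> s \<otimes>\<^bsub>G\<^esub> x) ` S"

definition centralizer :: "('a, 'b) monoid_scheme \<Rightarrow> 'a set \<Rightarrow> 'a set" where
  "centralizer G S = {g \<in> carrier G. \<forall>s\<in>S. g \<otimes>\<^bsub>G\<^esub> s = s \<otimes>\<^bsub>G\<^esub> g}"

text \<open>The product of an arbitrary (possibly infinite) family of normal subgroups is their join.\<close>

definition subgroup_prod :: "('a, 'b) monoid_scheme \<Rightarrow> 'a set set \<Rightarrow> 'a set" where
  "subgroup_prod G \<N> = generate G (\<Union>\<N>)"

primrec lower_central :: "('a, 'b) monoid_scheme \<Rightarrow> nat \<Rightarrow> 'a set" where
  "lower_central G 0 = carrier G"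
| "lower_central G (Suc n) =
     generate G {x \<otimes>\<^bsub>G\<^esub> y \<otimes>\<^bsub>G\<^esub> inv\<^bsub>G\<^esub> x \<otimes>\<^bsub>G\<^esub> inv\<^bsub>G\<^esub> y | x y. x \<in> lower_central G n \<and> y \<in> carrier G}"


section \<open>Classes of finite groups\<close>

text \<open>A class of groups is a predicate on groups; every class below consists of finite groups only.\<close>

definition nilpotent_group :: "('a, 'b) monoid_scheme \<Rightarrow> bool" where
  "nilpotent_group G \<longleftrightarrow> group G \<and> finite (carrier G) \<and> (\<exists>n. lower_central G n = {\<one>\<^bsub>G\<^esub>})"

definition p_group :: "nat \<Rightarrow> ('a, 'b) monoid_scheme \<Rightarrow> bool" where
  "p_group p G \<longleftrightarrow> group G \<and> finite (carrier G) \<and> (\<exists>n. order G = p ^ n)"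

definition p'_group :: "nat \<Rightarrow> ('a, 'b) monoid_scheme \<Rightarrow> bool" where
  "p'_group p G \<longleftrightarrow> group G \<and> finite (carrier G) \<and> \<not> p dvd order G"

definition class_radical ::
    "(('a, 'b) monoid_scheme \<Rightarrow> bool) \<Rightarrow> ('a, 'b) monoid_scheme \<Rightarrow> 'a set" where
  "class_radical \<XX> G = subgroup_prod G {N. N \<lhd> G \<and> \<XX> (G\<lparr>carrier := N\<rparr>)}"

text \<open>The second class of a product is applied to a quotient, hence the type \<^typ>\<open>'a set monoid\<close>.\<close>

definition class_prod ::
    "(('a, 'b) monoid_scheme \<Rightarrow> bool) \<Rightarrow> ('a set monoid \<Rightarrow> bool) \<Rightarrow>
     ('a, 'b) monoid_scheme \<Rightarrow> bool" where
  "class_prod \<XX> \<YY> G \<longleftrightarrow> group G \<and> finite (carrier G) \<and> \<YY> (G Mod class_radical \<XX> G)"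

definition fitting_subgroup :: "('a, 'b) monoid_scheme \<Rightarrow> 'a set" where
  "fitting_subgroup G = class_radical nilpotent_group G"

definition nilpotent_constrained :: "('a, 'b) monoid_scheme \<Rightarrow> bool" where
  "nilpotent_constrained G \<longleftrightarrow> centralizer G (fitting_subgroup G) \<subseteq> fitting_subgroup G"


section \<open>Fitting sets and Hartley sets\<close>

text \<open>In the second closure property, normality of \<open>S\<close> in \<open>S <#> T\<close> includes
  that \<open>S <#> T\<close> is a group.\<close>

definition fitting_set :: "('a, 'b) monoid_scheme \<Rightarrow> 'a set set \<Rightarrow> bool" where
  "fitting_set G \<F> \<longleftrightarrow>
     \<F> \<noteq> {} \<and> (\<forall>S\<in>\<F>. subgroup S G) \<and>
     (\<forall>S\<in>\<F>. \<forall>T. T \<lhd> G\<lparr>carrier := S\<rparr> \<longrightarrow> T \<in> \<F>) \<and>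
     (\<forall>S\<in>\<F>. \<forall>T\<in>\<F>. S \<lhd> G\<lparr>carrier := S <#>\<^bsub>G\<^esub> T\<rparr> \<longrightarrow> T \<lhd> G\<lparr>carrier := S <#>\<^bsub>G\<^esub> T\<rparr>
        \<longrightarrow> S <#>\<^bsub>G\<^esub> T \<in> \<F>) \<and>
     (\<forall>S\<in>\<F>. \<forall>x\<in>carrier G. conj_subgroup G S x \<in> \<F>)"

definition radical :: "('a, 'b) monoid_scheme \<Rightarrow> 'a set set \<Rightarrow> 'a set \<Rightarrow> 'a set" where
  "radical G \<F> H = subgroup_prod G {N \<in> \<F>. N \<lhd> G\<lparr>carrier := H\<rparr>}"

definition fitting_comp ::
    "('a, 'b) monoid_scheme \<Rightarrow> 'a set set \<Rightarrow> ('a set monoid \<Rightarrow> bool) \<Rightarrow> 'a set set" where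
  "fitting_comp G \<F> \<XX> = {H. subgroup H G \<and> \<XX> (G\<lparr>carrier := H\<rparr> Mod radical G \<F> H)}"

text \<open>Functions on the set of primes are represented by functions on \<^typ>\<open>nat\<close> whose values
  at non-primes are ignored.\<close>

definition H_function :: "('a, 'b) monoid_scheme \<Rightarrow> (nat \<Rightarrow> 'a set set) \<Rightarrow> bool" where
  "H_function G h \<longleftrightarrow> (\<forall>p. prime p \<longrightarrow> fitting_set G (h p))"

definition HS :: "('a, 'b) monoid_scheme \<Rightarrow> (nat \<Rightarrow> 'a set set) \<Rightarrow> 'a set set" where
  "HS G h = (\<Inter>p\<in>{p. prime p}. fitting_comp G (h p) (class_prod (p'_group p) (p_group p)))"

definition hartley_set_defined_by ::
    "('a, 'b) monoid_scheme \<Rightarrow> 'a set set \<Rightarrow> (nat \<Rightarrow> 'a set set) \<Rightarrow> bool" where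
  "hartley_set_defined_by G \<H> h \<longleftrightarrow> fitting_set G \<H> \<and> H_function G h \<and> \<H> = HS G h"

definition integrated :: "'a set set \<Rightarrow> (nat \<Rightarrow> 'a set set) \<Rightarrow> bool" where
  "integrated \<H> h \<longleftrightarrow> (\<forall>p. prime p \<longrightarrow> h p \<subseteq> \<H>)"

definition full :: "('a, 'b) monoid_scheme \<Rightarrow> (nat \<Rightarrow> 'a set set) \<Rightarrow> bool" where
  "full G h \<longleftrightarrow>
     (\<forall>p q. prime p \<longrightarrow> prime q \<longrightarrow> p \<noteq> q \<longrightarrow> h p \<subseteq> fitting_comp G (h q) (p'_group q))"

definition h_radical :: "('a, 'b) monoid_scheme \<Rightarrow> (nat \<Rightarrow> 'a set set) \<Rightarrow> 'a set" where
  "h_radical G h = subgroup_prod G {radical G (h p) (carrier G) | p. prime p}"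


section \<open>Injectors\<close>

definition maximal_in ::
    "('a, 'b) monoid_scheme \<Rightarrow> 'a set set \<Rightarrow> 'a set \<Rightarrow> 'a set \<Rightarrow> bool" where
  "maximal_in G \<F> N U \<longleftrightarrow>
     subgroup U (G\<lparr>carrier := N\<rparr>) \<and> U \<in> \<F> \<and>
     (\<forall>W. U \<subseteq> W \<longrightarrow> subgroup W (G\<lparr>carrier := N\<rparr>) \<longrightarrow> W \<in> \<F> \<longrightarrow> U = W)"

definition injector :: "('a, 'b) monoid_scheme \<Rightarrow> 'a set set \<Rightarrow> 'a set \<Rightarrow> bool" where
  "injector G \<F> V \<longleftrightarrow>
     subgroup V G \<and> (\<forall>N. subnormal G N \<longrightarrow> maximal_in G \<F> N (V \<inter> N))"

text \<open>For a class \<open>\<XX>\<close> in place of a Fitting set, a subgroup \<open>H\<close> belongs to \<open>\<XX>\<close>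
  if the group \<open>G\<lparr>carrier := H\<rparr>\<close> does.\<close>

definition class_injector ::
    "('a, 'b) monoid_scheme \<Rightarrow> (('a, 'b) monoid_scheme \<Rightarrow> bool) \<Rightarrow> 'a set \<Rightarrow> bool" where
  "class_injector G \<XX> V \<longleftrightarrow> injector G {H. subgroup H G \<and> \<XX> (G\<lparr>carrier := H\<rparr>)} V"

end

theory Submission
  imports Defs "HOL-Algebra.Sylow" "HOL-Algebra.Zassenhaus" "HOL-Algebra.Multiplicative_Group"
    "HOL-Number_Theory.Cong"
begin

text \<open>Write \<open>R\<close> for the \<open>h\<close>-radical of \<open>G\<close> and \<open>F\<close> for the full preimage in \<open>G\<close> of the Fitting
  subgroup of \<open>G/R\<close>. The theorem reduces to the nilpotent injectors of \<open>G/R\<close>, because for the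
  subgroups that contain \<open>F\<close> membership in the Hartley set only depends on the quotient by \<open>R\<close>.

  In one direction, fullness of \<open>h\<close> makes \<open>R\<close> a \<open>p'\<close>-group modulo the \<open>h(p)\<close>-radical of \<open>G\<close> for
  every prime \<open>p\<close> (\<open>h_radical_p'_mod\<close>). If \<open>R \<le> V\<close> and \<open>V/R\<close> is nilpotent, then modulo that radical
  the subgroup \<open>V\<close> is an extension of a \<open>p'\<close>-group by a nilpotent group, hence \<open>p\<close>-nilpotent, so
  \<open>V\<close> lies in the Hartley set (\<open>HS_of_nilpotent_quotient\<close>). In particular \<open>F\<close> does, and the radical
  of \<open>G\<close> for the Hartley set contains \<open>F\<close>.

  In the other direction, let \<open>N\<close> be subnormal in \<open>G\<close> and let \<open>W\<close> be a member of the Hartley set with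
  \<open>F \<inter> N \<le> W \<le> N\<close>. The \<open>h(p)\<close>-radical \<open>S\<close> of \<open>W\<close> and \<open>F \<inter> N\<close> are normal in \<open>W\<close>, and their
  intersection is a subnormal subgroup of \<open>G\<close> that belongs to \<open>h(p)\<close>; so it lies in \<open>R\<close>, and \<open>S\<close>
  centralizes \<open>F \<inter> N\<close> modulo \<open>R\<close>. Since \<open>NR/R\<close> inherits the constraint, this forces \<open>S \<le> F\<close> and
  then \<open>S \<le> R\<close> (\<open>HS_radical_subset\<close>). Now \<open>W/S\<close> is \<open>p\<close>-nilpotent, hence so is \<open>WR/R\<close>; as this
  holds for all \<open>p\<close>, the group \<open>WR/R\<close> is nilpotent (\<open>HS_nilpotent_quotient\<close>).

  What remains is Mann's theorem on a finite group whose Fitting subgroup contains its own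
  centralizer: the nilpotent injectors of the group are exactly the maximal ones among the nilpotent
  subgroups that contain the Fitting subgroup, they exist, and they are conjugate
  (\<open>nilpotent_injector_iff\<close>, \<open>max_nilpotent_conjugate\<close>). Such a subgroup is a
  product of pairwise commuting subgroups \<open>P p\<close>, where \<open>P p\<close> is a Sylow \<open>p\<close>-subgroup of the centralizer of the
  \<open>p'\<close>-part of the Fitting subgroup; the Sylow theorems give existence and conjugacy
  (\<open>mann_products_conjugate\<close>), and a coprime action argument shows that the intersection with a normal
  subgroup is of the same kind (\<open>max_nilpotent_normal\<close>).

  Nilpotency is used throughout in the form: for every prime \<open>p\<close>, products of elements of \<open>p\<close>-power
  order have \<open>p\<close>-power order. Unlike the lower central series this condition passes to subgroups by
  inspection and can be read off modulo a normal subgroup.\<close>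

section \<open>Subgroups, conjugates and joins\<close>

context group
begin

lemma inv_cancel_left:
  assumes "x \<in> carrier G" "y \<in> carrier G"
  shows "inv x \<otimes> (x \<otimes> y) = y" and "x \<otimes> (inv x \<otimes> y) = y"
  using assms by (simp_all add: m_assoc[symmetric])

lemma finite_subgroup: "finite (carrier G) \<Longrightarrow> subgroup H G \<Longrightarrow> finite H"
  using subgroup.subset finite_subset by blast

lemma subgroup_of_subgroup_iff:
  assumes "subgroup H G"
  shows "subgroup K (G\<lparr>carrier := H\<rparr>) \<longleftrightarrow> subgroup K G \<and> K \<subseteq> H"
  using incl_subgroup[OF assms, of K] subgroup_incl[OF _ assms, of K]
    subgroup.subset[of K "G\<lparr>carrier := H\<rparr>"] by auto

text \<open>Normality inside a subgroup, expressed in the ambient group only: all subgroups in sight can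
  then be treated as subsets of one group.\<close>

lemma normal_in_iff:
  assumes "subgroup H G"
  shows "N \<lhd> G\<lparr>carrier := H\<rparr> \<longleftrightarrow>
    subgroup N G \<and> N \<subseteq> H \<and> (\<forall>x\<in>H. \<forall>n\<in>N. x \<otimes> n \<otimes> inv x \<in> N)"
proof -
  interpret H: group "G\<lparr>carrier := H\<rparr>" using assms by (rule subgroup_imp_group)
  show ?thesis
    unfolding H.normal_inv_iff subgroup_of_subgroup_iff[OF assms]
    using m_inv_consistent[OF assms] by auto
qed

lemma pow_mem: "subgroup H G \<Longrightarrow> x \<in> H \<Longrightarrow> x [^] (n :: nat) \<in> H"
  by (induction n) (auto intro: subgroup.one_closed subgroup.m_closed)

lemma set_multI: "a \<in> A \<Longrightarrow> b \<in> B \<Longrightarrow> a \<otimes> b \<in> A <#> B"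
  by (auto simp: set_mult_def)

lemma set_mult_contains:
  assumes "subgroup A G" "subgroup B G"
  shows "A \<subseteq> A <#> B" "B \<subseteq> A <#> B"
  using assms[THEN subgroup.one_closed] assms[THEN subgroup.subset]
  by (force simp: set_mult_def)+

lemma normal_set_mult:
  assumes "A \<lhd> G" "B \<lhd> G"
  shows "A <#> B \<lhd> G"
proof (rule normal_invI)
  note AB = assms[THEN normal_invE(1)]
  note sub = AB[THEN subgroup.subset, THEN subsetD]
  show "subgroup (A <#> B) G"
    by (rule mult_norm_subgroup[OF assms(1) AB(2)])
  fix x h assume x: "x \<in> carrier G" and "h \<in> A <#> B"
  then obtain a b where ab: "a \<in> A" "b \<in> B" "h = a \<otimes> b" by (auto simp: set_mult_def)
  have "x \<otimes> h \<otimes> inv x = (x \<otimes> a \<otimes> inv x) \<otimes> (x \<otimes> b \<otimes> inv x)"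
    using x ab sub by (simp add: m_assoc inv_cancel_left)
  then show "x \<otimes> h \<otimes> inv x \<in> A <#> B"
    using set_multI normal_invE(2)[OF assms(1) x ab(1)] normal_invE(2)[OF assms(2) x ab(2)] by simp
qed

lemma subgroup_prod_insert:
  assumes "N \<lhd> G" "\<And>M. M \<in> \<N> \<Longrightarrow> M \<subseteq> carrier G"
  shows "subgroup_prod G (insert N \<N>) = N <#> subgroup_prod G \<N>"
proof -
  have U: "\<Union>\<N> \<subseteq> carrier G" using assms(2) by blast
  note N = normal_invE[OF assms(1)]
  let ?S = "generate G (\<Union>\<N>)"
  have S: "subgroup ?S G" using U by (rule generate_is_subgroup)
  have NS: "subgroup (N <#> ?S) G" by (rule mult_norm_subgroup[OF assms(1) S])
  have "generate G (\<Union>(insert N \<N>)) \<subseteq> N <#> ?S"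
  proof (rule generate_subgroup_incl[OF _ NS])
    show "\<Union>(insert N \<N>) \<subseteq> N <#> ?S"
      using set_mult_contains[OF N(1) S] generate.incl[of _ "\<Union>\<N>" G] by blast
  qed
  moreover have "N <#> ?S \<subseteq> generate G (\<Union>(insert N \<N>))"
  proof
    fix x assume "x \<in> N <#> ?S"
    then obtain n s where "n \<in> N" "s \<in> ?S" "x = n \<otimes> s" by (auto simp: set_mult_def)
    then show "x \<in> generate G (\<Union>(insert N \<N>))"
      using mono_generate[of "\<Union>\<N>" "\<Union>(insert N \<N>)"] by (auto intro: generate.eng generate.incl)
  qed
  ultimately show ?thesis unfolding subgroup_prod_def by auto
qed

text \<open>In a finite group a join of normal subgroups is an iterated product of two factors, so every
  property of the trivial subgroup that is stable under such products passes to joins.\<close>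

lemma normal_join_induct:
  assumes fin: "finite (carrier G)" and norm: "\<And>N. N \<in> \<N> \<Longrightarrow> N \<lhd> G"
    and one: "Q {\<one>}" and Q: "\<And>N. N \<in> \<N> \<Longrightarrow> Q N"
    and mult: "\<And>A B. A \<lhd> G \<Longrightarrow> B \<lhd> G \<Longrightarrow> Q A \<Longrightarrow> Q B \<Longrightarrow> Q (A <#> B)"
  shows "subgroup_prod G \<N> \<lhd> G" and "Q (subgroup_prod G \<N>)"
proof -
  have "\<N> \<subseteq> Pow (carrier G)" using norm[THEN normal_invE(1)] subgroup.subset by blast
  then have "finite \<N>" using fin by (meson finite_Pow_iff finite_subset)
  then have "subgroup_prod G \<N> \<lhd> G \<and> Q (subgroup_prod G \<N>)"
    using norm Q
  proof (induction \<N>)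
    case empty
    show ?case using one one_is_normal by (simp add: subgroup_prod_def generate_empty)
  next
    case (insert N \<N>)
    then have IH: "subgroup_prod G \<N> \<lhd> G" "Q (subgroup_prod G \<N>)" by auto
    have "subgroup_prod G (insert N \<N>) = N <#> subgroup_prod G \<N>"
      using insert.prems(1)[THEN normal_invE(1), THEN subgroup.subset]
      by (intro subgroup_prod_insert insert.prems(1)) auto
    then show ?case using IH insert.prems normal_set_mult mult by auto
  qed
  then show "subgroup_prod G \<N> \<lhd> G" and "Q (subgroup_prod G \<N>)" by auto
qed

lemma subnormal_subgroup: "subnormal G N \<Longrightarrow> subgroup N G"
  by (induction rule: subnormal.induct) (auto simp: subgroup_self normal_in_iff)

lemma normal_subnormal: "N \<lhd> G \<Longrightarrow> subnormal G N"
  using subnormal.step[OF subnormal.self[of G], of N] by simp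

lemma subgroup_prod_consistent:
  assumes "subgroup H G" "\<And>N. N \<in> \<N> \<Longrightarrow> N \<subseteq> H"
  shows "subgroup_prod (G\<lparr>carrier := H\<rparr>) \<N> = subgroup_prod G \<N>"
  unfolding subgroup_prod_def
  using generate_consistent[OF _ assms(1), of "\<Union>\<N>"] assms(2) by auto

lemma card_subgroup_dvd:
  assumes N: "subgroup N G" and T: "subgroup T G" "T \<subseteq> N"
  shows "card T dvd card N"
proof -
  have "subgroup T (G\<lparr>carrier := N\<rparr>)" using subgroup_of_subgroup_iff[OF N] T by simp
  from group.lagrange[OF subgroup_imp_group[OF N] this]
  have "card (rcosets\<^bsub>G\<lparr>carrier := N\<rparr>\<^esub> T) * card T = card N" by (simp add: order_def)
  then show ?thesis by (metis dvd_triv_right)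
qed

lemma conj_subgroup_mem:
  "x \<in> conj_subgroup G P g \<longleftrightarrow> (\<exists>y\<in>P. x = inv g \<otimes> y \<otimes> g)"
  by (auto simp: conj_subgroup_def)

lemma conj_subgroup_mult:
  assumes "P \<subseteq> carrier G" "x \<in> carrier G" "y \<in> carrier G"
  shows "conj_subgroup G (conj_subgroup G P x) y = conj_subgroup G P (x \<otimes> y)"
  unfolding conj_subgroup_def image_image using assms
  by (intro image_cong) (auto simp: m_assoc inv_mult_group subset_iff)

lemma conj_subgroup_one: "P \<subseteq> carrier G \<Longrightarrow> conj_subgroup G P \<one> = P"
  unfolding conj_subgroup_def by (force simp: subset_iff)

lemma conj_subgroup_cancel:
  assumes "P \<subseteq> carrier G" "g \<in> carrier G"
  shows "conj_subgroup G (conj_subgroup G P g) (inv g) = P"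
    and "conj_subgroup G (conj_subgroup G P (inv g)) g = P"
  using assms by (simp_all add: conj_subgroup_mult conj_subgroup_one)

lemma conj_subgroup_mono: "A \<subseteq> B \<Longrightarrow> conj_subgroup G A g \<subseteq> conj_subgroup G B g"
  by (auto simp: conj_subgroup_def)

lemma card_conj_subgroup:
  assumes "A \<subseteq> carrier G" "g \<in> carrier G"
  shows "card (conj_subgroup G A g) = card A"
  unfolding conj_subgroup_def using assms
  by (intro card_image inj_on_inverseI[where g = "\<lambda>x. g \<otimes> x \<otimes> inv g"])
    (auto simp: m_assoc inv_cancel_left subset_iff)

lemma subgroup_conj_subgroup:
  assumes P: "subgroup P G" and g: "g \<in> carrier G"
  shows "subgroup (conj_subgroup G P g) G"
proof -
  interpret group_hom G G "\<lambda>s. inv g \<otimes> s \<otimes> g"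
    by unfold_locales (use g in \<open>auto simp: hom_def m_assoc inv_cancel_left\<close>)
  show ?thesis unfolding conj_subgroup_def by (rule subgroup_img_is_subgroup[OF P])
qed

lemma conj_subgroup_normal:
  assumes "N \<lhd> G" "A \<subseteq> N" "g \<in> carrier G"
  shows "conj_subgroup G A g \<subseteq> N"
  using normal.inv_op_closed1[OF assms(1,3)] assms(2) by (auto simp: conj_subgroup_def)

lemma conj_subgroup_fixed:
  assumes "S \<subseteq> carrier G" "g \<in> carrier G"
    "\<And>s. s \<in> S \<Longrightarrow> g \<otimes> s \<otimes> inv g \<in> S" "\<And>s. s \<in> S \<Longrightarrow> inv g \<otimes> s \<otimes> g \<in> S"
  shows "conj_subgroup G S g = S"
proof
  show "conj_subgroup G S g \<subseteq> S" using assms(4) by (auto simp: conj_subgroup_def)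
  show "S \<subseteq> conj_subgroup G S g"
  proof
    fix s assume s: "s \<in> S"
    then have "s = inv g \<otimes> (g \<otimes> s \<otimes> inv g) \<otimes> g" using assms(1,2) by (simp add: m_assoc inv_cancel_left subset_iff)
    then show "s \<in> conj_subgroup G S g" using assms(3)[OF s] conj_subgroup_mem by blast
  qed
qed

lemma normalizing_subgroup:
  assumes "S \<subseteq> carrier G"
  shows "subgroup {g \<in> carrier G. \<forall>s\<in>S. g \<otimes> s \<otimes> inv g \<in> S \<and> inv g \<otimes> s \<otimes> g \<in> S} G"
    (is "subgroup ?N G")
proof (rule subgroupI)
  show "?N \<noteq> {}" using assms by (auto simp: subset_iff intro!: exI[of _ \<one>])
  fix g h assume gh: "g \<in> ?N" "h \<in> ?N"
  have "g \<otimes> h \<otimes> s \<otimes> inv (g \<otimes> h) = g \<otimes> (h \<otimes> s \<otimes> inv h) \<otimes> inv g"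
    "inv (g \<otimes> h) \<otimes> s \<otimes> (g \<otimes> h) = inv h \<otimes> (inv g \<otimes> s \<otimes> g) \<otimes> h" if "s \<in> S" for s
    using gh that assms by (simp_all add: m_assoc inv_mult_group subset_iff)
  then show "g \<otimes> h \<in> ?N" using gh by simp
qed auto

lemma conj_commuting:
  assumes "x \<in> carrier G" "s \<in> carrier G" "x \<otimes> s = s \<otimes> x"
  shows "x \<otimes> s \<otimes> inv x = s" "inv x \<otimes> s \<otimes> x = s"
proof -
  show "x \<otimes> s \<otimes> inv x = s" unfolding assms(3) using assms(1,2) by (simp add: m_assoc)
  have "inv x \<otimes> s \<otimes> x = inv x \<otimes> (x \<otimes> s)" unfolding assms(3) using assms(1,2) by (simp add: m_assoc)
  then show "inv x \<otimes> s \<otimes> x = s" using assms(1,2) by (simp add: inv_cancel_left)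
qed

lemma centralizer_subgroup: 
  assumes "S \<subseteq> carrier G"
  shows "subgroup (centralizer G S) G"
proof (rule subgroupI)
  show "centralizer G S \<subseteq> carrier G" by (auto simp: centralizer_def)
  show "centralizer G S \<noteq> {}" using assms by (auto simp: centralizer_def intro!: exI[of _ \<one>])
  show "inv x \<in> centralizer G S" if "x \<in> centralizer G S" for x
  proof -
    have "inv x \<otimes> s = s \<otimes> inv x" if s: "s \<in> S" for s
    proof -
      have "x \<in> carrier G" "s \<in> carrier G" "x \<otimes> s = s \<otimes> x"
        using s \<open>x \<in> centralizer G S\<close> assms by (auto simp: centralizer_def)
      then show ?thesis by (metis inv_closed inv_solve_left inv_solve_right m_assoc m_closed)
    qed
    then show ?thesis using that by (auto simp: centralizer_def)
  qed
  show "x \<otimes> y \<in> centralizer G S" if "x \<in> centralizer G S" "y \<in> centralizer G S" for x y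
  proof -
    have "x \<otimes> y \<otimes> s = s \<otimes> (x \<otimes> y)" if s: "s \<in> S" for s
    proof -
      have "x \<in> carrier G" "s \<in> carrier G" "x \<otimes> s = s \<otimes> x" "y \<in> carrier G" "y \<otimes> s = s \<otimes> y"
        using s \<open>x \<in> centralizer G S\<close> \<open>y \<in> centralizer G S\<close> assms by (auto simp: centralizer_def)
      then show ?thesis by (metis m_assoc)
    qed
    then show ?thesis using that by (auto simp: centralizer_def)
  qed
qed

lemma centralizer_normal:
  assumes S: "S \<subseteq> carrier G" and inv: "\<And>g s. g \<in> carrier G \<Longrightarrow> s \<in> S \<Longrightarrow> g \<otimes> s \<otimes> inv g \<in> S"
  shows "centralizer G S \<lhd> G"
proof (rule normal_invI[OF centralizer_subgroup[OF S]])
  fix g c assume g: "g \<in> carrier G" and c: "c \<in> centralizer G S"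
  have cc: "c \<in> carrier G" using c by (simp add: centralizer_def)
  have "(g \<otimes> c \<otimes> inv g) \<otimes> s = s \<otimes> (g \<otimes> c \<otimes> inv g)" if s: "s \<in> S" for s
  proof -
    let ?t = "inv g \<otimes> s \<otimes> g"
    have sc: "s \<in> carrier G" using s S by auto
    have "?t \<in> S" using inv[of "inv g" s] g s by simp
    then have "c \<otimes> ?t = ?t \<otimes> c" using c by (simp add: centralizer_def)
    then have "g \<otimes> (c \<otimes> ?t) \<otimes> inv g = g \<otimes> (?t \<otimes> c) \<otimes> inv g" by simp
    then show ?thesis using g cc sc by (simp add: m_assoc inv_cancel_left)
  qed
  then show "g \<otimes> c \<otimes> inv g \<in> centralizer G S" using g cc by (simp add: centralizer_def)
qed

end

section \<open>Cosets of a normal subgroup\<close>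

context group
begin

lemma FactGroup_pow_eq_one:
  assumes "N \<lhd> G" "x \<in> carrier G"
  shows "(N #> x) [^]\<^bsub>G Mod N\<^esub> (n :: nat) = \<one>\<^bsub>G Mod N\<^esub> \<longleftrightarrow> x [^] n \<in> N"
  using normal.FactGroup_pow[OF assms] normal_imp_subgroup[OF assms(1)] assms(2)
  by (metis coset_join1 coset_join2 nat_pow_closed one_FactGroup subgroup.subset)

context
  fixes N
  assumes N: "N \<lhd> G"
begin

lemma coset_mult: "x \<in> carrier G \<Longrightarrow> y \<in> carrier G \<Longrightarrow>
    (N #> x) \<otimes>\<^bsub>G Mod N\<^esub> (N #> y) = N #> (x \<otimes> y)"
  using normal.rcos_sum[OF N] by simp

lemma coset_inv: "x \<in> carrier G \<Longrightarrow> inv\<^bsub>G Mod N\<^esub> (N #> x) = N #> inv x"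
  using normal.inv_FactGroup[OF N] normal.rcos_inv[OF N] by (auto simp: carrier_FactGroup)

lemma coset_in_carrier: "x \<in> carrier G \<Longrightarrow> N #> x \<in> carrier (G Mod N)"
  by (auto simp: carrier_FactGroup)

lemma coset_eq_iff:
  assumes "x \<in> carrier G" "y \<in> carrier G"
  shows "N #> x = N #> y \<longleftrightarrow> x \<otimes> inv y \<in> N"
proof -
  note sN = normal_imp_subgroup[OF N]
  have "N #> x = N #> y \<longleftrightarrow> x \<in> N #> y"
    using assms sN by (metis rcos_self repr_independence)
  then show ?thesis using subgroup.rcos_module[OF sN is_group assms(2,1)] by simp
qed

lemma coset_eq_one_iff: "x \<in> carrier G \<Longrightarrow> N #> x = \<one>\<^bsub>G Mod N\<^esub> \<longleftrightarrow> x \<in> N"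
  using FactGroup_pow_eq_one[OF N, of x 1] normal.FactGroup_pow[OF N, of x 1] by simp

lemma coset_commute_iff:
  assumes "x \<in> carrier G" "y \<in> carrier G"
  shows "(N #> x) \<otimes>\<^bsub>G Mod N\<^esub> (N #> y) = (N #> y) \<otimes>\<^bsub>G Mod N\<^esub> (N #> x) \<longleftrightarrow>
    x \<otimes> y \<otimes> inv x \<otimes> inv y \<in> N"
  using assms coset_eq_iff[of "x \<otimes> y" "y \<otimes> x"] coset_mult
  by (simp add: inv_mult_group m_assoc del: mult_FactGroup)

lemma subgroup_coset_image:
  assumes "subgroup V G"
  shows "subgroup ((#>) N ` V) (G Mod N)"
proof -
  have "group_hom G (G Mod N) ((#>) N)"
    using normal.r_coset_hom_Mod[OF N] normal.factorgroup_is_group[OF N] is_group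
    by (simp add: group_hom_def group_hom_axioms_def)
  then show ?thesis using group_hom.subgroup_img_is_subgroup assms by blast
qed

lemma normal_coset_image:
  assumes K: "subgroup K G" and M: "M \<lhd> G\<lparr>carrier := K\<rparr>"
  shows "(#>) N ` M \<lhd> (G Mod N)\<lparr>carrier := (#>) N ` K\<rparr>"
proof -
  interpret Q: group "G Mod N" using N by (rule normal.factorgroup_is_group)
  have M': "subgroup M G" "M \<subseteq> K" "\<And>x m. x \<in> K \<Longrightarrow> m \<in> M \<Longrightarrow> x \<otimes> m \<otimes> inv x \<in> M"
    using M normal_in_iff[OF K] by auto
  note car = subgroup.mem_carrier[OF K] subgroup.mem_carrier[OF M'(1)]
  have "(N #> x) \<otimes>\<^bsub>G Mod N\<^esub> (N #> m) \<otimes>\<^bsub>G Mod N\<^esub> inv\<^bsub>G Mod N\<^esub> (N #> x) \<in> (#>) N ` M"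
    if "x \<in> K" "m \<in> M" for x m
    using that M'(3) car by (simp add: coset_mult coset_inv del: mult_FactGroup)
  then show ?thesis
    unfolding Q.normal_in_iff[OF subgroup_coset_image[OF K]]
    using subgroup_coset_image[OF M'(1)] M'(2) by blast
qed

lemma subnormal_coset_image: "subnormal G M \<Longrightarrow> subnormal (G Mod N) ((#>) N ` M)"
proof (induction rule: subnormal.induct)
  case self
  have "(#>) N ` carrier G = carrier (G Mod N)" by (simp add: carrier_FactGroup)
  then show ?case using subnormal.self[of "G Mod N"] by simp
next
  case (step K M)
  then show ?case using subnormal.step[OF step.IH] normal_coset_image subnormal_subgroup by blast
qed

lemma coset_in_image:
  assumes V: "subgroup V G" "N \<subseteq> V" and x: "x \<in> carrier G" "N #> x \<in> (#>) N ` V"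
  shows "x \<in> V"
proof -
  obtain v where v: "v \<in> V" "N #> x = N #> v" using x by auto
  then have "x \<otimes> inv v \<in> V" using coset_eq_iff[OF x(1)] V subgroup.mem_carrier[OF V(1)] by auto
  moreover have "x = x \<otimes> inv v \<otimes> v" using x v subgroup.mem_carrier[OF V(1)] by (simp add: m_assoc)
  ultimately show ?thesis using v subgroup.m_closed[OF V(1)] by metis
qed

lemma coset_image_subset_iff:
  assumes "subgroup V G" "N \<subseteq> V" "W \<subseteq> carrier G"
  shows "(#>) N ` W \<subseteq> (#>) N ` V \<longleftrightarrow> W \<subseteq> V"
  using coset_in_image[OF assms(1,2)] assms(3) by blast

lemma coset_image_Int:
  assumes "subgroup V G" "N \<subseteq> V" "W \<subseteq> carrier G"
  shows "(#>) N ` V \<inter> (#>) N ` W = (#>) N ` (V \<inter> W)"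
  using coset_in_image[OF assms(1,2)] assms(3) by blast

lemma subgroup_coset_preimage:
  assumes U: "subgroup U (G Mod N)"
  shows "subgroup {x \<in> carrier G. N #> x \<in> U} G" (is "subgroup ?V G")
    and "N \<subseteq> {x \<in> carrier G. N #> x \<in> U}"
    and "(#>) N ` {x \<in> carrier G. N #> x \<in> U} = U"
proof -
  note sN = normal_imp_subgroup[OF N]
  interpret Q: group "G Mod N" using N by (rule normal.factorgroup_is_group)
  have one: "N #> x \<in> U" if "x \<in> N" for x
    using coset_eq_one_iff[of x] that subgroup.mem_carrier[OF sN that] subgroup.one_closed[OF U] by metis
  show NV: "N \<subseteq> ?V" using one subgroup.mem_carrier[OF sN] by blast
  show "subgroup ?V G"
  proof (rule subgroupI)
    show "?V \<noteq> {}" using NV subgroup.one_closed[OF sN] by blast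
    show "inv x \<in> ?V" if "x \<in> ?V" for x
      using that subgroup.m_inv_closed[OF U, of "N #> x"] coset_inv[of x] by simp
    show "x \<otimes> y \<in> ?V" if "x \<in> ?V" "y \<in> ?V" for x y
      using that subgroup.m_closed[OF U, of "N #> x" "N #> y"] coset_mult[of x y]
      by (simp del: mult_FactGroup)
  qed auto
  show "(#>) N ` ?V = U" using subgroup.subset[OF U] by (auto simp: carrier_FactGroup)
qed

lemma normal_coset_preimage:
  assumes U: "U \<lhd> G Mod N"
  shows "{x \<in> carrier G. N #> x \<in> U} \<lhd> G"
proof (rule normal_invI)
  interpret Q: group "G Mod N" using N by (rule normal.factorgroup_is_group)
  show "subgroup {x \<in> carrier G. N #> x \<in> U} G"
    by (rule subgroup_coset_preimage(1)[OF normal_imp_subgroup[OF U]])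
  fix x f assume x: "x \<in> carrier G" and f: "f \<in> {x \<in> carrier G. N #> x \<in> U}"
  then have f': "f \<in> carrier G" "N #> f \<in> U" by auto
  have "(N #> x) \<otimes>\<^bsub>G Mod N\<^esub> (N #> f) \<otimes>\<^bsub>G Mod N\<^esub> inv\<^bsub>G Mod N\<^esub> (N #> x) \<in> U"
    using Q.normal_invE(2)[OF U coset_in_carrier[OF x] f'(2)] .
  then show "x \<otimes> f \<otimes> inv x \<in> {x \<in> carrier G. N #> x \<in> U}"
    using x f' by (simp add: coset_mult coset_inv del: mult_FactGroup)
qed

lemma conj_coset_image:
  assumes "V \<subseteq> carrier G" "g \<in> carrier G"
  shows "conj_subgroup (G Mod N) ((#>) N ` V) (N #> g) = (#>) N ` conj_subgroup G V g"
  unfolding conj_subgroup_def image_image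
  using assms by (intro image_cong) (auto simp: coset_mult coset_inv subset_iff simp del: mult_FactGroup)

end

lemma FactGroup_sub_pow:
  fixes n :: nat
  assumes H: "subgroup H G" and S: "S \<lhd> G\<lparr>carrier := H\<rparr>" and x: "x \<in> H"
  shows "(S #> x) [^]\<^bsub>G\<lparr>carrier := H\<rparr> Mod S\<^esub> n = \<one>\<^bsub>G\<lparr>carrier := H\<rparr> Mod S\<^esub> \<longleftrightarrow> x [^] n \<in> S"
  using group.FactGroup_pow_eq_one[OF subgroup_imp_group[OF H] S, of x n] x
  by (simp add: nat_pow_consistent[symmetric])

end

section \<open>Radicals of Fitting sets\<close>

context group
begin

context
  fixes \<F>
  assumes \<F>: "fitting_set G \<F>" and fin: "finite (carrier G)"
begin

lemma fitting_set_subgroup: "S \<in> \<F> \<Longrightarrow> subgroup S G"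
  using \<F> unfolding fitting_set_def by blast

lemma fitting_set_normal: "S \<in> \<F> \<Longrightarrow> T \<lhd> G\<lparr>carrier := S\<rparr> \<Longrightarrow> T \<in> \<F>"
  using \<F> unfolding fitting_set_def by blast

lemma one_in_fitting_set: "{\<one>} \<in> \<F>"
proof -
  obtain S where S: "S \<in> \<F>" using \<F> unfolding fitting_set_def by blast
  then interpret S: group "G\<lparr>carrier := S\<rparr>" using fitting_set_subgroup subgroup_imp_group by blast
  show ?thesis using fitting_set_normal[OF S] S.one_is_normal by simp
qed

lemma fitting_set_mult:
  assumes "subgroup H G" "S \<lhd> G\<lparr>carrier := H\<rparr>" "T \<lhd> G\<lparr>carrier := H\<rparr>" "S \<in> \<F>" "T \<in> \<F>"
  shows "S <#> T \<in> \<F>"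
proof -
  interpret H: group "G\<lparr>carrier := H\<rparr>" using assms(1) by (rule subgroup_imp_group)
  have "S <#> T \<lhd> G\<lparr>carrier := H\<rparr>" using H.normal_set_mult[OF assms(2,3)] by simp
  then have ST: "subgroup (S <#> T) G" "S <#> T \<subseteq> H" using normal_in_iff[OF assms(1)] by auto
  have "S \<lhd> G\<lparr>carrier := S <#> T\<rparr>" "T \<lhd> G\<lparr>carrier := S <#> T\<rparr>"
    using assms ST set_mult_contains[of S T] normal_in_iff[OF assms(1)] normal_in_iff[OF ST(1)]
    by (auto 0 4)
  then show ?thesis using \<F> assms unfolding fitting_set_def by blast
qed

lemma radical_in: "subgroup H G \<Longrightarrow> radical G \<F> H \<in> \<F>"
  and radical_normal: "subgroup H G \<Longrightarrow> radical G \<F> H \<lhd> G\<lparr>carrier := H\<rparr>"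
proof -
  let ?H = "G\<lparr>carrier := H\<rparr>"
  assume H: "subgroup H G"
  interpret H: group "?H" using H by (rule subgroup_imp_group)
  let ?N = "{N \<in> \<F>. N \<lhd> ?H}"
  have "finite (carrier ?H)" using finite_subgroup[OF fin H] by simp
  note * = H.normal_join_induct[of ?N "\<lambda>N. N \<in> \<F>", OF this]
  have "subgroup_prod ?H ?N \<in> \<F>"
    by (rule *) (use one_in_fitting_set fitting_set_mult[OF H] in auto)
  moreover have "subgroup_prod ?H ?N \<lhd> ?H"
    by (rule *) (use one_in_fitting_set fitting_set_mult[OF H] in auto)
  moreover have "subgroup_prod ?H ?N = radical G \<F> H"
    unfolding radical_def using normal_in_iff[OF H] by (intro subgroup_prod_consistent[OF H]) auto
  ultimately show "radical G \<F> H \<in> \<F>" "radical G \<F> H \<lhd> ?H" by auto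
qed

lemma radical_contains:
  "N \<in> \<F> \<Longrightarrow> N \<lhd> G\<lparr>carrier := H\<rparr> \<Longrightarrow> N \<subseteq> radical G \<F> H"
  unfolding radical_def subgroup_prod_def by (auto intro: generate.incl)

lemma radical_subset: "subgroup H G \<Longrightarrow> radical G \<F> H \<subseteq> H"
  using radical_normal normal_in_iff by blast

lemma subgroup_radical: "subgroup H G \<Longrightarrow> subgroup (radical G \<F> H) G"
  using radical_in fitting_set_subgroup by blast

text \<open>A Fitting set is closed under conjugation, so conjugating with an element of \<open>K\<close> only permutes
  the normal subgroups of \<open>N\<close> that belong to it.\<close>

lemma radical_of_normal:
  assumes K: "subgroup K G" and N: "N \<lhd> G\<lparr>carrier := K\<rparr>"
  shows "radical G \<F> N \<lhd> G\<lparr>carrier := K\<rparr>"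
proof -
  let ?R = "radical G \<F> N"
  have N': "subgroup N G" "N \<subseteq> K" "\<And>x n. x \<in> K \<Longrightarrow> n \<in> N \<Longrightarrow> x \<otimes> n \<otimes> inv x \<in> N"
    using N normal_in_iff[OF K] by auto
  have R: "?R \<in> \<F>" "subgroup ?R G" "?R \<subseteq> N" "\<And>x n. x \<in> N \<Longrightarrow> n \<in> ?R \<Longrightarrow> x \<otimes> n \<otimes> inv x \<in> ?R"
    using radical_in radical_normal N'(1) normal_in_iff by auto
  note car = subgroup.subset[OF K, THEN subsetD] subgroup.subset[OF N'(1), THEN subsetD]
  have "x \<otimes> r \<otimes> inv x \<in> ?R" if x: "x \<in> K" and r: "r \<in> ?R" for x r
  proof -
    let ?C = "conj_subgroup G ?R (inv x)"
    have C: "?C = (\<lambda>s. x \<otimes> s \<otimes> inv x) ` ?R"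
      unfolding conj_subgroup_def using x car by simp
    have CF: "?C \<in> \<F>" using R(1) \<F> x car unfolding fitting_set_def by simp
    moreover have "?C \<lhd> G\<lparr>carrier := N\<rparr>"
      unfolding normal_in_iff[OF N'(1)]
    proof (intro conjI ballI)
      show "subgroup ?C G" using CF by (rule fitting_set_subgroup)
      show "?C \<subseteq> N" using C R(3) N'(3) x by auto
      fix n c assume n: "n \<in> N" and "c \<in> ?C"
      then obtain s where s: "s \<in> ?R" "c = x \<otimes> s \<otimes> inv x" using C by auto
      let ?m = "inv x \<otimes> n \<otimes> x"
      have "inv x \<otimes> n \<otimes> inv (inv x) \<in> N" using x n K N'(3) subgroup.m_inv_closed by metis
      then have "?m \<in> N" using x car by simp
      moreover have "n \<otimes> c \<otimes> inv n = x \<otimes> (?m \<otimes> s \<otimes> inv ?m) \<otimes> inv x"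
        using s n x car R(3) by (simp add: m_assoc inv_mult_group inv_cancel_left subset_iff)
      ultimately show "n \<otimes> c \<otimes> inv n \<in> ?C" using C R(4) s by auto
    qed
    ultimately have "?C \<subseteq> ?R" by (rule radical_contains)
    then show ?thesis using C r by auto
  qed
  then show ?thesis using R N' normal_in_iff[OF K] by auto
qed

text \<open>Moving up a subnormal chain, the radical of each term is normal in the next one and so lies in
  the next radical.\<close>

lemma radical_of_subnormal:
  "subnormal G N \<Longrightarrow> radical G \<F> N \<subseteq> radical G \<F> (carrier G)"
proof (induction rule: subnormal.induct)
  case (step K N)
  then have K: "subgroup K G" using subnormal_subgroup by auto
  then have "subgroup N G" using step normal_in_iff by auto
  then have "radical G \<F> N \<subseteq> radical G \<F> K"
    using radical_contains radical_of_normal[OF K step.hyps(2)] radical_in by blast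
  then show ?case using step by auto
qed auto

lemma subnormal_in_radical:
  assumes "subnormal G N" "N \<in> \<F>"
  shows "N \<subseteq> radical G \<F> (carrier G)"
proof -
  have "N \<lhd> G\<lparr>carrier := N\<rparr>"
    using group.normal_self[OF subgroup_imp_group[OF fitting_set_subgroup[OF assms(2)]]] by simp
  then show ?thesis using radical_contains[OF assms(2)] radical_of_subnormal[OF assms(1)] by blast
qed

lemma subnormal_Int_in_fitting_set:
  assumes "V \<in> \<F>"
  shows "subnormal G N \<Longrightarrow> V \<inter> N \<in> \<F>"
proof (induction rule: subnormal.induct)
  case self
  then show ?case using assms fitting_set_subgroup[OF assms] subgroup.subset by (metis inf.absorb1)
next
  case (step K N)
  have V: "subgroup V G" using assms by (rule fitting_set_subgroup)
  have K: "subgroup K G" using step.hyps subnormal_subgroup by auto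
  have N: "subgroup N G" "N \<subseteq> K" "\<And>x n. x \<in> K \<Longrightarrow> n \<in> N \<Longrightarrow> x \<otimes> n \<otimes> inv x \<in> N"
    using step.hyps normal_in_iff[OF K] by auto
  have VK: "subgroup (V \<inter> K) G" "subgroup (V \<inter> N) G" using V K N subgroups_Inter_pair by auto
  have "V \<inter> N \<lhd> G\<lparr>carrier := V \<inter> K\<rparr>"
    unfolding normal_in_iff[OF VK(1)] using VK N V
    by (auto intro!: subgroup.m_closed subgroup.m_inv_closed)
  then show ?case using step.IH fitting_set_normal by blast
qed

end

end

section \<open>Elements of prime power order\<close>

definition p_element :: "('a, 'b) monoid_scheme \<Rightarrow> nat \<Rightarrow> 'a \<Rightarrow> bool" where
  "p_element G p x \<longleftrightarrow> x \<in> carrier G \<and> (\<exists>k. x [^]\<^bsub>G\<^esub> (p ^ k) = \<one>\<^bsub>G\<^esub>)"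

lemma nat_prime_part:
  fixes n p :: nat
  assumes "prime p" "n > 0"
  obtains a m where "n = p ^ a * m" "\<not> p dvd m"
  using multiplicity_decompose'[of n p] assms by (metis not_prime_unit not_less0)

lemma coprime_prime_power: "prime p \<Longrightarrow> \<not> p dvd m \<Longrightarrow> coprime (p ^ k) m" for p m :: nat
  by (simp add: prime_imp_coprime)

lemma coprime_distinct_primes_power:
  "prime p \<Longrightarrow> prime q \<Longrightarrow> p \<noteq> q \<Longrightarrow> coprime (p ^ k) (q ^ l)" for p q :: nat
  using primes_coprime[of p q] by simp

context group
begin

lemma pow_coprime_mem:
  fixes a b :: nat
  assumes D: "subgroup D G" and x: "x \<in> carrier G" and "x [^] a \<in> D" "x [^] b \<in> D" "coprime a b"
  shows "x \<in> D"
proof (cases "a = 0")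
  case True
  then show ?thesis using assms by simp
next
  case False
  then obtain s k where "a * s = b * k + gcd a b" using bezout_nat by blast
  then have "a * s = b * k + 1" using assms(5) by simp
  then have "(x [^] a) [^] s = (x [^] b) [^] k \<otimes> x"
    using x by (simp add: nat_pow_pow)
  then have "x = inv ((x [^] b) [^] k) \<otimes> (x [^] a) [^] s"
    using x by (simp add: inv_solve_left)
  then show ?thesis
    using assms(3,4) pow_mem[OF D] by (metis D subgroup.m_closed subgroup.m_inv_closed)
qed

lemma pow_coprime_one:
  fixes a b :: nat
  assumes "x \<in> carrier G" "x [^] a = \<one>" "x [^] b = \<one>" "coprime a b"
  shows "x = \<one>"
  using pow_coprime_mem[OF triv_subgroup, of x a b] assms by simp

text \<open>The primary decomposition of an element into powers of itself. The exponent of the part of order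
  prime to \<open>p\<close> can be made divisible by any given power of \<open>p\<close>; this is what allows elements to be
  lifted from quotients, see \<open>p_element_lift\<close>.\<close>

lemma power_decomposition:
  fixes p a m K :: nat
  assumes x: "x \<in> carrier G" and p: "prime p" and m: "\<not> p dvd m" and 1: "x [^] (p ^ a * m) = \<one>"
  obtains u v :: nat where "x = x [^] u \<otimes> x [^] v" "(x [^] u) [^] (p ^ a) = \<one>"
    "(x [^] v) [^] m = \<one>" "p ^ K dvd v"
proof -
  \<comment> \<open>By the Chinese remainder theorem \<open>u\<close> is \<open>1\<close> modulo \<open>p ^ e\<close> and \<open>0\<close> modulo \<open>m\<close>, and \<open>v\<close> is the
    opposite. The exponent \<open>e\<close> has to be at least \<open>a\<close> for \<open>x [^] v\<close>, and at least \<open>K\<close> for \<open>v\<close>.\<close>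
  define e where "e = max a K"
  have cop: "coprime (p ^ e) m" "coprime m (p ^ e)"
    using coprime_prime_power[OF p m] by (auto simp: coprime_commute)
  obtain s where s: "[m * s = 1] (mod p ^ e)" using cong_solve_coprime_nat[OF cop(2)] by auto
  obtain t where t: "[p ^ e * t = 1] (mod m)" using cong_solve_coprime_nat[OF cop(1)] by auto
  define u v where "u = m * s" and "v = p ^ e * t"
  have pa: "p ^ a dvd p ^ e" "p ^ K dvd p ^ e" unfolding e_def by (simp_all add: le_imp_power_dvd)
  have "[u + v = 1 + 0] (mod p ^ e)" unfolding u_def v_def by (intro cong_add s) (simp add: cong_def)
  moreover have "[u + v = 0 + 1] (mod m)" unfolding u_def v_def by (intro cong_add t) (simp add: cong_def)
  ultimately have "[u + v = 1] (mod p ^ e * m)" using coprime_cong_mult_nat[OF _ _ cop(1)] by simp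
  then have "[u + v = 1] (mod p ^ a * m)" using cong_dvd_modulus_nat pa by (meson dvd_refl mult_dvd_mono)
  then obtain k1 k2 where "1 + k1 * (p ^ a * m) = u + v + k2 * (p ^ a * m)"
    by (auto simp: cong_iff_lin_nat)
  then have "x [^] (1 + k1 * (p ^ a * m)) = x [^] (u + v + k2 * (p ^ a * m))" by simp
  moreover have "x [^] (c + k * (p ^ a * m)) = x [^] c" for c k :: nat
    using x 1 nat_pow_pow[of x "p ^ a * m" k] by (simp add: nat_pow_mult[symmetric] mult.commute)
  ultimately have "x [^] (1 :: nat) = x [^] (u + v)" by metis
  then have "x = x [^] (u + v)" using x by simp
  then have "x = x [^] u \<otimes> x [^] v" using x by (simp add: nat_pow_mult)
  moreover have "x [^] n = \<one>" if "p ^ a * m dvd n" for n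
    using that pow_eq_id[OF x] 1 by (meson dvd_trans)
  then have "(x [^] u) [^] (p ^ a) = \<one>" "(x [^] v) [^] m = \<one>"
    using pa x by (auto simp: nat_pow_pow u_def v_def mult_ac intro!: mult_dvd_mono)
  ultimately show ?thesis using that pa unfolding v_def by (meson dvd_mult2)
qed

lemma pow_finite:
  fixes p :: nat
  assumes "finite (carrier G)" "x \<in> carrier G" "prime p"
  obtains a m :: nat where "\<not> p dvd m" "x [^] (p ^ a * m) = \<one>"
  using nat_prime_part[OF assms(3), of "order G"] assms pow_order_eq_1 order_gt_0_iff_finite by metis

lemma p_element_finite_decomposition:
  fixes p K :: nat
  assumes "finite (carrier G)" "x \<in> carrier G" "prime p"
  obtains u v m :: nat where "x = x [^] u \<otimes> x [^] v" "p_element G p (x [^] u)"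
    "\<not> p dvd m" "(x [^] v) [^] m = \<one>" "p ^ K dvd v"
proof -
  obtain a m :: nat where "\<not> p dvd m" "x [^] (p ^ a * m) = \<one>" using pow_finite[OF assms] .
  then show ?thesis using power_decomposition[OF assms(2,3), of m a K] that assms(2)
    unfolding p_element_def by (metis nat_pow_closed)
qed

text \<open>An element of finite order is a product of powers of itself that have prime power order.\<close>

lemma primary_generation:
  fixes m :: nat
  assumes "subgroup H G" "y \<in> carrier G" "m > 0" "y [^] m = \<one>"
    "\<And>q j k. prime q \<Longrightarrow> q dvd m \<Longrightarrow> (y [^] (j :: nat)) [^] (q ^ k) = \<one> \<Longrightarrow> y [^] j \<in> H"
  shows "y \<in> H"
  using assms(2-)
proof (induction m arbitrary: y rule: less_induct)
  case (less m)
  show ?case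
  proof (cases "m = 1")
    case True
    then show ?thesis using less.prems subgroup.one_closed[OF assms(1)] by simp
  next
    case False
    then obtain q where q: "prime q" "q dvd m" using prime_factor_nat by blast
    obtain a m' where m': "m = q ^ a * m'" "\<not> q dvd m'"
      using nat_prime_part[OF q(1) less.prems(2)] .
    have "y [^] (q ^ a * m') = \<one>" using less.prems(3) m'(1) by simp
    then obtain u v :: nat where uv: "y = y [^] u \<otimes> y [^] v" "(y [^] u) [^] (q ^ a) = \<one>" "(y [^] v) [^] m' = \<one>"
      by (rule power_decomposition[OF less.prems(1) q(1) m'(2), where K = 0]) (rule that)
    have "a > 0" using q m' by (cases a) auto
    then have "q ^ a > 1" using q(1) prime_gt_1_nat one_less_power by blast
    then have "m' < m" using m' less.prems(2) by (cases "m' = 0") auto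
    moreover have "m' > 0" using m' less.prems(2) by (cases m') auto
    moreover have "(y [^] v) [^] j \<in> H"
      if "prime r" "r dvd m'" "((y [^] v) [^] j) [^] (r ^ k) = \<one>" for r j k :: nat
      using less.prems(4)[OF that(1), of "v * j" k] that(2,3) m'(1) less.prems(1)
      by (simp add: nat_pow_pow)
    ultimately have "y [^] v \<in> H" using less.IH[of m' "y [^] v"] less.prems(1) uv(3) by blast
    moreover have "y [^] u \<in> H" using less.prems(4)[OF q uv(2)] .
    ultimately show ?thesis using uv(1) subgroup.m_closed[OF assms(1)] by metis
  qed
qed

lemma commute_by_primary:
  fixes m :: nat
  assumes x: "x \<in> carrier G" and y: "y \<in> carrier G" "m > 0" "y [^] m = \<one>"
    and prim: "\<And>q j. prime q \<Longrightarrow> q dvd m \<Longrightarrow> p_element G q (y [^] (j :: nat)) \<Longrightarrow>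
      x \<otimes> y [^] j = y [^] j \<otimes> x"
  shows "x \<otimes> y = y \<otimes> x"
proof -
  have "y \<in> centralizer G {x}"
    using y prim[symmetric] x by (intro primary_generation[OF centralizer_subgroup, of "{x}" y m])
      (auto simp: centralizer_def p_element_def)
  then show ?thesis by (simp add: centralizer_def)
qed

lemma p_element_subgroup:
  assumes "subgroup H G"
  shows "p_element (G\<lparr>carrier := H\<rparr>) p x \<longleftrightarrow> x \<in> H \<and> p_element G p x"
  using subgroup.mem_carrier[OF assms] by (auto simp: p_element_def nat_pow_consistent[symmetric])

lemma p_element_commute_mult:
  assumes "p_element G p x" "p_element G p y" "x \<otimes> y = y \<otimes> x"
  shows "p_element G p (x \<otimes> y)"
proof -
  obtain k l where kl: "x [^] (p ^ k) = \<one>" "y [^] (p ^ l) = \<one>" "x \<in> carrier G" "y \<in> carrier G"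
    using assms unfolding p_element_def by auto
  have "(x \<otimes> y) [^] (p ^ (k + l)) = x [^] (p ^ k * p ^ l) \<otimes> y [^] (p ^ l * p ^ k)"
    using pow_mult_distrib[OF assms(3) kl(3,4)] by (simp only: power_add mult.commute)
  also have "\<dots> = \<one>" using kl by (simp add: nat_pow_pow[symmetric])
  finally show ?thesis using kl unfolding p_element_def by blast
qed

lemma p_element_inv: "p_element G p x \<Longrightarrow> p_element G p (inv x)"
  by (auto simp: p_element_def nat_pow_inv)

lemma conj_pow:
  "g \<in> carrier G \<Longrightarrow> x \<in> carrier G \<Longrightarrow> (g \<otimes> x \<otimes> inv g) [^] (n :: nat) = g \<otimes> x [^] n \<otimes> inv g"
  by (induction n) (simp_all add: m_assoc inv_cancel_left)

lemma p_element_conj: "p_element G p x \<Longrightarrow> g \<in> carrier G \<Longrightarrow> p_element G p (g \<otimes> x \<otimes> inv g)"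
  unfolding p_element_def by (metis conj_pow inv_closed m_closed r_inv r_one)

lemma p_element_conj': "p_element G p x \<Longrightarrow> g \<in> carrier G \<Longrightarrow> p_element G p (inv g \<otimes> x \<otimes> g)"
  using p_element_conj[of p x "inv g"] by simp

lemma p_element_one: "p_element G p \<one>"
  by (auto simp: p_element_def)

lemma p_element_FactGroup:
  assumes "N \<lhd> G" "x \<in> carrier G"
  shows "p_element (G Mod N) p (N #> x) \<longleftrightarrow> (\<exists>k. x [^] (p ^ k) \<in> N)"
  unfolding p_element_def FactGroup_pow_eq_one[OF assms] using assms(2) by (auto simp: carrier_FactGroup)

text \<open>If \<open>x\<close> has \<open>p\<close>-power order modulo \<open>N\<close>, then its part of order prime to \<open>p\<close> lies in \<open>N\<close> and can
  be dropped from the representative.\<close>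

lemma p_element_lift:
  fixes k :: nat
  assumes fin: "finite (carrier G)" and N: "N \<lhd> G" and p: "prime p" and x: "x \<in> carrier G" "x [^] (p ^ k) \<in> N"
  obtains u :: nat where "p_element G p (x [^] u)" "N #> x = N #> (x [^] u)"
proof -
  have sN: "subgroup N G" using N normal_imp_subgroup by blast
  obtain u v m :: nat where uv: "x = x [^] u \<otimes> x [^] v" "p_element G p (x [^] u)" "p ^ k dvd v"
    using p_element_finite_decomposition[OF fin x(1) p, of k] by metis
  obtain w where "v = p ^ k * w" using uv(3) by auto
  then have "x [^] v = (x [^] (p ^ k)) [^] w" using x(1) by (simp add: nat_pow_pow)
  then have v: "x [^] v \<in> N" using pow_mem[OF sN x(2)] by simp
  have "x = x [^] v \<otimes> x [^] u" using uv(1) x(1) by (simp add: nat_pow_mult add.commute)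
  then have "N #> x = (N #> x [^] v) #> x [^] u"
    using x(1) coset_mult_assoc[OF subgroup.subset[OF sN]] by (metis nat_pow_closed)
  also have "N #> x [^] v = N" using v sN x(1) by (intro coset_join2) auto
  finally show ?thesis using that uv by blast
qed

lemma p_elementI:
  fixes p :: nat
  assumes fin: "finite (carrier G)" and p: "prime p" and z: "z \<in> carrier G"
    and tor: "\<And>q. prime q \<Longrightarrow> q \<noteq> p \<Longrightarrow> \<exists>n :: nat. \<not> q dvd n \<and> z [^] n = \<one>"
  shows "p_element G p z"
proof -
  obtain a m :: nat where m: "\<not> p dvd m" "z [^] (p ^ a * m) = \<one>" using pow_finite[OF fin z p] .
  let ?y = "z [^] (p ^ a)"
  have yc: "?y \<in> carrier G" using z by simp
  have "?y [^] m = \<one>" using m(2) z by (simp add: nat_pow_pow)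
  then have om: "ord ?y dvd m" using pow_eq_id[OF yc] by simp
  have "ord ?y = 1"
  proof (rule ccontr)
    assume "ord ?y \<noteq> 1"
    then obtain q where q: "prime q" "q dvd ord ?y" using prime_factor_nat by blast
    then have "q \<noteq> p" using om m(1) by auto
    then obtain n :: nat where n: "\<not> q dvd n" "z [^] n = \<one>" using tor q(1) by blast
    have "?y [^] n = (z [^] n) [^] (p ^ a)" using z by (simp add: nat_pow_pow mult.commute)
    then have "?y [^] n = \<one>" using n(2) by simp
    then have "ord ?y dvd n" using pow_eq_id[OF yc] by simp
    then show False using q n by auto
  qed
  then have "?y = \<one>" using ord_eq_1[OF yc] by simp
  then show ?thesis using z unfolding p_element_def by blast
qed

text \<open>Modulo \<open>N\<close> the factor \<open>n\<close> disappears from \<open>n \<otimes> g\<close>, hence also from its powers.\<close>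

lemma pow_mult_normal:
  assumes N: "N \<lhd> G" and n: "n \<in> N" and g: "g \<in> carrier G"
  shows "\<exists>n'\<in>N. (n \<otimes> g) [^] (k :: nat) = n' \<otimes> g [^] k"
proof (induction k)
  case 0
  then show ?case using subgroup.one_closed[OF normal_invE(1)[OF N]] by (auto intro: bexI[of _ \<one>])
next
  case (Suc k)
  note car = subgroup.mem_carrier[OF normal_invE(1)[OF N]]
  obtain n' where n': "n' \<in> N" "(n \<otimes> g) [^] k = n' \<otimes> g [^] k" using Suc by auto
  have "(n \<otimes> g) [^] Suc k = (n' \<otimes> (g [^] k \<otimes> n \<otimes> inv (g [^] k))) \<otimes> g [^] Suc k"
    using n' n g car by (simp add: m_assoc inv_cancel_left)
  moreover have "n' \<otimes> (g [^] k \<otimes> n \<otimes> inv (g [^] k)) \<in> N"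
    using n n' g by (intro subgroup.m_closed[OF normal_invE(1)[OF N]] normal_invE(2)[OF N]) auto
  ultimately show ?case by blast
qed

lemma p_element_mult_normal:
  assumes P: "P \<lhd> G" "\<And>x. x \<in> P \<Longrightarrow> p_element G p x" and a: "a \<in> P" and b: "p_element G p b"
  shows "p_element G p (a \<otimes> b)"
proof -
  note car = subgroup.mem_carrier[OF normal_invE(1)[OF P(1)]]
  obtain k where k: "b \<in> carrier G" "b [^] (p ^ k) = \<one>" using b by (auto simp: p_element_def)
  then obtain n' where "n' \<in> P" "(a \<otimes> b) [^] (p ^ k) = n'"
    using pow_mult_normal[OF P(1) a k(1), of "p ^ k"] car by auto
  then obtain l where "(a \<otimes> b) [^] (p ^ k * p ^ l) = \<one>"
    using P(2) a k car unfolding p_element_def by (metis m_closed nat_pow_pow)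
  then show ?thesis unfolding p_element_def power_add[symmetric] using a k car by blast
qed

text \<open>The exponent for \<open>a\<close> takes \<open>a \<otimes> b\<close> into \<open>B\<close> modulo \<open>D\<close>; the exponent for the resulting element
  of \<open>B\<close> then takes it into \<open>D\<close>.\<close>

lemma p'_mod_set_mult:
  fixes p :: nat
  assumes p: "prime p" and D: "D \<lhd> G" and B: "B \<lhd> G"
    and A': "\<And>x. x \<in> A \<Longrightarrow> x \<in> carrier G \<and> (\<exists>n :: nat. \<not> p dvd n \<and> x [^] n \<in> D)"
    and B': "\<And>x. x \<in> B \<Longrightarrow> \<exists>n :: nat. \<not> p dvd n \<and> x [^] n \<in> D"
    and x: "x \<in> A <#> B"
  shows "\<exists>n :: nat. \<not> p dvd n \<and> x [^] n \<in> D"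
proof -
  obtain a b where ab: "a \<in> A" "b \<in> B" "x = a \<otimes> b" using x by (auto simp: set_mult_def)
  note sB = normal_invE(1)[OF B] and sD = normal_invE(1)[OF D]
  note car = subgroup.mem_carrier[OF sB] subgroup.mem_carrier[OF sD]
  have ac: "a \<in> carrier G" using A' ab by auto
  obtain n :: nat where n: "\<not> p dvd n" "a [^] n \<in> D" using A' ab by blast
  have "x = (a \<otimes> b \<otimes> inv a) \<otimes> a" using ab ac car by (simp add: m_assoc)
  then obtain b' where b': "b' \<in> B" "x [^] n = b' \<otimes> a [^] n"
    using pow_mult_normal[OF B normal_invE(2)[OF B ac ab(2)] ac, of n] by auto
  define d where "d = b' \<otimes> a [^] n \<otimes> inv b'"
  have d: "d \<in> D" unfolding d_def using normal_invE(2)[OF D _ n(2)] b' car by blast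
  have xd: "x [^] n = d \<otimes> b'" unfolding d_def using b' car ac by (simp add: m_assoc)
  obtain m :: nat where m: "\<not> p dvd m" "b' [^] m \<in> D" using B' b' by blast
  obtain d' where d': "d' \<in> D" "(d \<otimes> b') [^] m = d' \<otimes> b' [^] m"
    using pow_mult_normal[OF D d, of b' m] b' car by auto
  have "x [^] (n * m) = d' \<otimes> b' [^] m"
    using d'(2) xd ab ac car by (metis m_closed nat_pow_pow)
  then have "x [^] (n * m) \<in> D" using d' m subgroup.m_closed[OF sD] by simp
  moreover have "\<not> p dvd n * m" using n m p prime_dvd_mult_iff by blast
  ultimately show ?thesis by blast
qed

lemma p'_mod_join:
  fixes p :: nat
  assumes fin: "finite (carrier G)" and p: "prime p" and D: "D \<lhd> G"
    and N: "\<And>N. N \<in> \<N> \<Longrightarrow> N \<lhd> G"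
    and N': "\<And>N x. N \<in> \<N> \<Longrightarrow> x \<in> N \<Longrightarrow> \<exists>n :: nat. \<not> p dvd n \<and> x [^] n \<in> D"
    and x: "x \<in> subgroup_prod G \<N>"
  shows "\<exists>n :: nat. \<not> p dvd n \<and> x [^] n \<in> D"
proof -
  let ?Q = "\<lambda>A. \<forall>x\<in>A. x \<in> carrier G \<and> (\<exists>n :: nat. \<not> p dvd n \<and> x [^] n \<in> D)"
  have one: "\<one> \<in> D" using subgroup.one_closed[OF normal_invE(1)[OF D]] .
  have np: "\<not> p dvd 1" using p not_prime_unit by blast
  have "?Q (subgroup_prod G \<N>)"
  proof (rule normal_join_induct[OF fin N])
    show "?Q {\<one>}" using one np by (auto intro!: exI[of _ 1])
    show "?Q M" if "M \<in> \<N>" for M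
      using N'[OF that] subgroup.subset[OF normal_invE(1)[OF N[OF that]]] by auto
    show "?Q (A <#> B)" if "A \<lhd> G" "B \<lhd> G" "?Q A" "?Q B" for A B
      using p'_mod_set_mult[OF p D that(2), of A] that(3,4)
        subgroup.subset[OF normal_invE(1)[OF normal_set_mult[OF that(1,2)]]] by blast
  qed
  then show ?thesis using x by blast
qed

end

section \<open>Groups of prime power order and Sylow subgroups\<close>

definition p_subgroup_of :: "('a, 'b) monoid_scheme \<Rightarrow> nat \<Rightarrow> 'a set \<Rightarrow> 'a set \<Rightarrow> bool" where
  "p_subgroup_of G p C P \<longleftrightarrow> subgroup P G \<and> P \<subseteq> C \<and> (\<forall>x\<in>P. p_element G p x)"

text \<open>For a prime \<open>p\<close> and a subgroup \<open>C\<close> of a finite group these are the Sylow \<open>p\<close>-subgroups of \<open>C\<close>.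
  With maximality as the definition, finiteness alone gives one that contains a prescribed
  \<open>p\<close>-subgroup.\<close>

definition max_p_subgroup_of :: "('a, 'b) monoid_scheme \<Rightarrow> nat \<Rightarrow> 'a set \<Rightarrow> 'a set \<Rightarrow> bool" where
  "max_p_subgroup_of G p C P \<longleftrightarrow>
     p_subgroup_of G p C P \<and> (\<forall>Q. p_subgroup_of G p C Q \<longrightarrow> P \<subseteq> Q \<longrightarrow> Q = P)"

context group
begin

lemma cauchy:
  assumes "finite (carrier G)" "prime p" "p dvd order G"
  obtains x where "x \<in> carrier G" "x \<noteq> \<one>" "x [^] p = \<one>"
proof -
  obtain m where "order G = p ^ 1 * m" using assms(3) by auto
  then obtain H where H: "subgroup H G" "card H = p"
    using sylow_thm[OF assms(2) is_group _ assms(1), of 1 m] by auto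
  interpret H: group "G\<lparr>carrier := H\<rparr>" using H(1) by (rule subgroup_imp_group)
  have "card H \<ge> 2" using H(2) assms(2) prime_ge_2_nat by simp
  then have "H \<noteq> {\<one>}" by auto
  then obtain x where x: "x \<in> H" "x \<noteq> \<one>" using subgroup.one_closed[OF H(1)] by auto
  have "x [^] p = \<one>"
    using H.pow_order_eq_1[of x] x H(2) by (simp add: order_def nat_pow_consistent[symmetric])
  then show ?thesis using that x subgroup.mem_carrier[OF H(1)] by blast
qed

lemma p_group_iff:
  assumes p: "prime p" and fin: "finite (carrier G)"
  shows "p_group p G \<longleftrightarrow> (\<forall>x\<in>carrier G. p_element G p x)"
proof
  assume "p_group p G"
  then show "\<forall>x\<in>carrier G. p_element G p x"
    unfolding p_group_def p_element_def using pow_order_eq_1 by metis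
next
  assume *: "\<forall>x\<in>carrier G. p_element G p x"
  obtain a m where m: "order G = p ^ a * m" "\<not> p dvd m"
    using nat_prime_part[OF p] fin order_gt_0_iff_finite by metis
  have "m = 1"
  proof (rule ccontr)
    assume "m \<noteq> 1"
    then obtain q where q: "prime q" "q dvd m" using prime_factor_nat by blast
    then obtain x where x: "x \<in> carrier G" "x \<noteq> \<one>" "x [^] q = \<one>"
      using cauchy[OF fin q(1)] m by auto
    obtain k where "x [^] (p ^ k) = \<one>" using * x(1) unfolding p_element_def by auto
    moreover have "coprime (p ^ k) q" using p q m by (metis coprime_power_left_iff primes_coprime)
    ultimately show False using pow_coprime_one x by blast
  qed
  then show "p_group p G" unfolding p_group_def using fin m is_group by auto
qed

lemma p'_group_iff:
  assumes p: "prime p" and fin: "finite (carrier G)"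
  shows "p'_group p G \<longleftrightarrow> (\<forall>x\<in>carrier G. \<exists>n :: nat. \<not> p dvd n \<and> x [^] n = \<one>)"
proof
  assume "p'_group p G"
  then show "\<forall>x\<in>carrier G. \<exists>n :: nat. \<not> p dvd n \<and> x [^] n = \<one>"
    unfolding p'_group_def using pow_order_eq_1 by metis
next
  assume *: "\<forall>x\<in>carrier G. \<exists>n :: nat. \<not> p dvd n \<and> x [^] n = \<one>"
  have "\<not> p dvd order G"
  proof
    assume "p dvd order G"
    then obtain x where x: "x \<in> carrier G" "x \<noteq> \<one>" "x [^] p = \<one>" using cauchy[OF fin p] by auto
    obtain n where "\<not> p dvd n" "x [^] n = \<one>" using * x(1) by auto
    then show False using pow_coprime_one[of x p n] x p prime_imp_coprime by blast
  qed
  then show "p'_group p G" unfolding p'_group_def using fin is_group by auto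
qed

end

text \<open>Orbits that are not fixed points have a size divisible by \<open>p\<close>.\<close>

lemma (in group_action) p_group_fixed_points:
  assumes E: "finite E" and p: "prime p" and ord: "order G = p ^ n"
  shows "[card E = card {x \<in> E. \<forall>g\<in>carrier G. \<phi> g x = x}] (mod p)"
proof -
  let ?F = "{x \<in> E. \<forall>g\<in>carrier G. \<phi> g x = x}"
  let ?C = "{orbit G \<phi> x | x. x \<in> E - ?F}"
  interpret group G using group_hom group_hom.axioms(1) by blast
  have orb_sub: "orbit G \<phi> x \<subseteq> E" if "x \<in> E" for x
    using that element_image unfolding orbit_def by blast
  have orb_eq: "orbit G \<phi> x = orbit G \<phi> y" if "x \<in> E" "y \<in> orbit G \<phi> x" for x y
    using that disjoint_union[of "orbit G \<phi> x" "orbit G \<phi> y"] orbit_refl orb_sub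
    unfolding orbits_def by blast
  have fixed: "x \<in> ?F \<longleftrightarrow> orbit G \<phi> x = {x}" if "x \<in> E" for x
    using that orbit_refl[OF that] unfolding orbit_def by auto
  have U: "\<Union>?C = E - ?F"
  proof
    show "\<Union>?C \<subseteq> E - ?F"
    proof
      fix y assume "y \<in> \<Union>?C"
      then obtain x where x: "x \<in> E" "x \<notin> ?F" "y \<in> orbit G \<phi> x" by auto
      then have y: "y \<in> E" using orb_sub by auto
      have "y \<notin> ?F"
      proof
        assume "y \<in> ?F"
        then have "orbit G \<phi> x = {y}" using fixed[OF y] orb_eq x by auto
        then show False using fixed x orbit_refl[OF x(1)] by auto
      qed
      then show "y \<in> E - ?F" using y by auto
    qed
    show "E - ?F \<subseteq> \<Union>?C" using orbit_refl by blast
  qed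
  have "p dvd card (\<Union>?C)"
  proof (rule dvd_partition)
    show "finite (\<Union>?C)" unfolding U using E by simp
    show "\<forall>c\<in>?C. p dvd card c"
    proof
      fix c assume "c \<in> ?C"
      then obtain x where x: "c = orbit G \<phi> x" "x \<in> E" "x \<notin> ?F" by auto
      have "card c dvd p ^ n" using orbit_stabilizer_theorem[OF x(2)] ord x(1) by (metis dvd_triv_left)
      then obtain i where i: "card c = p ^ i" using p divides_primepow_nat by blast
      have "i \<noteq> 0"
      proof
        assume "i = 0"
        then have "card c = 1" using i by simp
        then have "c = {x}" using orbit_refl[OF x(2)] x(1) by (metis card_1_singletonE singletonD)
        then show False using fixed x by auto
      qed
      then show "p dvd card c" using i by simp
    qed
    show "\<forall>c1\<in>?C. \<forall>c2\<in>?C. c1 \<noteq> c2 \<longrightarrow> c1 \<inter> c2 = {}"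
      using disjoint_union unfolding orbits_def by blast
  qed
  then have "p dvd card (E - ?F)" unfolding U .
  moreover have "card E = card ?F + card (E - ?F)"
    using E card_Int_Diff[of E ?F] by (simp add: Int_def)
  ultimately show ?thesis by (auto simp: cong_def elim!: dvdE)
qed

context group
begin

text \<open>The center is the set of fixed points of the action by conjugation. Their number is divisible by
  \<open>p\<close>, and the identity is one of them.\<close>

lemma p_group_center_nontrivial:
  assumes p: "prime p" and pg: "p_group p G" and nt: "carrier G \<noteq> {\<one>}"
  obtains z where "z \<in> carrier G" "z \<noteq> \<one>" "\<And>x. x \<in> carrier G \<Longrightarrow> x \<otimes> z = z \<otimes> x"
proof -
  have fin: "finite (carrier G)" using pg by (simp add: p_group_def)
  obtain n where n: "order G = p ^ n" using pg by (auto simp: p_group_def)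
  interpret A: group_action G "carrier G" "\<lambda>g. \<lambda>h\<in>carrier G. g \<otimes> h \<otimes> inv g"
    by (rule action_by_conjugation)
  let ?Z = "{x \<in> carrier G. \<forall>g\<in>carrier G. (\<lambda>h\<in>carrier G. g \<otimes> h \<otimes> inv g) x = x}"
  have "n \<noteq> 0" using n nt order_one_triv_iff by (metis power_0)
  then have "p dvd card (carrier G)" using n by (simp add: order_def)
  then have "p dvd card ?Z" using A.p_group_fixed_points[OF fin p n] cong_dvd_iff by blast
  moreover have one: "\<one> \<in> ?Z" by auto
  moreover have "finite ?Z" using fin by simp
  ultimately have "card ?Z \<ge> p" by (intro dvd_imp_le) (auto simp: card_gt_0_iff)
  then have "card ?Z \<ge> 2" using prime_ge_2_nat[OF p] by linarith
  then have "?Z \<noteq> {\<one>}" by (metis (no_types, lifting) is_singletonI is_singleton_altdef numeral_le_one_iff semiring_norm(69))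
  then obtain z where z: "z \<in> ?Z" "z \<noteq> \<one>" using one by blast
  have "x \<otimes> z = z \<otimes> x" if "x \<in> carrier G" for x
  proof -
    have "x \<otimes> z \<otimes> inv x = z" using z that by auto
    then show ?thesis using z that by (metis (lifting) inv_solve_right' m_closed mem_Collect_eq)
  qed
  then show ?thesis using that z by auto
qed

text \<open>The \<open>p\<close>-group \<open>P\<close> acts by right multiplication on the cosets of \<open>S\<close>, whose number is prime to
  \<open>p\<close>; a fixed coset \<open>S #> g\<close> provides the conjugating element.\<close>

lemma sylow_contains_conjugate:
  assumes fin: "finite (carrier G)" and p: "prime p" and S: "subgroup S G" "card S = p ^ a"
    and ord: "order G = p ^ a * m" "\<not> p dvd m" and P: "p_subgroup_of G p (carrier G) P"
  obtains g where "g \<in> carrier G" "\<And>x. x \<in> P \<Longrightarrow> g \<otimes> x \<otimes> inv g \<in> S"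
proof -
  have Ps: "subgroup P G" using P by (simp add: p_subgroup_of_def)
  note car = subgroup.mem_carrier[OF Ps] subgroup.mem_carrier[OF S(1)]
  interpret P: group "G\<lparr>carrier := P\<rparr>" using Ps by (rule subgroup_imp_group)
  have "finite P" using finite_subgroup[OF fin Ps] .
  then have "p_group p (G\<lparr>carrier := P\<rparr>)"
    using P.p_group_iff[OF p] P p_element_subgroup[OF Ps] by (auto simp: p_subgroup_of_def)
  then obtain n where n: "order (G\<lparr>carrier := P\<rparr>) = p ^ n" by (auto simp: p_group_def)
  let ?E = "rcosets S"
  let ?f = "\<lambda>x. \<lambda>C\<in>?E. C #> inv x"
  have sub: "C \<subseteq> carrier G" if "C \<in> ?E" for C
    using that S(1) by (simp add: rcosets_part_G[OF S(1), symmetric] Union_upper)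
  have cl: "C #> x \<in> ?E" if C: "C \<in> ?E" and x: "x \<in> carrier G" for C x
  proof -
    obtain h where h: "h \<in> carrier G" "C = S #> h" using C unfolding RCOSETS_def by auto
    then have "C #> x = S #> (h \<otimes> x)" using x coset_mult_assoc[OF subgroup.subset[OF S(1)]] by simp
    then show ?thesis using h x unfolding RCOSETS_def by auto
  qed
  have assoc: "(C #> x) #> y = C #> (x \<otimes> y)" if "C \<in> ?E" "x \<in> carrier G" "y \<in> carrier G" for C x y
    using that sub coset_mult_assoc by blast
  have "?f x \<in> Bij ?E" if x: "x \<in> P" for x
  proof -
    have "bij_betw (?f x) ?E ?E"
      by (rule bij_betwI[where g = "\<lambda>C. C #> x"]) (use x car cl assoc sub in auto)
    then show ?thesis by (simp add: Bij_def)
  qed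
  then have hom: "group_action (G\<lparr>carrier := P\<rparr>) ?E ?f"
    unfolding group_action_def group_hom_def group_hom_axioms_def
    using P.is_group group_BijGroup car cl assoc
    by (auto simp: hom_def BijGroup_def compose_def inv_mult_group fun_eq_iff)
  interpret A: group_action "G\<lparr>carrier := P\<rparr>" ?E ?f by (rule hom)
  let ?F = "{C \<in> ?E. \<forall>x\<in>P. ?f x C = C}"
  have "card ?E * card S = p ^ a * m" using lagrange[OF S(1)] ord(1) by simp
  then have "card ?E = m" using S(2) p by (simp add: prime_gt_0_nat)
  moreover have "[card ?E = card ?F] (mod p)"
    using A.p_group_fixed_points[OF _ p n] finite_subset[OF rcosets_subset_PowG[OF S(1)]] fin
    by simp
  ultimately have "\<not> p dvd card ?F" using ord(2) cong_dvd_iff by blast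
  then have "?F \<noteq> {}" by (metis card.empty dvd_0_right)
  then obtain C where C: "C \<in> ?E" "\<And>x. x \<in> P \<Longrightarrow> C #> inv x = C" by auto
  then obtain h where h: "h \<in> carrier G" "C = S #> h" unfolding RCOSETS_def by auto
  have "h \<otimes> x \<otimes> inv h \<in> S" if x: "x \<in> P" for x
  proof -
    have "h \<in> C" using rcos_self[OF h(1) S(1)] h by simp
    moreover have "C #> x = C"
      using C(2)[of "inv x"] x car subgroup.m_inv_closed[OF Ps] by simp
    ultimately have "h \<otimes> x \<in> S #> h" using h(2) rcosI[of h C x] sub[OF C(1)] x car by metis
    then show ?thesis using h x car subgroup.rcos_module[OF S(1) is_group] by simp
  qed
  then show ?thesis using that h by blast
qed

lemma p_subgroup_conj:
  assumes "p_subgroup_of G p C P" "g \<in> carrier G" "conj_subgroup G P g \<subseteq> C"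
  shows "p_subgroup_of G p C (conj_subgroup G P g)"
  using assms subgroup_conj_subgroup p_element_conj'
  unfolding p_subgroup_of_def by (auto simp: conj_subgroup_def)

lemma p_subgroup_in_max:
  assumes fin: "finite (carrier G)" and P: "p_subgroup_of G p C P"
  obtains Q where "max_p_subgroup_of G p C Q" "P \<subseteq> Q"
proof -
  let ?A = "{Q. p_subgroup_of G p C Q}"
  have "?A \<subseteq> Pow (carrier G)" using subgroup.subset by (auto simp: p_subgroup_of_def)
  then have "finite ?A" using fin by (meson finite_Pow_iff finite_subset)
  then obtain Q where "Q \<in> ?A" "P \<subseteq> Q" "\<forall>R\<in>?A. Q \<subseteq> R \<longrightarrow> Q = R"
    using finite_has_maximal2[of ?A P] P by auto
  moreover from this have "max_p_subgroup_of G p C Q" unfolding max_p_subgroup_of_def by auto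
  ultimately show ?thesis using that by blast
qed

lemma sylow_is_p_subgroup:
  assumes S: "subgroup S G" "card S = p ^ a"
  shows "p_subgroup_of G p (carrier G) S"
proof -
  interpret S: group "G\<lparr>carrier := S\<rparr>" using S(1) by (rule subgroup_imp_group)
  have "x [^] (p ^ a) = \<one>" if "x \<in> S" for x
    using S.pow_order_eq_1[of x] that S(2) by (simp add: order_def nat_pow_consistent[symmetric])
  then show ?thesis using S subgroup.subset[OF S(1)] unfolding p_subgroup_of_def p_element_def by blast
qed

lemma cyclic_p_subgroup:
  assumes p: "prime p" and z: "p_element G p z"
  shows "p_subgroup_of G p (carrier G) (range (\<lambda>n :: nat. z [^] n))" (is "p_subgroup_of G p _ ?P")
proof -
  obtain k where k: "z \<in> carrier G" "z [^] (p ^ k) = \<one>" using z by (auto simp: p_element_def)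
  have "subgroup ?P G"
  proof (rule subgroupI)
    show "?P \<subseteq> carrier G" using k(1) by auto
    show "a \<otimes> b \<in> ?P" if "a \<in> ?P" "b \<in> ?P" for a b using that k(1) by (auto simp: nat_pow_mult)
    show "inv a \<in> ?P" if a: "a \<in> ?P" for a
    proof -
      obtain n :: nat where n: "a = z [^] n" using a by auto
      have "p ^ k > 0" using prime_gt_0_nat[OF p] by simp
      then have "n * (p ^ k - 1) + n = n * p ^ k" by (cases "p ^ k") auto
      then have "z [^] (n * (p ^ k - 1)) \<otimes> a = z [^] (n * p ^ k)"
        using n k(1) by (simp add: nat_pow_mult)
      then have "inv a = z [^] (n * (p ^ k - 1))"
        using k n by (metis inv_equality mult.commute nat_pow_closed nat_pow_one nat_pow_pow)
      then show ?thesis by blast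
    qed
  qed auto
  moreover have "p_element G p (z [^] n)" for n :: nat
    using k unfolding p_element_def by (metis mult.commute nat_pow_closed nat_pow_one nat_pow_pow)
  ultimately show ?thesis unfolding p_subgroup_of_def using k(1) by auto
qed

lemma max_p_subgroup_sylow:
  assumes fin: "finite (carrier G)" and p: "prime p" and S: "subgroup S G" "card S = p ^ a"
    and ord: "order G = p ^ a * m" "\<not> p dvd m" and P: "max_p_subgroup_of G p (carrier G) P"
  obtains g where "g \<in> carrier G" "P = conj_subgroup G S g"
proof -
  have P': "p_subgroup_of G p (carrier G) P" using P by (simp add: max_p_subgroup_of_def)
  then obtain g where g: "g \<in> carrier G" "\<And>x. x \<in> P \<Longrightarrow> g \<otimes> x \<otimes> inv g \<in> S"
    using sylow_contains_conjugate[OF fin p S ord] by metis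
  have car: "x \<in> carrier G" if "x \<in> P" for x using P' that by (auto simp: p_subgroup_of_def)
  have "P \<subseteq> conj_subgroup G S g"
  proof
    fix x assume x: "x \<in> P"
    then have "x = inv g \<otimes> (g \<otimes> x \<otimes> inv g) \<otimes> g" using car g(1) by (simp add: m_assoc inv_cancel_left)
    then show "x \<in> conj_subgroup G S g" using g(2)[OF x] conj_subgroup_mem by blast
  qed
  moreover have "p_subgroup_of G p (carrier G) (conj_subgroup G S g)"
    using sylow_is_p_subgroup[OF S] g subgroup.subset[OF subgroup_conj_subgroup[OF S(1)]]
    by (intro p_subgroup_conj) auto
  ultimately show ?thesis using that g P unfolding max_p_subgroup_of_def by blast
qed

lemma max_p_subgroups_conjugate_aux:
  assumes fin: "finite (carrier G)" and p: "prime p"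
    and P: "max_p_subgroup_of G p (carrier G) P" and Q: "max_p_subgroup_of G p (carrier G) Q"
  obtains g where "g \<in> carrier G" "Q = conj_subgroup G P g"
proof -
  obtain a m where m: "order G = p ^ a * m" "\<not> p dvd m"
    using nat_prime_part[OF p] fin order_gt_0_iff_finite by metis
  obtain S where S: "subgroup S G" "card S = p ^ a" using sylow_thm[OF p is_group m(1) fin] by auto
  obtain g where g: "g \<in> carrier G" "P = conj_subgroup G S g"
    using max_p_subgroup_sylow[OF fin p S m P] .
  obtain h where h: "h \<in> carrier G" "Q = conj_subgroup G S h"
    using max_p_subgroup_sylow[OF fin p S m Q] .
  have "conj_subgroup G P (inv g \<otimes> h) = conj_subgroup G S (g \<otimes> (inv g \<otimes> h))"
    unfolding g(2) using g(1) h(1) by (intro conj_subgroup_mult subgroup.subset[OF S(1)]) auto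
  also have "\<dots> = Q" unfolding inv_cancel_left(2)[OF g(1) h(1)] h(2) ..
  finally have "Q = conj_subgroup G P (inv g \<otimes> h)" ..
  then show ?thesis using that[of "inv g \<otimes> h"] g(1) h(1) by simp
qed

lemma p_subgroup_of_sub:
  assumes "subgroup C G"
  shows "p_subgroup_of (G\<lparr>carrier := C\<rparr>) p C P \<longleftrightarrow> p_subgroup_of G p C P"
  using subgroup_of_subgroup_iff[OF assms] p_element_subgroup[OF assms]
  by (auto simp: p_subgroup_of_def)

lemma max_p_subgroups_conjugate:
  assumes fin: "finite (carrier G)" and p: "prime p" and C: "subgroup C G"
    and P: "max_p_subgroup_of G p C P" and Q: "max_p_subgroup_of G p C Q"
  obtains g where "g \<in> C" "Q = conj_subgroup G P g"
proof -
  let ?H = "G\<lparr>carrier := C\<rparr>"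
  interpret C: group "?H" using C by (rule subgroup_imp_group)
  have "max_p_subgroup_of ?H p C R \<longleftrightarrow> max_p_subgroup_of G p C R" for R
    unfolding max_p_subgroup_of_def p_subgroup_of_sub[OF C] ..
  then have PQ: "max_p_subgroup_of ?H p (carrier ?H) P"
    "max_p_subgroup_of ?H p (carrier ?H) Q"
    using P Q by simp_all
  have "finite (carrier ?H)" using finite_subgroup[OF fin C] by simp
  then obtain g where g: "g \<in> carrier ?H" "Q = conj_subgroup ?H P g"
    using C.max_p_subgroups_conjugate_aux[OF _ p PQ] by metis
  then have "Q = conj_subgroup G P g" using m_inv_consistent[OF C] by (simp add: conj_subgroup_def)
  then show ?thesis using that[of g] g(1) by simp
qed

lemma max_p_subgroup_conj:
  assumes P: "max_p_subgroup_of G p C P" and C: "C \<lhd> G" and g: "g \<in> carrier G"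
  shows "max_p_subgroup_of G p C (conj_subgroup G P g)"
  unfolding max_p_subgroup_of_def
proof (intro conjI allI impI)
  have P': "p_subgroup_of G p C P" using P by (simp add: max_p_subgroup_of_def)
  then have Pc: "P \<subseteq> carrier G" "P \<subseteq> C" using subgroup.subset by (auto simp: p_subgroup_of_def)
  show "p_subgroup_of G p C (conj_subgroup G P g)"
    using P' g conj_subgroup_normal[OF C Pc(2) g] by (rule p_subgroup_conj)
  fix Q assume Q: "p_subgroup_of G p C Q" "conj_subgroup G P g \<subseteq> Q"
  then have Qc: "Q \<subseteq> carrier G" "Q \<subseteq> C" using subgroup.subset by (auto simp: p_subgroup_of_def)
  have "P \<subseteq> conj_subgroup G Q (inv g)"
    using conj_subgroup_mono[OF Q(2), of "inv g"] conj_subgroup_cancel[OF Pc(1) g] by simp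
  moreover have "p_subgroup_of G p C (conj_subgroup G Q (inv g))"
    using Q(1) g conj_subgroup_normal[OF C Qc(2)] by (intro p_subgroup_conj) auto
  ultimately have "conj_subgroup G Q (inv g) = P" using P by (auto simp: max_p_subgroup_of_def)
  then show "Q = conj_subgroup G P g" using conj_subgroup_cancel(2)[OF Qc(1) g] by simp
qed

lemma max_p_subgroup_contains_normal:
  assumes P: "max_p_subgroup_of G p C P" and C: "subgroup C G"
    and N: "N \<lhd> G" "N \<subseteq> C" "\<And>x. x \<in> N \<Longrightarrow> p_element G p x"
  shows "N \<subseteq> P"
proof -
  have P': "subgroup P G" "P \<subseteq> C" "\<And>x. x \<in> P \<Longrightarrow> p_element G p x"
    using P by (auto simp: max_p_subgroup_of_def p_subgroup_of_def)
  note NP = set_mult_contains[OF normal_imp_subgroup[OF N(1)] P'(1)]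
  have "p_subgroup_of G p C (N <#> P)" unfolding p_subgroup_of_def
  proof (intro conjI ballI)
    show "subgroup (N <#> P) G" by (rule mult_norm_subgroup[OF N(1) P'(1)])
    show "N <#> P \<subseteq> C" using N(2) P'(2) subgroup.m_closed[OF C] by (auto simp: set_mult_def)
    show "p_element G p x" if "x \<in> N <#> P" for x
      using that p_element_mult_normal[OF N(1,3)] P'(3) by (auto simp: set_mult_def)
  qed
  then have "N <#> P = P" using P NP(2) by (auto simp: max_p_subgroup_of_def)
  then show ?thesis using NP(1) by simp
qed

end

section \<open>Nilpotency through elements of prime power order\<close>

text \<open>For a subgroup \<open>H\<close> of a finite group this says that \<open>H\<close> is nilpotent, see
  \<open>nilpotent_subgroup_iff\<close>.\<close>

definition p_closed :: "('a, 'b) monoid_scheme \<Rightarrow> 'a set \<Rightarrow> bool" where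
  "p_closed G H \<longleftrightarrow> (\<forall>p x y. prime p \<longrightarrow> x \<in> H \<longrightarrow> y \<in> H \<longrightarrow>
     p_element G p x \<longrightarrow> p_element G p y \<longrightarrow> p_element G p (x \<otimes>\<^bsub>G\<^esub> y))"

declare lower_central.simps(2) [simp del]

context group
begin

lemma p_closedD:
  "p_closed G H \<Longrightarrow> prime p \<Longrightarrow> x \<in> H \<Longrightarrow> y \<in> H \<Longrightarrow> p_element G p x \<Longrightarrow> p_element G p y \<Longrightarrow>
    p_element G p (x \<otimes> y)"
  by (auto simp: p_closed_def)

lemma p_closed_subset: "p_closed G H \<Longrightarrow> K \<subseteq> H \<Longrightarrow> p_closed G K"
  by (auto simp: p_closed_def)

lemma p_closed_sub:
  assumes H: "subgroup H G" and A: "A \<subseteq> H"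
  shows "p_closed (G\<lparr>carrier := H\<rparr>) A \<longleftrightarrow> p_closed G A"
proof -
  have A': "x \<in> H" if "x \<in> A" for x using that A by auto
  then show ?thesis
    unfolding p_closed_def p_element_subgroup[OF H]
    by (simp add: subgroup.m_closed[OF H] cong: imp_cong)
qed

lemma p_closed_conj:
  assumes pc: "p_closed G H" and H: "H \<subseteq> carrier G" and g: "g \<in> carrier G"
  shows "p_closed G (conj_subgroup G H g)"
  unfolding p_closed_def
proof (intro allI impI)
  fix p x y assume p: "prime p" and x: "x \<in> conj_subgroup G H g" "p_element G p x"
    and y: "y \<in> conj_subgroup G H g" "p_element G p y"
  obtain a b where ab: "a \<in> H" "x = inv g \<otimes> a \<otimes> g" "b \<in> H" "y = inv g \<otimes> b \<otimes> g"
    using x y by (auto simp: conj_subgroup_mem)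
  have "a \<in> carrier G" "b \<in> carrier G" using ab H by auto
  then have *: "a = g \<otimes> x \<otimes> inv g" "b = g \<otimes> y \<otimes> inv g" "x \<otimes> y = inv g \<otimes> (a \<otimes> b) \<otimes> g"
    using ab g by (simp_all add: m_assoc inv_cancel_left)
  have "p_element G p (a \<otimes> b)"
    using p_closedD[OF pc p ab(1,3)] *(1,2) x y g p_element_conj by auto
  then show "p_element G p (x \<otimes> y)" unfolding *(3) using g by (rule p_element_conj')
qed

lemma p_closed_coset_image:
  assumes N: "N \<lhd> G" and V: "V \<subseteq> carrier G"
  shows "p_closed (G Mod N) ((#>) N ` V) \<longleftrightarrow>
    (\<forall>(p :: nat) x y. prime p \<longrightarrow> x \<in> V \<longrightarrow> y \<in> V \<longrightarrow> (\<exists>k. x [^] (p ^ k) \<in> N) \<longrightarrow> (\<exists>k. y [^] (p ^ k) \<in> N) \<longrightarrow>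
      (\<exists>k. (x \<otimes> y) [^] (p ^ k) \<in> N))"
proof -
  have V': "x \<in> carrier G" if "x \<in> V" for x using V that by auto
  have *: "p_element (G Mod N) p (N #> x) \<longleftrightarrow> (\<exists>k. x [^] (p ^ k) \<in> N)" if "x \<in> V" for p x
    using p_element_FactGroup[OF N V'[OF that]] .
  have **: "p_element (G Mod N) p ((N #> x) \<otimes>\<^bsub>G Mod N\<^esub> (N #> y)) \<longleftrightarrow> (\<exists>k. (x \<otimes> y) [^] (p ^ k) \<in> N)"
    if "x \<in> V" "y \<in> V" for p x y
    using p_element_FactGroup[OF N, of "x \<otimes> y" p] coset_mult[OF N that[THEN V']] that V' by (simp del: mult_FactGroup)
  have "p_closed (G Mod N) ((#>) N ` V) \<longleftrightarrow> (\<forall>p x y. prime p \<longrightarrow> x \<in> V \<longrightarrow> y \<in> V \<longrightarrow>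
      p_element (G Mod N) p (N #> x) \<longrightarrow> p_element (G Mod N) p (N #> y) \<longrightarrow>
      p_element (G Mod N) p ((N #> x) \<otimes>\<^bsub>G Mod N\<^esub> (N #> y)))"
    unfolding p_closed_def by (auto simp del: mult_FactGroup)
  then show ?thesis by (simp add: * ** del: mult_FactGroup cong: imp_cong)
qed

lemma p_closed_FactGroup:
  assumes fin: "finite (carrier G)" and N: "N \<lhd> G" and pc: "p_closed G (carrier G)"
  shows "p_closed (G Mod N) (carrier (G Mod N))"
  unfolding p_closed_def
proof (intro allI impI)
  fix p X Y assume p: "prime p" and X: "X \<in> carrier (G Mod N)" "p_element (G Mod N) p X"
    and Y: "Y \<in> carrier (G Mod N)" "p_element (G Mod N) p Y"
  have lift: "\<exists>x. X = N #> x \<and> p_element G p x"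
    if X: "X \<in> carrier (G Mod N)" "p_element (G Mod N) p X" for X
  proof -
    obtain x where x: "x \<in> carrier G" "X = N #> x" using X(1) by (auto simp: carrier_FactGroup)
    then obtain k where "x [^] (p ^ k) \<in> N" using X(2) p_element_FactGroup[OF N] by auto
    then show ?thesis using p_element_lift[OF fin N p x(1)] x by metis
  qed
  obtain x y where xy: "X = N #> x" "p_element G p x" "Y = N #> y" "p_element G p y"
    using lift[OF X] lift[OF Y] by auto
  then have car: "x \<in> carrier G" "y \<in> carrier G" by (auto simp: p_element_def)
  have xy': "p_element G p (x \<otimes> y)" using p_closedD[OF pc p car xy(2,4)] .
  then obtain k where "(x \<otimes> y) [^] (p ^ k) = \<one>" unfolding p_element_def by auto
  then have "p_element (G Mod N) p (N #> (x \<otimes> y))"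
    using p_element_FactGroup[OF N, of "x \<otimes> y" p] car subgroup.one_closed[OF normal_imp_subgroup[OF N]]
    by (metis m_closed)
  then show "p_element (G Mod N) p (X \<otimes>\<^bsub>G Mod N\<^esub> Y)"
    unfolding xy(1,3) using coset_mult[OF N car] by simp
qed

lemma subgroup_p_part:
  assumes "subgroup H G" "p_closed G H" "prime p"
  shows "subgroup {x \<in> H. p_element G p x} G"
  using assms subgroup.mem_carrier[OF assms(1)] subgroup.one_closed[OF assms(1)]
    subgroup.m_closed[OF assms(1)] subgroup.m_inv_closed[OF assms(1)]
    p_element_one p_element_inv p_closedD
  by (intro subgroupI) auto

lemma p_part_normal:
  assumes A: "A \<lhd> G" and pc: "p_closed G A" and p: "prime p"
  shows "{x \<in> A. p_element G p x} \<lhd> G"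
  using subgroup_p_part[OF normal_invE(1)[OF A] pc p] normal_invE(2)[OF A] p_element_conj
  by (intro normal_invI) auto

lemma p_closed_p_subgroup:
  assumes P: "subgroup P G" "\<And>x. x \<in> P \<Longrightarrow> p_element G p x" and p: "prime p"
  shows "p_closed G P"
  unfolding p_closed_def
proof (intro allI impI)
  fix q x y assume q: "prime q" and xy: "x \<in> P" "y \<in> P" "p_element G q x" "p_element G q y"
  show "p_element G q (x \<otimes> y)"
  proof (cases "q = p")
    case True
    then show ?thesis using P xy subgroup.m_closed by metis
  next
    case False
    have "z = \<one>" if z: "z \<in> P" "p_element G q z" for z
    proof -
      have "p_element G p z" using P(2) z by blast
      then obtain k l where "z [^] (p ^ k) = \<one>" "z [^] (q ^ l) = \<one>" "z \<in> carrier G"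
        using z(2) unfolding p_element_def by auto
      then show ?thesis using pow_coprime_one coprime_distinct_primes_power[OF p q] False by metis
    qed
    then have "x = \<one>" "y = \<one>" using xy by blast+
    then show ?thesis using p_element_one[of q] by simp
  qed
qed

text \<open>The \<open>p\<close>-elements and the \<open>q\<close>-elements of \<open>H\<close> form normal subgroups with trivial intersection,
  and the commutator of \<open>x\<close> and \<open>y\<close> lies in both.\<close>

lemma p_closed_commute_primary:
  assumes H: "subgroup H G" and pc: "p_closed G H" and pq: "prime p" "prime q" "p \<noteq> q"
    and x: "x \<in> H" "p_element G p x" and y: "y \<in> H" "p_element G q y"
  shows "x \<otimes> y = y \<otimes> x"
proof -
  note car = subgroup.mem_carrier[OF H]
  note cl = subgroup.m_closed[OF H] subgroup.m_inv_closed[OF H]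
  let ?c = "x \<otimes> y \<otimes> inv x \<otimes> inv y"
  have "p_element G q ?c"
    using x y pq cl car by (intro p_closedD[OF pc] p_element_conj p_element_inv) auto
  moreover have "p_element G p (x \<otimes> (y \<otimes> inv x \<otimes> inv y))"
    using x y pq cl car by (intro p_closedD[OF pc] p_element_conj p_element_inv) auto
  then have "p_element G p ?c" using x y car by (simp add: m_assoc)
  moreover have "coprime (p ^ k) (q ^ l)" for k l using coprime_distinct_primes_power[OF pq] .
  ultimately have "?c = \<one>" unfolding p_element_def using pow_coprime_one by blast
  moreover have "x \<otimes> y = ?c \<otimes> (y \<otimes> x)" using x y car by (simp add: m_assoc inv_cancel_left)
  ultimately show ?thesis using x y car by simp
qed

lemma p_closed_commute:
  fixes m :: nat
  assumes H: "subgroup H G" and pc: "p_closed G H" and p: "prime p"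
    and x: "x \<in> H" "p_element G p x" and y: "y \<in> H" "\<not> p dvd m" "y [^] m = \<one>"
  shows "x \<otimes> y = y \<otimes> x"
  using y(2) x y p
  by (intro commute_by_primary[of x y m] p_closed_commute_primary[OF H pc p] pow_mem[OF H])
    (auto simp: subgroup.mem_carrier[OF H] intro: Nat.gr0I)

text \<open>The elements of order a power of \<open>p\<close> form a \<open>p\<close>-group, and a nontrivial element of its center
  commutes with all elements of prime power order.\<close>

lemma p_closed_center_nontrivial:
  assumes fin: "finite (carrier G)" and pc: "p_closed G (carrier G)" and nt: "carrier G \<noteq> {\<one>}"
  obtains z where "z \<in> carrier G" "z \<noteq> \<one>" "\<And>x. x \<in> carrier G \<Longrightarrow> x \<otimes> z = z \<otimes> x"
proof -
  have "order G \<noteq> 1" using nt order_one_triv_iff by blast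
  then obtain p where p: "prime p" "p dvd order G" using prime_factor_nat by blast
  let ?P = "{x \<in> carrier G. p_element G p x}"
  have P: "subgroup ?P G" using subgroup_p_part[OF subgroup_self pc p(1)] .
  interpret P: group "G\<lparr>carrier := ?P\<rparr>" using P by (rule subgroup_imp_group)
  have "p_group p (G\<lparr>carrier := ?P\<rparr>)"
    using P.p_group_iff[OF p(1)] p_element_subgroup[OF P] fin by simp
  moreover have "?P \<noteq> {\<one>}"
  proof -
    obtain x where x: "x \<in> carrier G" "x \<noteq> \<one>" "x [^] p = \<one>" using cauchy[OF fin p] .
    then have "x [^] (p ^ 1) = \<one>" by simp
    then have "x \<in> ?P" using x(1) unfolding p_element_def by blast
    then show ?thesis using x by auto
  qed
  ultimately obtain z where z: "z \<in> ?P" "z \<noteq> \<one>" "\<And>x. x \<in> ?P \<Longrightarrow> x \<otimes> z = z \<otimes> x"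
    using P.p_group_center_nontrivial[OF p(1)] by auto
  have "z \<otimes> x = x \<otimes> z" if x: "x \<in> carrier G" for x
  proof (rule commute_by_primary[OF _ x])
    show "order G > 0" using fin order_gt_0_iff_finite by simp
    show "x [^] order G = \<one>" using x by (rule pow_order_eq_1)
    show "z \<otimes> x [^] j = x [^] j \<otimes> z"
      if "prime q" "q dvd order G" "p_element G q (x [^] j)" for q and j :: nat
      using p_closed_commute_primary[OF subgroup_self pc p(1) that(1), of z "x [^] j"] z(1)
        z(3)[of "x [^] j"] that x by (cases "p = q") auto
  qed (use z in auto)
  then show ?thesis using that z by auto
qed

lemma lower_central_normal: "lower_central G n \<lhd> G"
proof (induction n)
  case 0
  then show ?case using normal_self by simp
next
  case (Suc n)
  let ?C = "{x \<otimes> y \<otimes> inv x \<otimes> inv y | x y. x \<in> lower_central G n \<and> y \<in> carrier G}"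
  note N = normal_invE[OF Suc]
  note car = subgroup.mem_carrier[OF N(1)]
  have "g \<otimes> h \<otimes> inv g \<in> ?C" if h: "h \<in> ?C" and g: "g \<in> carrier G" for g h
  proof -
    obtain x y where xy: "x \<in> lower_central G n" "y \<in> carrier G" "h = x \<otimes> y \<otimes> inv x \<otimes> inv y"
      using h by auto
    let ?x = "g \<otimes> x \<otimes> inv g" and ?y = "g \<otimes> y \<otimes> inv g"
    have "g \<otimes> h \<otimes> inv g = ?x \<otimes> ?y \<otimes> inv ?x \<otimes> inv ?y"
      using xy g car by (simp add: m_assoc inv_mult_group inv_cancel_left)
    moreover have "?x \<in> lower_central G n" "?y \<in> carrier G" using xy g N(2) by auto
    ultimately show ?thesis by blast
  qed
  then show ?case unfolding lower_central.simps using car by (intro normal_generateI) auto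
qed

lemma lower_central_commutator:
  assumes "x \<in> lower_central G n" "y \<in> carrier G"
  shows "x \<otimes> y \<otimes> inv x \<otimes> inv y \<in> lower_central G (Suc n)"
  using assms unfolding lower_central.simps by (auto intro!: generate.incl)

text \<open>A commutator that commutes with both its entries has an order dividing the orders of both.\<close>

lemma central_commutator_trivial:
  fixes m n :: nat
  assumes x: "x \<in> carrier G" "x [^] m = \<one>" and y: "y \<in> carrier G" "y [^] n = \<one>" and "coprime m n"
    and c: "c = x \<otimes> y \<otimes> inv x \<otimes> inv y" "c \<otimes> x = x \<otimes> c" "c \<otimes> y = y \<otimes> c"
  shows "c = \<one>"
proof -
  have cc: "c \<in> carrier G" using x y c by simp
  have "x \<otimes> y \<otimes> inv x = c \<otimes> y" using x y c(1) by (simp add: m_assoc)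
  then have "(c \<otimes> y) [^] n = x \<otimes> y [^] n \<otimes> inv x" using x y conj_pow by metis
  then have "c [^] n \<otimes> y [^] n = \<one>" using pow_mult_distrib[OF c(3) cc y(1)] x y by simp
  then have cn: "c [^] n = \<one>" using y cc by simp
  have "y \<otimes> x \<otimes> inv y = inv c \<otimes> x" using x y c(1) by (simp add: m_assoc inv_mult_group inv_cancel_left)
  moreover have "inv c \<otimes> x = x \<otimes> inv c" using c(2) cc x
    by (metis inv_closed inv_solve_left inv_solve_right m_assoc m_closed)
  ultimately have "inv c [^] m \<otimes> x [^] m = y \<otimes> x [^] m \<otimes> inv y"
    using conj_pow[OF y(1) x(1), of m] pow_mult_distrib[of "inv c" x m] x cc by simp
  then have "inv (c [^] m) = \<one>" using x y cc by (simp add: nat_pow_inv)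
  then have "c [^] m = \<one>" using cc by (metis inv_eq_1_iff nat_pow_closed)
  then show ?thesis using cn pow_coprime_one[OF cc] assms(5) by blast
qed

text \<open>By induction the commutator lies in every term of the lower central series: modulo the next term
  it is central, so \<open>central_commutator_trivial\<close> applies.\<close>

lemma nilpotent_coprime_commute:
  fixes m n :: nat
  assumes nil: "nilpotent_group G" and x: "x \<in> carrier G" "x [^] m = \<one>"
    and y: "y \<in> carrier G" "y [^] n = \<one>" and cop: "coprime m n"
  shows "x \<otimes> y = y \<otimes> x"
proof -
  let ?c = "x \<otimes> y \<otimes> inv x \<otimes> inv y"
  have "?c \<in> lower_central G i" for i
  proof (induction i)
    case 0
    then show ?case using x y by simp
  next
    case (Suc i)
    let ?N = "lower_central G (Suc i)"
    have N: "?N \<lhd> G" by (rule lower_central_normal)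
    interpret Q: group "G Mod ?N" using N by (rule normal.factorgroup_is_group)
    have comm: "(?N #> ?c) \<otimes>\<^bsub>G Mod ?N\<^esub> (?N #> a) = (?N #> a) \<otimes>\<^bsub>G Mod ?N\<^esub> (?N #> ?c)"
      if a: "a \<in> carrier G" for a
      using lower_central_commutator[OF Suc a] coset_commute_iff[OF N _ a, of ?c] x y by simp
    have "?N #> ?c = \<one>\<^bsub>G Mod ?N\<^esub>"
    proof (rule Q.central_commutator_trivial[OF _ _ _ _ cop _ comm comm])
      show "?N #> x \<in> carrier (G Mod ?N)" "?N #> y \<in> carrier (G Mod ?N)"
        using x y by (auto simp: carrier_FactGroup)
      show "(?N #> x) [^]\<^bsub>G Mod ?N\<^esub> m = \<one>\<^bsub>G Mod ?N\<^esub>" "(?N #> y) [^]\<^bsub>G Mod ?N\<^esub> n = \<one>\<^bsub>G Mod ?N\<^esub>"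
        using FactGroup_pow_eq_one[OF N] x y subgroup.one_closed[OF normal_imp_subgroup[OF N]] by auto
    qed (use x y coset_mult[OF N] coset_inv[OF N] in \<open>simp_all del: mult_FactGroup\<close>)
    then show ?case using coset_eq_one_iff[OF N, of ?c] x y by simp
  qed
  then have "?c = \<one>" using nil unfolding nilpotent_group_def by auto
  moreover have "x \<otimes> y = ?c \<otimes> (y \<otimes> x)" using x y by (simp add: m_assoc inv_cancel_left)
  ultimately show ?thesis using x y by simp
qed

text \<open>A Sylow subgroup is centralized by the Sylow subgroups for all other primes, so the order of its
  normalizer is divisible by every prime power that divides the order of \<open>G\<close>.\<close>

lemma nilpotent_normalizes_sylow:
  assumes nil: "nilpotent_group G" and p: "prime p" and S: "subgroup S G" "card S = p ^ a"
    and m: "order G = p ^ a * m" "\<not> p dvd m"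
  shows "{g \<in> carrier G. \<forall>s\<in>S. g \<otimes> s \<otimes> inv g \<in> S \<and> inv g \<otimes> s \<otimes> g \<in> S} = carrier G" (is "?N = _")
proof -
  have fin: "finite (carrier G)" using nil by (simp add: nilpotent_group_def)
  note car = subgroup.mem_carrier[OF S(1)]
  have Sp: "p_subgroup_of G p (carrier G) S" by (rule sylow_is_p_subgroup[OF S])
  have N: "subgroup ?N G" using subgroup.subset[OF S(1)] by (rule normalizing_subgroup)
  have mult_q: "multiplicity r l = b" if "prime r" "l = r ^ b * n" "\<not> r dvd n" for r l b n :: nat
    using that multiplicity_prime_elem_times_other[of r n "r ^ b"] by (simp add: mult.commute)
  have cpos: "card ?N > 0" using fin subgroup.one_closed[OF N] card_gt_0_iff[of ?N] by auto
  have ord: "order G dvd card ?N"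
  proof (rule multiplicity_le_imp_dvd)
    fix q :: nat assume q: "prime q"
    obtain b n where n: "order G = q ^ b * n" "\<not> q dvd n"
      using nat_prime_part[OF q] fin order_gt_0_iff_finite by metis
    have "\<exists>T. subgroup T G \<and> card T = q ^ b \<and> T \<subseteq> ?N"
    proof (cases "q = p")
      case True
      have "a = b" using mult_q[OF p m] mult_q[OF q n] True by simp
      have "S \<subseteq> ?N" using S(1) car by (auto intro!: subgroup.m_closed subgroup.m_inv_closed)
      then show ?thesis using S \<open>a = b\<close> True by auto
    next
      case False
      obtain T where T: "subgroup T G" "card T = q ^ b" using sylow_thm[OF q is_group n(1) fin] by auto
      have Tp: "p_subgroup_of G q (carrier G) T" by (rule sylow_is_p_subgroup[OF T])
      have "t \<otimes> s = s \<otimes> t" if t: "t \<in> T" and s: "s \<in> S" for s t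
      proof -
        obtain k l where "t [^] (q ^ k) = \<one>" "s [^] (p ^ l) = \<one>"
          using Tp Sp s t unfolding p_subgroup_of_def p_element_def by metis
        moreover have "coprime (q ^ k) (p ^ l)" using coprime_distinct_primes_power[OF q p False] .
        ultimately show ?thesis
          using nilpotent_coprime_commute[OF nil] s t car subgroup.mem_carrier[OF T(1)] by blast
      qed
      moreover have tc: "t \<in> carrier G" if "t \<in> T" for t using that by (rule subgroup.mem_carrier[OF T(1)])
      ultimately have "t \<otimes> s \<otimes> inv t \<in> S \<and> inv t \<otimes> s \<otimes> t \<in> S"
        if "t \<in> T" "s \<in> S" for t s
        using conj_commuting[of t s] that car by simp
      then have "T \<subseteq> ?N" using tc by auto
      then show ?thesis using T by blast
    qed
    then obtain T where T: "subgroup T G" "card T = q ^ b" "T \<subseteq> ?N" by auto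
    have "q ^ b dvd card ?N" using card_subgroup_dvd[OF N T(1,3)] T(2) by simp
    moreover have "multiplicity q (order G) = b" using mult_q[OF q n] .
    ultimately show "multiplicity q (order G) \<le> multiplicity q (card ?N)"
      using multiplicity_geI[of "card ?N" q b] cpos prime_gt_1_nat[OF q] by simp
  qed (use fin order_gt_0_iff_finite in simp)
  have "card ?N \<le> order G" unfolding order_def using fin by (intro card_mono) auto
  then have "card ?N = card (carrier G)" using dvd_imp_le[OF ord cpos] unfolding order_def by simp
  then show ?thesis using fin card_subset_eq[of "carrier G" ?N] by auto
qed

lemma nilpotent_p_closed:
  assumes nil: "nilpotent_group G"
  shows "p_closed G (carrier G)"
  unfolding p_closed_def
proof (intro allI impI)
  have fin: "finite (carrier G)" using nil by (simp add: nilpotent_group_def)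
  fix p x y assume p: "prime p" and x: "p_element G p x" and y: "p_element G p y"
  obtain a m where m: "order G = p ^ a * m" "\<not> p dvd m"
    using nat_prime_part[OF p] fin order_gt_0_iff_finite by metis
  obtain S where S: "subgroup S G" "card S = p ^ a" using sylow_thm[OF p is_group m(1) fin] by auto
  have mem: "z \<in> S" if z: "p_element G p z" for z
  proof -
    have zc: "z \<in> carrier G" using z by (simp add: p_element_def)
    obtain Q where Q: "max_p_subgroup_of G p (carrier G) Q" "range (\<lambda>n :: nat. z [^] n) \<subseteq> Q"
      using p_subgroup_in_max[OF fin cyclic_p_subgroup[OF p z]] .
    obtain g where g: "g \<in> carrier G" "Q = conj_subgroup G S g"
      using max_p_subgroup_sylow[OF fin p S m Q(1)] .
    have "z = z [^] (1 :: nat)" using zc by simp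
    then have "z \<in> conj_subgroup G S g" using Q(2) g(2) by blast
    then show "z \<in> S" using nilpotent_normalizes_sylow[OF nil p S m] g(1) by (auto simp: conj_subgroup_def)
  qed
  have "x \<otimes> y \<in> S" using mem x y S(1) subgroup.m_closed by metis
  then show "p_element G p (x \<otimes> y)" using sylow_is_p_subgroup[OF S] by (simp add: p_subgroup_of_def)
qed

text \<open>The subgroup \<open>Z\<close> is the preimage of the center of \<open>G/N\<close>.\<close>

lemma upper_central_step:
  assumes fin: "finite (carrier G)" and pc: "p_closed G (carrier G)" and N: "N \<lhd> G" "N \<noteq> carrier G"
  obtains Z where "Z \<lhd> G" "N \<subset> Z"
    "\<And>x g. x \<in> Z \<Longrightarrow> g \<in> carrier G \<Longrightarrow> x \<otimes> g \<otimes> inv x \<otimes> inv g \<in> N"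
proof -
  interpret Q: group "G Mod N" using N(1) by (rule normal.factorgroup_is_group)
  let ?C = "centralizer (G Mod N) (carrier (G Mod N))"
  let ?Z = "{x \<in> carrier G. N #> x \<in> ?C}"
  have C: "?C \<lhd> G Mod N" by (rule Q.centralizer_normal) (auto simp del: mult_FactGroup)
  note pre = subgroup_coset_preimage[OF N(1) normal_imp_subgroup[OF C]]
  obtain a where a: "a \<in> carrier G" "a \<notin> N"
    using N(2) subgroup.subset[OF normal_imp_subgroup[OF N(1)]] by auto
  then have "carrier (G Mod N) \<noteq> {\<one>\<^bsub>G Mod N\<^esub>}"
    using coset_eq_one_iff[OF N(1) a(1)] coset_in_carrier[OF N(1) a(1)] by auto
  moreover have "finite (carrier (G Mod N))" using fin by (simp add: carrier_FactGroup)
  ultimately obtain \<zeta> where \<zeta>: "\<zeta> \<in> carrier (G Mod N)" "\<zeta> \<noteq> \<one>\<^bsub>G Mod N\<^esub>"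
    "\<And>x. x \<in> carrier (G Mod N) \<Longrightarrow> x \<otimes>\<^bsub>G Mod N\<^esub> \<zeta> = \<zeta> \<otimes>\<^bsub>G Mod N\<^esub> x"
    using Q.p_closed_center_nontrivial p_closed_FactGroup[OF fin N(1) pc] by metis
  obtain z where z: "z \<in> carrier G" "\<zeta> = N #> z" using \<zeta>(1) by (auto simp: carrier_FactGroup)
  have "\<zeta> \<in> ?C" using \<zeta>(1) \<zeta>(3)[symmetric] by (simp add: centralizer_def del: mult_FactGroup)
  then have "z \<in> ?Z" using z by simp
  moreover have "z \<notin> N" using coset_eq_one_iff[OF N(1) z(1)] \<zeta>(2) z(2) by simp
  ultimately have "N \<subset> ?Z" using pre(2) by blast
  moreover have "x \<otimes> g \<otimes> inv x \<otimes> inv g \<in> N" if "x \<in> ?Z" "g \<in> carrier G" for x g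
    using that coset_commute_iff[OF N(1), of x g] coset_in_carrier[OF N(1), of g]
    by (simp add: centralizer_def del: mult_FactGroup)
  ultimately show ?thesis using that[OF normal_coset_preimage[OF N(1) C]] by blast
qed

text \<open>The upper central series above \<open>N\<close> reaches \<open>G\<close>, and the lower central series descends through
  its terms. The series is built inside \<open>G\<close> because an induction over quotients would have to change
  the type of the group.\<close>

lemma p_closed_lower_central:
  assumes fin: "finite (carrier G)" and pc: "p_closed G (carrier G)"
  shows "N \<lhd> G \<Longrightarrow> \<exists>k. lower_central G k \<subseteq> N"
proof (induction "order G - card N" arbitrary: N rule: less_induct)
  case less
  show ?case
  proof (cases "N = carrier G")
    case True
    then have "lower_central G 0 \<subseteq> N" by simp
    then show ?thesis ..
  next
    case False
    obtain Z where Z: "Z \<lhd> G" "N \<subset> Z"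
      "\<And>x g. x \<in> Z \<Longrightarrow> g \<in> carrier G \<Longrightarrow> x \<otimes> g \<otimes> inv x \<otimes> inv g \<in> N"
      using upper_central_step[OF fin pc less.prems False] by metis
    have ZG: "Z \<subseteq> carrier G" using subgroup.subset[OF normal_imp_subgroup[OF Z(1)]] .
    have "card N < card Z" using Z(2) finite_subset[OF ZG fin] by (rule psubset_card_mono[rotated])
    moreover have "card Z \<le> order G" unfolding order_def using fin ZG by (rule card_mono)
    ultimately obtain k where k: "lower_central G k \<subseteq> Z" using less.hyps[OF _ Z(1)] by force
    have "lower_central G (Suc k) \<subseteq> N"
      unfolding lower_central.simps
      using Z(3) k by (intro generate_subgroup_incl normal_imp_subgroup[OF less.prems]) auto
    then show ?thesis ..
  qed
qed

lemma nilpotent_iff_p_closed: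
  assumes fin: "finite (carrier G)"
  shows "nilpotent_group G \<longleftrightarrow> p_closed G (carrier G)"
proof
  assume "p_closed G (carrier G)"
  then obtain k where "lower_central G k \<subseteq> {\<one>}"
    using p_closed_lower_central[OF fin] one_is_normal by blast
  then have "lower_central G k = {\<one>}"
    using subgroup.one_closed[OF normal_imp_subgroup[OF lower_central_normal]] by blast
  then show "nilpotent_group G" unfolding nilpotent_group_def using fin is_group by blast
qed (rule nilpotent_p_closed)

lemma nilpotent_subgroup_iff:
  assumes fin: "finite (carrier G)" and H: "subgroup H G"
  shows "nilpotent_group (G\<lparr>carrier := H\<rparr>) \<longleftrightarrow> p_closed G H"
proof -
  interpret H: group "G\<lparr>carrier := H\<rparr>" using H by (rule subgroup_imp_group)
  show ?thesis
    using p_closed_sub[OF H, of H] H.nilpotent_iff_p_closed finite_subgroup[OF fin H] by simp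
qed

text \<open>The key step of Fitting's theorem: a \<open>p\<close>-element of the product \<open>AB\<close> is a product of \<open>p\<close>-elements
  of \<open>A\<close> and \<open>B\<close>. Modulo \<open>B\<close> the factor \<open>a\<close> is a \<open>p\<close>-element, so the part of \<open>a\<close> of order prime to
  \<open>p\<close> lies in \<open>B\<close> and is moved into the second factor \<open>c\<close>. By symmetry the part \<open>d\<close> of \<open>c\<close> of order
  prime to \<open>p\<close> lies in \<open>A \<inter> B\<close>. It commutes with the remaining factors, whose product is a
  \<open>p\<close>-element, and so it is trivial.\<close>

lemma p_element_of_normal_product:
  assumes fin: "finite (carrier G)" and A: "A \<lhd> G" "p_closed G A" and B: "B \<lhd> G" and p: "prime p"
    and a: "a \<in> A" and b: "b \<in> B" and g: "p_element G p (a \<otimes> b)"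
  obtains a' b' where "a' \<in> A" "p_element G p a'" "b' \<in> B" "p_element G p b'" "a \<otimes> b = a' \<otimes> b'"
proof -
  note sA = normal_invE(1)[OF A(1)] and sB = normal_invE(1)[OF B]
  note car = subgroup.mem_carrier[OF sA] subgroup.mem_carrier[OF sB]
  note clB = subgroup.m_closed[OF sB] subgroup.m_inv_closed[OF sB]
  note clA = subgroup.m_closed[OF sA] subgroup.m_inv_closed[OF sA]
  obtain k where k: "(a \<otimes> b) [^] (p ^ k) = \<one>" using g by (auto simp: p_element_def)
  have "(a \<otimes> b \<otimes> inv a) \<otimes> a = a \<otimes> b" using a b car by (simp add: m_assoc)
  then obtain b0 where "b0 \<in> B" "\<one> = b0 \<otimes> a [^] (p ^ k)"
    using pow_mult_normal[OF B normal_invE(2)[OF B, of a b], of a "p ^ k"] a b car k by auto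
  then have "a [^] (p ^ k) = inv b0" using a car by (metis inv_equality inv_inv nat_pow_closed inv_closed)
  then have aB: "a [^] (p ^ k) \<in> B" using \<open>b0 \<in> B\<close> clB by simp
  obtain u v m :: nat where uv: "a = a [^] u \<otimes> a [^] v" "p_element G p (a [^] u)" "p ^ k dvd v"
    using p_element_finite_decomposition[OF fin _ p, of a k] a car by metis
  have vB: "a [^] v \<in> B"
  proof -
    obtain w where "v = p ^ k * w" using uv(3) by auto
    then have "a [^] v = (a [^] (p ^ k)) [^] w" using a car by (simp add: nat_pow_pow)
    then show ?thesis using pow_mem[OF sB aB] by simp
  qed
  define c where "c = a [^] v \<otimes> b"
  have cB: "c \<in> B" unfolding c_def using vB b clB by blast
  have uA: "a [^] u \<in> A" using a pow_mem[OF sA] by blast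
  have ac: "a \<otimes> b = a [^] u \<otimes> c"
    unfolding c_def using uv(1) a b car by (metis m_assoc nat_pow_closed)
  then obtain a0 where "a0 \<in> A" "\<one> = a0 \<otimes> c [^] (p ^ k)"
    using pow_mult_normal[OF A(1) uA, of c "p ^ k"] cB car k by auto
  then have "c [^] (p ^ k) = inv a0" using cB car by (metis inv_equality inv_inv nat_pow_closed inv_closed)
  then have cA: "c [^] (p ^ k) \<in> A" using \<open>a0 \<in> A\<close> clA by simp
  obtain s t n :: nat where st: "c = c [^] s \<otimes> c [^] t" "p_element G p (c [^] s)" "\<not> p dvd n"
    "(c [^] t) [^] n = \<one>" "p ^ k dvd t"
    using p_element_finite_decomposition[OF fin _ p, of c k] cB car by metis
  have tA: "c [^] t \<in> A"
  proof -
    obtain w where "t = p ^ k * w" using st(5) by auto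
    then have "c [^] t = (c [^] (p ^ k)) [^] w" using cB car by (simp add: nat_pow_pow)
    then show ?thesis using pow_mem[OF sA cA] by simp
  qed
  let ?w = "a [^] u \<otimes> c [^] s" and ?d = "c [^] t"
  have cc: "c \<in> carrier G" "a [^] u \<in> carrier G" using cB a car by auto
  have d1: "a [^] u \<otimes> ?d = ?d \<otimes> a [^] u"
    using p_closed_commute[OF sA A(2) p uA uv(2) tA st(3,4)] .
  have d2: "c [^] s \<otimes> ?d = ?d \<otimes> c [^] s" using cc by (simp add: nat_pow_mult add.commute)
  have g': "a \<otimes> b = ?w \<otimes> ?d" using ac st(1) cc by (metis m_assoc nat_pow_closed)
  have dw: "?w \<otimes> ?d = ?d \<otimes> ?w" using d1 d2 cc by (metis m_assoc nat_pow_closed)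
  have pw: "p_element G p ?w"
    using p_part_normal[OF A p] uv(2) uA st(2) by (intro p_element_mult_normal[of "{x \<in> A. p_element G p x}"]) auto
  have "?d = inv ?w \<otimes> (a \<otimes> b)" unfolding g' using cc by (simp add: inv_cancel_left)
  moreover have "p_element G p (inv ?w \<otimes> (a \<otimes> b))"
  proof (rule p_element_commute_mult[OF p_element_inv[OF pw] g])
    show "inv ?w \<otimes> (a \<otimes> b) = a \<otimes> b \<otimes> inv ?w"
      unfolding g' using conj_commuting(1)[OF _ _ dw] cc inv_cancel_left(1)[of ?w ?d] by simp
  qed
  ultimately have "p_element G p ?d" by simp
  then obtain l where "?d [^] (p ^ l) = \<one>" by (auto simp: p_element_def)
  then have "?d = \<one>"
    using pow_coprime_one[of ?d "p ^ l" n] st(4) coprime_prime_power[OF p st(3)] cc by auto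
  then have "a \<otimes> b = a [^] u \<otimes> c [^] s" using g' cc by simp
  then show ?thesis using that uA uv(2) st(2) pow_mem[OF sB cB] by blast
qed

lemma p_closed_set_mult:
  assumes fin: "finite (carrier G)" and A: "A \<lhd> G" "p_closed G A" and B: "B \<lhd> G" "p_closed G B"
  shows "p_closed G (A <#> B)"
  unfolding p_closed_def
proof (intro allI impI)
  fix p x y assume p: "prime p" and x: "x \<in> A <#> B" "p_element G p x" and y: "y \<in> A <#> B" "p_element G p y"
  let ?P = "\<lambda>C. {x \<in> C. p_element G p x}"
  have "?P A <#> ?P B \<lhd> G" using A B p by (intro normal_set_mult p_part_normal)
  then have PAB: "subgroup (?P A <#> ?P B) G" by (rule normal_imp_subgroup)
  have mem: "z \<in> ?P A <#> ?P B" if z: "z \<in> A <#> B" "p_element G p z" for z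
  proof -
    obtain a b where ab: "a \<in> A" "b \<in> B" "z = a \<otimes> b" using z(1) by (auto simp: set_mult_def)
    obtain a' b' where "a' \<in> A" "p_element G p a'" "b' \<in> B" "p_element G p b'" "a \<otimes> b = a' \<otimes> b'"
      using p_element_of_normal_product[OF fin A B(1) p ab(1,2)] z(2) ab(3) by metis
    then show ?thesis using ab(3) by (auto intro: set_multI)
  qed
  have "x \<otimes> y \<in> ?P A <#> ?P B" using subgroup.m_closed[OF PAB mem[OF x] mem[OF y]] .
  then show "p_element G p (x \<otimes> y)"
    using p_element_mult_normal[OF p_part_normal[OF A p]] unfolding set_mult_def by auto
qed

lemma nilpotent_fitting_set:
  assumes fin: "finite (carrier G)"
  shows "fitting_set G {H. subgroup H G \<and> nilpotent_group (G\<lparr>carrier := H\<rparr>)}"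
proof -
  have eq: "{H. subgroup H G \<and> nilpotent_group (G\<lparr>carrier := H\<rparr>)} = {H. subgroup H G \<and> p_closed G H}"
    using nilpotent_subgroup_iff[OF fin] by auto
  show ?thesis unfolding eq fitting_set_def
  proof (intro conjI ballI allI impI)
    have "p_closed G {\<one>}" by (auto simp: p_closed_def)
    then show "{H. subgroup H G \<and> p_closed G H} \<noteq> {}" using triv_subgroup by blast
    fix S assume "S \<in> {H. subgroup H G \<and> p_closed G H}"
    then have S: "subgroup S G" "p_closed G S" by auto
    then show "subgroup S G" by simp
    show "T \<in> {H. subgroup H G \<and> p_closed G H}" if "T \<lhd> G\<lparr>carrier := S\<rparr>" for T
      using that S p_closed_subset normal_in_iff[OF S(1)] by blast
    show "conj_subgroup G S x \<in> {H. subgroup H G \<and> p_closed G H}" if "x \<in> carrier G" for x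
      using S that subgroup_conj_subgroup p_closed_conj subgroup.subset by blast
    fix T assume "T \<in> {H. subgroup H G \<and> p_closed G H}"
      and n: "S \<lhd> G\<lparr>carrier := S <#> T\<rparr>" "T \<lhd> G\<lparr>carrier := S <#> T\<rparr>"
    then have T: "subgroup T G" "p_closed G T" by auto
    let ?H = "G\<lparr>carrier := S <#> T\<rparr>"
    interpret H: group ?H using n(1) by (simp add: normal_def)
    have H: "subgroup (S <#> T) G"
      using H.is_group set_mult_closed[of S T] S T subgroup.subset
      by (intro group_incl_imp_subgroup) (auto simp: set_mult_def)
    note eq = p_closed_sub[OF H]
    have sub: "S \<subseteq> S <#> T" "T \<subseteq> S <#> T" using set_mult_contains[OF S(1) T(1)] .
    have "p_closed ?H (S <#>\<^bsub>?H\<^esub> T)"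
      using eq[OF sub(1)] eq[OF sub(2)] S(2) T(2) finite_subgroup[OF fin H]
      by (intro H.p_closed_set_mult n) simp_all
    then have "p_closed G (S <#> T)" using eq[OF subset_refl] by simp
    then show "S <#> T \<in> {H. subgroup H G \<and> p_closed G H}" using H by simp
  qed
qed

end

section \<open>Nilpotent injectors of constrained groups\<close>

definition nilpotent_subgroups :: "('a, 'b) monoid_scheme \<Rightarrow> 'a set set" where
  "nilpotent_subgroups G = {H. subgroup H G \<and> nilpotent_group (G\<lparr>carrier := H\<rparr>)}"

text \<open>If the Fitting subgroup contains its centralizer these are the nilpotent injectors, see
  \<open>nilpotent_injector_iff\<close>.\<close>

definition max_nilpotent :: "('a, 'b) monoid_scheme \<Rightarrow> 'a set \<Rightarrow> bool" where
  "max_nilpotent G V \<longleftrightarrow> subgroup V G \<and> p_closed G V \<and> fitting_subgroup G \<subseteq> V \<and>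
     (\<forall>W. subgroup W G \<longrightarrow> p_closed G W \<longrightarrow> V \<subseteq> W \<longrightarrow> W = V)"

text \<open>The centralizer of the \<open>p'\<close>-part of the Fitting subgroup; elements of prime power order suffice
  as they generate this part.\<close>

definition mann_centralizer :: "('a, 'b) monoid_scheme \<Rightarrow> nat \<Rightarrow> 'a set" where
  "mann_centralizer G p =
     centralizer G {y \<in> fitting_subgroup G. \<exists>q. prime q \<and> q \<noteq> p \<and> p_element G q y}"

definition mann_system :: "('a, 'b) monoid_scheme \<Rightarrow> (nat \<Rightarrow> 'a set) \<Rightarrow> bool" where
  "mann_system G P \<longleftrightarrow> (\<forall>p. prime p \<longrightarrow> max_p_subgroup_of G p (mann_centralizer G p) (P p))"

definition mann_product :: "('a, 'b) monoid_scheme \<Rightarrow> (nat \<Rightarrow> 'a set) \<Rightarrow> 'a set" where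
  "mann_product G P = subgroup_prod G (P ` {p. prime p})"

context group
begin

lemma mult_past_commutators:
  assumes "c \<in> carrier G" "d \<in> carrier G" "f \<in> carrier G" "a \<in> carrier G" "b \<in> carrier G"
    and cf: "c \<otimes> f = f \<otimes> a \<otimes> c" and df: "d \<otimes> f = f \<otimes> b \<otimes> d" and cb: "c \<otimes> b = b \<otimes> c"
  shows "c \<otimes> d \<otimes> f = f \<otimes> (a \<otimes> b) \<otimes> (c \<otimes> d)"
proof -
  note car = assms(1-5)
  have "c \<otimes> d \<otimes> f = c \<otimes> (d \<otimes> f)" using car by (simp add: m_assoc)
  also have "\<dots> = (c \<otimes> f) \<otimes> b \<otimes> d" unfolding df using car by (simp add: m_assoc)
  also have "\<dots> = f \<otimes> a \<otimes> (c \<otimes> b) \<otimes> d" unfolding cf using car by (simp add: m_assoc)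
  also have "\<dots> = f \<otimes> (a \<otimes> b) \<otimes> (c \<otimes> d)" unfolding cb using car by (simp add: m_assoc)
  finally show ?thesis .
qed

text \<open>The three subgroups lemma in the case where \<open>C\<close> centralizes all commutators of \<open>C\<close> with \<open>F\<close>:
  \<open>C\<close> then acts on \<open>F\<close> as an abelian group.\<close>

lemma three_subgroups:
  assumes C: "C \<lhd> G" and F: "F \<subseteq> carrier G" "\<And>g f. g \<in> carrier G \<Longrightarrow> f \<in> F \<Longrightarrow> g \<otimes> f \<otimes> inv g \<in> F"
    and comm: "\<And>c d f. c \<in> C \<Longrightarrow> d \<in> C \<Longrightarrow> f \<in> F \<Longrightarrow>
      d \<otimes> (inv f \<otimes> c \<otimes> f \<otimes> inv c) = (inv f \<otimes> c \<otimes> f \<otimes> inv c) \<otimes> d"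
    and c: "c \<in> C" and d: "d \<in> C" and f: "f \<in> F"
  shows "(c \<otimes> d \<otimes> inv c \<otimes> inv d) \<otimes> f = f \<otimes> (c \<otimes> d \<otimes> inv c \<otimes> inv d)"
proof -
  note sC = normal_imp_subgroup[OF C]
  have cc: "c \<in> carrier G" "d \<in> carrier G" using c d subgroup.mem_carrier[OF sC] by auto
  have act: "c \<otimes> d \<otimes> f = (d \<otimes> c) \<otimes> f \<otimes> inv (d \<otimes> c) \<otimes> (c \<otimes> d)" if f: "f \<in> F" for f
  proof -
    have fc: "f \<in> carrier G" using f F(1) by auto
    define a b where "a = inv f \<otimes> c \<otimes> f \<otimes> inv c" and "b = inv f \<otimes> d \<otimes> f \<otimes> inv d"
    have ab: "a \<in> carrier G" "b \<in> carrier G" using cc fc unfolding a_def b_def by simp_all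
    have cf: "c \<otimes> f = f \<otimes> a \<otimes> c" and df: "d \<otimes> f = f \<otimes> b \<otimes> d"
      unfolding a_def b_def using fc cc by (simp_all add: m_assoc inv_cancel_left)
    have cb: "c \<otimes> b = b \<otimes> c" and da: "d \<otimes> a = a \<otimes> d"
      unfolding a_def b_def using comm c d f by auto
    \<comment> \<open>Both factors of \<open>a = (inv f \<otimes> c \<otimes> f) \<otimes> inv c\<close> lie in the normal subgroup \<open>C\<close>,
      which commutes with \<open>b\<close>.\<close>
    have "inv f \<otimes> c \<otimes> f \<in> C" using normal.inv_op_closed1[OF C fc c] .
    then have "a \<in> C" unfolding a_def using subgroup.m_closed[OF sC] subgroup.m_inv_closed[OF sC c] by blast
    then have "a \<otimes> b = b \<otimes> a" using comm[OF d _ f, folded b_def] by blast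
    then have 1: "c \<otimes> d \<otimes> f = f \<otimes> (a \<otimes> b) \<otimes> (c \<otimes> d)" and 2: "d \<otimes> c \<otimes> f = f \<otimes> (a \<otimes> b) \<otimes> (d \<otimes> c)"
      using mult_past_commutators[OF cc fc ab cf df cb]
        mult_past_commutators[OF cc(2,1) fc ab(2,1) df cf da] by simp_all
    show ?thesis unfolding 1 2 using ab cc fc by (simp add: m_assoc inv_mult_group inv_cancel_left)
  qed
  have fc: "f \<in> carrier G" using f F(1) by auto
  define f' where "f' = inv (d \<otimes> c) \<otimes> f \<otimes> (d \<otimes> c)"
  have f': "f' \<in> F" unfolding f'_def using F(2)[of "inv (d \<otimes> c)" f] f cc by simp
  have "(d \<otimes> c) \<otimes> f' \<otimes> inv (d \<otimes> c) = f" unfolding f'_def using fc cc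
    by (simp add: m_assoc inv_mult_group inv_cancel_left)
  then have "c \<otimes> d \<otimes> f' = f \<otimes> (c \<otimes> d)" using act[OF f'] by simp
  then have "c \<otimes> d \<otimes> f' \<otimes> inv (d \<otimes> c) = f \<otimes> (c \<otimes> d) \<otimes> inv (d \<otimes> c)" by simp
  then show ?thesis unfolding f'_def using fc cc by (simp add: m_assoc inv_mult_group inv_cancel_left)
qed

lemma fitting_subgroup_eq_radical:
  assumes H: "subgroup H G"
  shows "fitting_subgroup (G\<lparr>carrier := H\<rparr>) = radical G (nilpotent_subgroups G) H"
proof -
  have "{N. N \<lhd> G\<lparr>carrier := H\<rparr> \<and> nilpotent_group (G\<lparr>carrier := N\<rparr>)} =
    {N \<in> nilpotent_subgroups G. N \<lhd> G\<lparr>carrier := H\<rparr>}"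
    unfolding nilpotent_subgroups_def using normal_in_iff[OF H] by auto
  moreover have "subgroup_prod (G\<lparr>carrier := H\<rparr>) {N \<in> nilpotent_subgroups G. N \<lhd> G\<lparr>carrier := H\<rparr>} =
    subgroup_prod G {N \<in> nilpotent_subgroups G. N \<lhd> G\<lparr>carrier := H\<rparr>}"
    by (rule subgroup_prod_consistent[OF H]) (simp add: normal_in_iff[OF H])
  ultimately show ?thesis
    unfolding fitting_subgroup_def class_radical_def radical_def by simp
qed

context
  assumes fin: "finite (carrier G)"
begin

lemma nilpotent_subgroups_iff:
  "H \<in> nilpotent_subgroups G \<longleftrightarrow> subgroup H G \<and> p_closed G H"
  unfolding nilpotent_subgroups_def using nilpotent_subgroup_iff[OF fin] by auto

lemma fitting_set_nilpotent_subgroups: "fitting_set G (nilpotent_subgroups G)"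
  unfolding nilpotent_subgroups_def by (rule nilpotent_fitting_set[OF fin])

lemma fitting_subgroup_radical: "fitting_subgroup G = radical G (nilpotent_subgroups G) (carrier G)"
  using fitting_subgroup_eq_radical[OF subgroup_self] by simp

lemma fitting_subgroup_normal: "fitting_subgroup G \<lhd> G"
  using radical_normal[OF fitting_set_nilpotent_subgroups fin subgroup_self]
  by (simp add: fitting_subgroup_radical)

lemma p_closed_fitting_subgroup: "p_closed G (fitting_subgroup G)"
  using radical_in[OF fitting_set_nilpotent_subgroups fin subgroup_self]
  by (simp add: fitting_subgroup_radical nilpotent_subgroups_iff)

lemma fitting_subgroup_contains: "N \<lhd> G \<Longrightarrow> p_closed G N \<Longrightarrow> N \<subseteq> fitting_subgroup G"
  using radical_contains[OF fitting_set_nilpotent_subgroups fin, of N "carrier G"]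
  by (simp add: fitting_subgroup_radical nilpotent_subgroups_iff normal_imp_subgroup)

lemma fitting_subgroup_subnormal:
  assumes "subnormal G N"
  shows "fitting_subgroup (G\<lparr>carrier := N\<rparr>) = fitting_subgroup G \<inter> N"
proof -
  note F = fitting_set_nilpotent_subgroups
  have N: "subgroup N G" using assms by (rule subnormal_subgroup)
  have "fitting_subgroup G \<inter> N \<lhd> G\<lparr>carrier := N\<rparr>"
    using normal_Int_subgroup[OF N fitting_subgroup_normal] .
  moreover have "fitting_subgroup G \<inter> N \<in> nilpotent_subgroups G"
    using calculation normal_in_iff[OF N] p_closed_subset[OF p_closed_fitting_subgroup]
    by (auto simp: nilpotent_subgroups_iff)
  ultimately have "fitting_subgroup G \<inter> N \<subseteq> radical G (nilpotent_subgroups G) N"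
    using radical_contains[OF F fin] by blast
  then show ?thesis
    using radical_of_subnormal[OF F fin assms] radical_subset[OF F fin N]
    by (auto simp: fitting_subgroup_radical fitting_subgroup_eq_radical[OF N])
qed

lemma fitting_carrier: "x \<in> fitting_subgroup G \<Longrightarrow> x \<in> carrier G"
  using subgroup.mem_carrier[OF normal_imp_subgroup[OF fitting_subgroup_normal]] .

lemma fitting_conj: "g \<in> carrier G \<Longrightarrow> x \<in> fitting_subgroup G \<Longrightarrow> g \<otimes> x \<otimes> inv g \<in> fitting_subgroup G"
  using normal_invE(2)[OF fitting_subgroup_normal] .

lemma mann_centralizer_normal: "mann_centralizer G p \<lhd> G"
  unfolding mann_centralizer_def using fitting_carrier fitting_conj p_element_conj
  by (intro centralizer_normal) auto

lemmas mann_centralizer_subgroup = normal_imp_subgroup[OF mann_centralizer_normal]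

lemma mann_centralizer_commute:
  assumes "x \<in> mann_centralizer G p" "y \<in> fitting_subgroup G" "prime q" "q \<noteq> p" "p_element G q y"
  shows "x \<otimes> y = y \<otimes> x"
  using assms unfolding mann_centralizer_def centralizer_def by auto

lemma mann_centralizer_commute':
  fixes m :: nat
  assumes x: "x \<in> mann_centralizer G p" and y: "y \<in> fitting_subgroup G" "y [^] m = \<one>" and m: "\<not> p dvd m"
  shows "x \<otimes> y = y \<otimes> x"
proof (rule commute_by_primary[of x y m])
  show "x \<in> carrier G" using x subgroup.mem_carrier[OF mann_centralizer_subgroup] by blast
  show "m > 0" using m by (auto intro: Nat.gr0I)
  show "x \<otimes> y [^] j = y [^] j \<otimes> x" if "prime q" "q dvd m" "p_element G q (y [^] j)" for q and j :: nat
    using that m y pow_mem[OF normal_imp_subgroup[OF fitting_subgroup_normal]]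
    by (intro mann_centralizer_commute[OF x, of _ q]) auto
qed (use y fitting_carrier in auto)

lemma mann_centralizer_Int:
  assumes pq: "p \<noteq> q"
  shows "mann_centralizer G p \<inter> mann_centralizer G q \<subseteq> centralizer G (fitting_subgroup G)"
proof
  fix x assume x: "x \<in> mann_centralizer G p \<inter> mann_centralizer G q"
  have xc: "x \<in> carrier G" using x subgroup.mem_carrier[OF mann_centralizer_subgroup] by blast
  have "x \<otimes> y = y \<otimes> x" if y: "y \<in> fitting_subgroup G" for y
  proof (rule commute_by_primary[OF xc fitting_carrier[OF y]])
    show "order G > 0" using fin order_gt_0_iff_finite by simp
    show "y [^] order G = \<one>" using fitting_carrier[OF y] by (rule pow_order_eq_1)
    show "x \<otimes> y [^] j = y [^] j \<otimes> x" if "prime r" "r dvd order G" "p_element G r (y [^] j)" for r and j :: nat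
      using that x pq mann_centralizer_commute[of x p "y [^] j" r] mann_centralizer_commute[of x q "y [^] j" r]
        pow_mem[OF normal_imp_subgroup[OF fitting_subgroup_normal] y] by (cases "r = p") auto
  qed
  then show "x \<in> centralizer G (fitting_subgroup G)" using xc by (simp add: centralizer_def)
qed

lemma fitting_p_part_subset:
  assumes "prime p"
  shows "{x \<in> fitting_subgroup G. p_element G p x} \<subseteq> mann_centralizer G p"
  using p_closed_commute_primary[OF normal_imp_subgroup[OF fitting_subgroup_normal] p_closed_fitting_subgroup]
    assms fitting_carrier unfolding mann_centralizer_def centralizer_def by auto

lemma mann_system_D:
  assumes "mann_system G P" "prime p"
  shows "subgroup (P p) G" "P p \<subseteq> mann_centralizer G p" "\<And>x. x \<in> P p \<Longrightarrow> p_element G p x"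
    "max_p_subgroup_of G p (mann_centralizer G p) (P p)"
  using assms by (auto simp: mann_system_def max_p_subgroup_of_def p_subgroup_of_def)

lemma mann_product_subgroup:
  assumes P: "mann_system G P"
  shows "subgroup (mann_product G P) G"
proof -
  have "P p \<subseteq> carrier G" if "prime p" for p using mann_system_D(1)[OF P that] by (rule subgroup.subset)
  then show ?thesis unfolding mann_product_def subgroup_prod_def by (intro generate_is_subgroup) auto
qed

lemma mann_product_contains: "prime p \<Longrightarrow> P p \<subseteq> mann_product G P"
  unfolding mann_product_def subgroup_prod_def by (auto intro: generate.incl)

lemma mann_product_minimal:
  "subgroup H G \<Longrightarrow> (\<And>p. prime p \<Longrightarrow> P p \<subseteq> H) \<Longrightarrow> mann_product G P \<subseteq> H"
  unfolding mann_product_def subgroup_prod_def by (intro generate_subgroup_incl) auto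

lemma subset_mann_product:
  assumes P: "mann_system G P" and W: "subgroup W G"
    and sub: "\<And>p x. prime p \<Longrightarrow> x \<in> W \<Longrightarrow> p_element G p x \<Longrightarrow> x \<in> P p"
  shows "W \<subseteq> mann_product G P"
proof
  fix w assume w: "w \<in> W"
  note car = subgroup.mem_carrier[OF W]
  show "w \<in> mann_product G P"
  proof (rule primary_generation[OF mann_product_subgroup[OF P] car[OF w]])
    show "w [^] order G = \<one>" using car[OF w] by (rule pow_order_eq_1)
    show "order G > 0" using fin order_gt_0_iff_finite by simp
    show "w [^] j \<in> mann_product G P"
      if q: "prime q" "q dvd order G" "(w [^] j) [^] (q ^ k) = \<one>" for q k and j :: nat
    proof -
      have "w [^] j \<in> P q"
        using q pow_mem[OF W w] car by (intro sub) (auto simp: p_element_def)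
      then show ?thesis using mann_product_contains[OF q(1)] by blast
    qed
  qed
qed

lemma fitting_subset_mann_product:
  assumes P: "mann_system G P"
  shows "fitting_subgroup G \<subseteq> mann_product G P"
proof (rule subset_mann_product[OF P normal_imp_subgroup[OF fitting_subgroup_normal]])
  fix p x assume p: "prime p" and x: "x \<in> fitting_subgroup G" "p_element G p x"
  then show "x \<in> P p"
    using max_p_subgroup_contains_normal[OF mann_system_D(4)[OF P p] mann_centralizer_subgroup
      p_part_normal[OF fitting_subgroup_normal p_closed_fitting_subgroup p] fitting_p_part_subset[OF p]]
    by auto
qed

text \<open>The hypothesis on the \<open>p\<close>-elements of \<open>W\<close> holds if \<open>W\<close> contains the Fitting subgroup
  (\<open>mann_product_exists'\<close>), because the elements of coprime order in \<open>W\<close> commute. In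
  \<open>max_nilpotent_normal\<close> it comes from a coprime action instead.\<close>

lemma mann_product_exists:
  assumes W: "subgroup W G" "p_closed G W"
    and sub: "\<And>p x. prime p \<Longrightarrow> x \<in> W \<Longrightarrow> p_element G p x \<Longrightarrow> x \<in> mann_centralizer G p"
  obtains P where "mann_system G P" "W \<subseteq> mann_product G P"
proof -
  have "\<exists>Q. max_p_subgroup_of G p (mann_centralizer G p) Q \<and> {x \<in> W. p_element G p x} \<subseteq> Q"
    if p: "prime p" for p
  proof -
    have "p_subgroup_of G p (mann_centralizer G p) {x \<in> W. p_element G p x}"
      using subgroup_p_part[OF W p] sub p by (auto simp: p_subgroup_of_def)
    then show ?thesis using p_subgroup_in_max[OF fin] by metis
  qed
  then obtain P where P: "\<And>p. prime p \<Longrightarrow> max_p_subgroup_of G p (mann_centralizer G p) (P p)"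
    "\<And>p. prime p \<Longrightarrow> {x \<in> W. p_element G p x} \<subseteq> P p" by metis
  have sys: "mann_system G P" using P(1) by (simp add: mann_system_def)
  have "W \<subseteq> mann_product G P" using P(2) by (intro subset_mann_product[OF sys W(1)]) auto
  then show ?thesis using that sys by blast
qed

lemma mann_product_exists':
  assumes W: "subgroup W G" "p_closed G W" "fitting_subgroup G \<subseteq> W"
  obtains P where "mann_system G P" "W \<subseteq> mann_product G P"
proof (rule mann_product_exists[OF W(1,2)])
  fix p x assume p: "prime p" and x: "x \<in> W" "p_element G p x"
  have "x \<otimes> y = y \<otimes> x" if "y \<in> fitting_subgroup G" "prime q" "q \<noteq> p" "p_element G q y" for q y
    using p_closed_commute_primary[OF W(1,2) p that(2) _ x] that W(3) by blast
  then show "x \<in> mann_centralizer G p"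
    unfolding mann_centralizer_def centralizer_def using x subgroup.mem_carrier[OF W(1)] by auto
qed (use that in blast)

context
  assumes con: "nilpotent_constrained G"
begin

text \<open>For different primes the two centralizers commute modulo the center of the Fitting subgroup:
  \<open>z = [c, x]\<close> centralizes the Fitting subgroup and hence lies in it. The \<open>p\<close>-part of \<open>z\<close> belongs to
  \<open>P\<close>, its \<open>p'\<close>-part commutes with \<open>x\<close>. Since \<open>z \<otimes> x\<close> is a conjugate of \<open>x\<close> and has \<open>p\<close>-power order,
  the \<open>p'\<close>-part of \<open>z\<close> is trivial and \<open>z \<otimes> x\<close> stays in \<open>P\<close>.\<close>

lemma mann_normalize:
  assumes pq: "prime p" "prime q" "p \<noteq> q" and P: "max_p_subgroup_of G p (mann_centralizer G p) P"
    and c: "c \<in> mann_centralizer G q" and x: "x \<in> P"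
  shows "c \<otimes> x \<otimes> inv c \<in> P"
proof -
  let ?F = "fitting_subgroup G"
  note sF = normal_imp_subgroup[OF fitting_subgroup_normal]
  note cp = mann_centralizer_subgroup[of p] and cq = mann_centralizer_subgroup[of q]
  have P': "subgroup P G" "x \<in> mann_centralizer G p" "\<And>x. x \<in> P \<Longrightarrow> p_element G p x"
    using P x by (auto simp: max_p_subgroup_of_def p_subgroup_of_def)
  have cc: "c \<in> carrier G" "x \<in> carrier G" using c P' cp cq subgroup.mem_carrier by metis+
  define z where "z = c \<otimes> x \<otimes> inv c \<otimes> inv x"
  have zc: "z \<in> carrier G" unfolding z_def using cc by simp
  have "z \<in> mann_centralizer G p" unfolding z_def
    using normal_invE(2)[OF mann_centralizer_normal] P' cc subgroup.m_closed[OF cp] subgroup.m_inv_closed[OF cp] by blast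
  moreover have "z = c \<otimes> (x \<otimes> inv c \<otimes> inv x)" unfolding z_def using cc by (simp add: m_assoc)
  then have "z \<in> mann_centralizer G q"
    using normal_invE(2)[OF mann_centralizer_normal] c cc subgroup.m_closed[OF cq] subgroup.m_inv_closed[OF cq] by metis
  ultimately have zF: "z \<in> ?F"
    using mann_centralizer_Int[OF pq(3)] con unfolding nilpotent_constrained_def by blast
  obtain u v m :: nat where uv: "z = z [^] u \<otimes> z [^] v" "p_element G p (z [^] u)" "\<not> p dvd m" "(z [^] v) [^] m = \<one>"
    using p_element_finite_decomposition[OF fin zc pq(1), of 0] by metis
  let ?w = "z [^] u \<otimes> x" and ?d = "z [^] v"
  have "{x \<in> ?F. p_element G p x} \<subseteq> P"
    using max_p_subgroup_contains_normal[OF P cp p_part_normal[OF fitting_subgroup_normal p_closed_fitting_subgroup pq(1)]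
      fitting_p_part_subset[OF pq(1)]] by simp
  then have zu: "z [^] u \<in> P" using uv(2) pow_mem[OF sF zF] by blast
  then have w: "?w \<in> P" using x subgroup.m_closed[OF P'(1)] by blast
  have xd: "x \<otimes> ?d = ?d \<otimes> x" using mann_centralizer_commute'[OF P'(2) pow_mem[OF sF zF] uv(4,3)] .
  have zz: "z [^] u \<otimes> ?d = ?d \<otimes> z [^] u" using zc by (simp add: nat_pow_mult add.commute)
  have dw: "?d \<otimes> ?w = ?w \<otimes> ?d" using xd zz zc cc by (metis m_assoc nat_pow_closed)
  have cx: "c \<otimes> x \<otimes> inv c = z \<otimes> x" unfolding z_def using cc by (simp add: m_assoc)
  also have "\<dots> = (?d \<otimes> z [^] u) \<otimes> x" using uv(1) zz by simp
  also have "\<dots> = ?d \<otimes> ?w" using zc cc by (simp add: m_assoc)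
  finally have cx: "c \<otimes> x \<otimes> inv c = ?d \<otimes> ?w" .
  have "p_element G p (c \<otimes> x \<otimes> inv c \<otimes> inv ?w)"
  proof (rule p_element_commute_mult)
    show "p_element G p (c \<otimes> x \<otimes> inv c)" using P'(3)[OF x] cc by (intro p_element_conj)
    show "p_element G p (inv ?w)" using P'(3)[OF w] by (rule p_element_inv)
    show "c \<otimes> x \<otimes> inv c \<otimes> inv ?w = inv ?w \<otimes> (c \<otimes> x \<otimes> inv c)"
      unfolding cx using conj_commuting(2)[of ?w ?d] dw zc cc
      by (metis conj_commuting(2) inv_closed inv_solve_right m_assoc m_closed nat_pow_closed)
  qed
  moreover have "c \<otimes> x \<otimes> inv c \<otimes> inv ?w = ?d" unfolding cx using zc cc by (simp add: m_assoc)
  ultimately have "p_element G p ?d" by simp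
  then obtain l where "?d [^] (p ^ l) = \<one>" by (auto simp: p_element_def)
  then have "?d = \<one>"
    using pow_coprime_one[of ?d "p ^ l" m] uv(4) coprime_prime_power[OF pq(1) uv(3)] zc by auto
  then show ?thesis using cx w zc cc by simp
qed

text \<open>By \<open>mann_normalize\<close> the factors \<open>P p\<close> normalize each other, so the product is a join of normal
  \<open>p\<close>-subgroups and Fitting's theorem applies.\<close>

lemma mann_product_p_closed:
  assumes P: "mann_system G P"
  shows "p_closed G (mann_product G P)"
proof -
  let ?V = "mann_product G P"
  let ?H = "G\<lparr>carrier := ?V\<rparr>"
  note V = mann_product_subgroup[OF P]
  interpret V: group "?H" using V by (rule subgroup_imp_group)
  have norm: "P p \<lhd> ?H" if p: "prime p" for p
  proof -
    let ?N = "{g \<in> carrier G. \<forall>s\<in>P p. g \<otimes> s \<otimes> inv g \<in> P p \<and> inv g \<otimes> s \<otimes> g \<in> P p}"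
    note Pp = mann_system_D[OF P p]
    have N: "subgroup ?N G" using subgroup.subset[OF Pp(1)] by (rule normalizing_subgroup)
    have "P q \<subseteq> ?N" if q: "prime q" for q
    proof
      fix g assume g: "g \<in> P q"
      note Pq = mann_system_D[OF P q]
      have gc: "g \<in> carrier G" using g subgroup.mem_carrier[OF Pq(1)] by blast
      show "g \<in> ?N"
      proof (cases "q = p")
        case True
        then show ?thesis using g gc subgroup.m_closed[OF Pp(1)] subgroup.m_inv_closed[OF Pp(1)] by auto
      next
        case False
        then have "h \<otimes> s \<otimes> inv h \<in> P p" if "h \<in> P q" "s \<in> P p" for h s
          using mann_normalize[OF p q _ Pp(4)] Pq(2) that by auto
        from this[OF g] this[OF subgroup.m_inv_closed[OF Pq(1) g]] show ?thesis using gc by auto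
      qed
    qed
    then have "?V \<subseteq> ?N" using mann_product_minimal[OF N] by blast
    then show ?thesis using normal_in_iff[OF V] Pp(1) mann_product_contains[OF p] by blast
  qed
  have finV: "finite (carrier ?H)" using finite_subgroup[OF fin V] by simp
  have "p_closed ?H (subgroup_prod ?H (P ` {p. prime p}))"
  proof (rule V.normal_join_induct(2)[OF finV, of _ "p_closed ?H"])
    show "p_closed ?H {\<one>\<^bsub>?H\<^esub>}"
      by (simp add: p_closed_def)
    show "N \<lhd> ?H" if "N \<in> P ` {p. prime p}" for N using norm that by auto
    show "p_closed ?H N" if N: "N \<in> P ` {p. prime p}" for N
    proof -
      obtain p where p: "prime p" "N = P p" using N by auto
      have "p_closed G (P p)" using mann_system_D[OF P p(1)] p(1) by (intro p_closed_p_subgroup) auto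
      then show ?thesis using p_closed_sub[OF V mann_product_contains[OF p(1)]] p(2) by simp
    qed
    show "p_closed ?H (A <#>\<^bsub>?H\<^esub> B)"
      if "A \<lhd> ?H" "B \<lhd> ?H"
        "p_closed ?H A" "p_closed ?H B" for A B
      using V.p_closed_set_mult[OF finV] that by blast
  qed
  moreover have "subgroup_prod ?H (P ` {p. prime p}) = ?V"
    using subgroup_prod_consistent[OF V, of "P ` {p. prime p}"] mann_product_contains
    unfolding mann_product_def by auto
  ultimately show ?thesis using p_closed_sub[OF V subset_refl] by simp
qed

text \<open>The primes are treated one after the other. The element \<open>c\<close> that adjusts the factor for \<open>q\<close> can
  be chosen in \<open>mann_centralizer G q\<close>, and by \<open>mann_normalize\<close> it does not disturb the factors
  for the other primes.\<close>

lemma mann_system_conjugate: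
  assumes P: "mann_system G P" and Q: "mann_system G Q"
  shows "finite \<pi> \<Longrightarrow> (\<And>p. p \<in> \<pi> \<Longrightarrow> prime p) \<Longrightarrow>
    \<exists>g\<in>carrier G. \<forall>p\<in>\<pi>. Q p = conj_subgroup G (P p) g"
proof (induction \<pi> rule: finite_induct)
  case empty
  show ?case by auto
next
  case (insert q \<pi>)
  then obtain g where g: "g \<in> carrier G" "\<forall>p\<in>\<pi>. Q p = conj_subgroup G (P p) g" by auto
  have q: "prime q" using insert.prems by simp
  have Pc: "P p \<subseteq> carrier G" "Q p \<subseteq> carrier G" if "prime p" for p
    using mann_system_D(1)[OF P that] mann_system_D(1)[OF Q that] by (auto dest: subgroup.subset)
  obtain c where c: "c \<in> mann_centralizer G q" "Q q = conj_subgroup G (conj_subgroup G (P q) g) c"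
    using max_p_subgroups_conjugate[OF fin q mann_centralizer_subgroup
      max_p_subgroup_conj[OF mann_system_D(4)[OF P q] mann_centralizer_normal g(1)] mann_system_D(4)[OF Q q]] .
  have cc: "c \<in> carrier G" using c(1) subgroup.mem_carrier[OF mann_centralizer_subgroup] by blast
  have "Q p = conj_subgroup G (P p) (g \<otimes> c)" if p: "p \<in> insert q \<pi>" for p
  proof (cases "p = q")
    case True
    then show ?thesis using c(2) cc g Pc[OF q] by (simp add: conj_subgroup_mult)
  next
    case False
    then have p': "p \<in> \<pi>" "prime p" using p insert.prems by auto
    have n: "d \<otimes> s \<otimes> inv d \<in> Q p" if "d \<in> mann_centralizer G q" "s \<in> Q p" for d s
      using mann_normalize[OF p'(2) q False mann_system_D(4)[OF Q p'(2)] that] .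
    have "conj_subgroup G (Q p) c = Q p"
      using n[OF c(1)] n[OF subgroup.m_inv_closed[OF mann_centralizer_subgroup c(1)]] cc
      by (intro conj_subgroup_fixed Pc(2)[OF p'(2)]) auto
    then show ?thesis using g p' Pc(1)[OF p'(2)] cc by (simp add: conj_subgroup_mult)
  qed
  then show ?case using g(1) cc by blast
qed

lemma mann_product_conj_subset:
  assumes P: "mann_system G P" and g: "g \<in> carrier G"
    and eq: "\<And>p. prime p \<Longrightarrow> Q p = conj_subgroup G (P p) g"
  shows "mann_product G Q \<subseteq> conj_subgroup G (mann_product G P) g"
  using eq conj_subgroup_mono[OF mann_product_contains[where P = P]]
  by (intro mann_product_minimal subgroup_conj_subgroup mann_product_subgroup P g) simp

lemma mann_products_conjugate:
  assumes P: "mann_system G P" and Q: "mann_system G Q"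
  obtains g where "g \<in> carrier G" "mann_product G Q = conj_subgroup G (mann_product G P) g"
proof -
  have "finite {p. prime p \<and> p dvd order G}"
    using finite_divisors_nat[of "order G"] fin order_gt_0_iff_finite by auto
  then obtain g where g: "g \<in> carrier G"
    "\<forall>p\<in>{p. prime p \<and> p dvd order G}. Q p = conj_subgroup G (P p) g"
    using mann_system_conjugate[OF P Q, of "{p. prime p \<and> p dvd order G}"] by blast
  have triv: "R p = {\<one>}" if R: "mann_system G R" and p: "prime p" "\<not> p dvd order G" for R p
  proof -
    have "x = \<one>" if x: "x \<in> R p" for x
    proof -
      obtain k where k: "x \<in> carrier G" "x [^] (p ^ k) = \<one>"
        using mann_system_D(3)[OF R p(1) x] by (auto simp: p_element_def)
      then show ?thesis using pow_coprime_one[OF k pow_order_eq_1[OF k(1)] coprime_prime_power[OF p]] by simp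
    qed
    then show ?thesis using subgroup.one_closed[OF mann_system_D(1)[OF R p(1)]] by blast
  qed
  have eq: "Q p = conj_subgroup G (P p) g" if p: "prime p" for p
  proof (cases "p dvd order G")
    case False
    then show ?thesis using triv[OF P p] triv[OF Q p] g(1) by (simp add: conj_subgroup_def)
  next
    case True
    then show ?thesis using g(2) p by blast
  qed
  have Pc: "P p \<subseteq> carrier G" if "prime p" for p
    using mann_system_D(1)[OF P that] by (auto dest: subgroup.subset)
  have ig: "inv g \<in> carrier G" using g(1) by simp
  have "P p = conj_subgroup G (Q p) (inv g)" if p: "prime p" for p
    using eq[OF p] conj_subgroup_cancel(1)[OF Pc[OF p] g(1)] by simp
  then have "mann_product G P \<subseteq> conj_subgroup G (mann_product G Q) (inv g)"
    by (rule mann_product_conj_subset[OF Q ig])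
  then have "conj_subgroup G (mann_product G P) g \<subseteq> conj_subgroup G (conj_subgroup G (mann_product G Q) (inv g)) g"
    by (rule conj_subgroup_mono)
  also have "\<dots> = mann_product G Q"
    using conj_subgroup_cancel(2)[OF subgroup.subset[OF mann_product_subgroup[OF Q]] g(1)] .
  finally show ?thesis using that[OF g(1)] mann_product_conj_subset[OF P g(1) eq] by blast
qed

text \<open>A larger nilpotent subgroup is contained in another product, which has the same order.\<close>

lemma mann_product_max_nilpotent:
  assumes P: "mann_system G P"
  shows "max_nilpotent G (mann_product G P)"
  unfolding max_nilpotent_def
proof (intro conjI allI impI)
  note F = fitting_subset_mann_product[OF P]
  show "subgroup (mann_product G P) G" "p_closed G (mann_product G P)" "fitting_subgroup G \<subseteq> mann_product G P"
    using mann_product_subgroup[OF P] mann_product_p_closed[OF P] F by auto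
  fix W assume W: "subgroup W G" "p_closed G W" "mann_product G P \<subseteq> W"
  have FW: "fitting_subgroup G \<subseteq> W" using F W(3) by blast
  obtain Q where Q: "mann_system G Q" "W \<subseteq> mann_product G Q"
    using mann_product_exists'[OF W(1,2) FW] .
  obtain g where g: "g \<in> carrier G" "mann_product G Q = conj_subgroup G (mann_product G P) g"
    using mann_products_conjugate[OF P Q(1)] .
  have "card (mann_product G Q) = card (mann_product G P)"
    unfolding g(2) using card_conj_subgroup[OF subgroup.subset[OF mann_product_subgroup[OF P]] g(1)] .
  moreover have "finite (mann_product G Q)"
    using finite_subgroup[OF fin mann_product_subgroup[OF Q(1)]] .
  ultimately have "mann_product G P = mann_product G Q"
    using W(3) Q(2) by (intro card_subset_eq) auto
  then show "W = mann_product G P" using W(3) Q(2) by auto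
qed

lemma max_nilpotent_mann_product:
  assumes V: "max_nilpotent G V"
  obtains P where "mann_system G P" "V = mann_product G P"
proof -
  have V': "subgroup V G" "p_closed G V" "fitting_subgroup G \<subseteq> V" using V by (auto simp: max_nilpotent_def)
  obtain P where P: "mann_system G P" "V \<subseteq> mann_product G P" using mann_product_exists'[OF V'] .
  then show ?thesis using that mann_product_subgroup mann_product_p_closed V
    unfolding max_nilpotent_def by metis
qed

lemma max_nilpotent_exists: obtains V where "max_nilpotent G V"
  using mann_product_exists'[OF normal_imp_subgroup[OF fitting_subgroup_normal] p_closed_fitting_subgroup subset_refl]
    mann_product_max_nilpotent by metis

lemma max_nilpotent_conjugate:
  assumes "max_nilpotent G V" "max_nilpotent G W"
  obtains g where "g \<in> carrier G" "W = conj_subgroup G V g"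
proof -
  obtain P where P: "mann_system G P" "V = mann_product G P" using max_nilpotent_mann_product[OF assms(1)] .
  obtain Q where Q: "mann_system G Q" "W = mann_product G Q" using max_nilpotent_mann_product[OF assms(2)] .
  show ?thesis using mann_products_conjugate[OF P(1) Q(1)] that unfolding P(2) Q(2) by metis
qed

text \<open>Let \<open>C\<close> be the centralizer in \<open>N\<close> of the Fitting subgroup of \<open>N\<close>. By \<open>three_subgroups\<close> the
  commutators of \<open>C\<close> centralize the Fitting subgroup of \<open>G\<close>, so they belong to the Fitting subgroup of
  \<open>N\<close> and are central in \<open>C\<close>. Hence \<open>C\<close> is nilpotent of class at most two; being normal in \<open>G\<close> it lies
  in the Fitting subgroup.\<close>

lemma constrained_normal:
  assumes N: "N \<lhd> G"
  shows "nilpotent_constrained (G\<lparr>carrier := N\<rparr>)"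
proof -
  let ?F = "fitting_subgroup G"
  note sN = normal_invE(1)[OF N] and sF = normal_imp_subgroup[OF fitting_subgroup_normal]
  have FN: "fitting_subgroup (G\<lparr>carrier := N\<rparr>) = ?F \<inter> N"
    using fitting_subgroup_subnormal[OF normal_subnormal[OF N]] .
  let ?C = "centralizer (G\<lparr>carrier := N\<rparr>) (?F \<inter> N)"
  have C: "?C = N \<inter> centralizer G (?F \<inter> N)"
    using subgroup.subset[OF sN] by (auto simp: centralizer_def)
  have cF: "centralizer G (?F \<inter> N) \<lhd> G"
    using fitting_carrier fitting_conj normal_invE(2)[OF N] by (intro centralizer_normal) auto
  have CN: "?C \<lhd> G" unfolding C using N cF by (rule normal_subgroup_intersect)
  note sC = normal_invE(1)[OF CN]
  note car = subgroup.mem_carrier[OF sC] fitting_carrier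
  have comm: "c \<otimes> a = a \<otimes> c" if "c \<in> ?C" "a \<in> ?F" "a \<in> N" for c a
    using that by (auto simp: centralizer_def)
  have key: "c \<otimes> d \<otimes> inv c \<otimes> inv d \<in> ?F \<inter> N" if c: "c \<in> ?C" and d: "d \<in> ?C" for c d
  proof -
    let ?k = "c \<otimes> d \<otimes> inv c \<otimes> inv d"
    have "e \<otimes> (inv f \<otimes> b \<otimes> f \<otimes> inv b) = (inv f \<otimes> b \<otimes> f \<otimes> inv b) \<otimes> e"
      if b: "b \<in> ?C" and e: "e \<in> ?C" and f: "f \<in> ?F" for b e f
    proof (rule comm[OF e])
      have "inv f \<otimes> (b \<otimes> f \<otimes> inv b) \<in> ?F"
        using b f car fitting_conj subgroup.m_closed[OF sF] subgroup.m_inv_closed[OF sF] by metis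
      then show "inv f \<otimes> b \<otimes> f \<otimes> inv b \<in> ?F" using b f car by (simp add: m_assoc)
      have "inv f \<otimes> b \<otimes> f \<in> N" "inv b \<in> N"
        using normal.inv_op_closed1[OF N car(2)[OF f]] b C subgroup.m_inv_closed[OF sN] by auto
      then show "inv f \<otimes> b \<otimes> f \<otimes> inv b \<in> N" by (rule subgroup.m_closed[OF sN])
    qed
    then have "?k \<otimes> f = f \<otimes> ?k" if "f \<in> ?F" for f
      using three_subgroups[OF CN subgroup.subset[OF sF] fitting_conj _ c d that] by blast
    then have "?k \<in> centralizer G ?F" using c d car by (simp add: centralizer_def)
    moreover have "?k \<in> N"
      using c d unfolding C by (blast intro: subgroup.m_closed[OF sN] subgroup.m_inv_closed[OF sN])
    ultimately show ?thesis using con unfolding nilpotent_constrained_def by auto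
  qed
  let ?H = "G\<lparr>carrier := ?C\<rparr>"
  interpret C: group "?H" using sC by (rule subgroup_imp_group)
  have inv: "inv\<^bsub>?H\<^esub> x = inv x" if "x \<in> ?C" for x using m_inv_consistent[OF sC that] .
  have kC: "c \<otimes> d \<otimes> inv c \<otimes> inv d \<in> ?C" if "c \<in> ?C" "d \<in> ?C" for c d
    using that subgroup.m_closed[OF sC] subgroup.m_inv_closed[OF sC] by metis
  have lc1: "lower_central ?H 1 \<subseteq> ?F \<inter> N \<inter> ?C"
  proof -
    have "subgroup (?F \<inter> N \<inter> ?C) G" using subgroups_Inter_pair sF sN sC by metis
    then have "subgroup (?F \<inter> N \<inter> ?C) ?H" using subgroup_of_subgroup_iff[OF sC] by simp
    then show ?thesis unfolding One_nat_def lower_central.simps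
      using key kC inv by (intro C.generate_subgroup_incl) auto
  qed
  have "lower_central ?H 2 \<subseteq> {\<one>}"
  proof -
    have "subgroup {\<one>} ?H" using C.triv_subgroup by simp
    moreover have "x \<otimes> y \<otimes> inv x \<otimes> inv y = \<one>" if "x \<in> lower_central ?H 1" "y \<in> ?C" for x y
    proof -
      have x: "x \<in> ?F" "x \<in> N" "x \<in> ?C" using that lc1 by auto
      have "x \<otimes> y = y \<otimes> x" using comm[OF that(2)] x by simp
      then show ?thesis using conj_commuting(1)[of x y] x that(2) car by simp
    qed
    ultimately show ?thesis unfolding numeral_2_eq_2 lower_central.simps(2)[of _ "Suc 0"]
      using lc1 inv by (intro C.generate_subgroup_incl) auto
  qed
  then have "lower_central ?H 2 = {\<one>}"
    using subgroup.one_closed[OF normal_imp_subgroup[OF C.lower_central_normal[of 2]]] by auto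
  then have "nilpotent_group ?H"
    unfolding nilpotent_group_def using C.is_group finite_subgroup[OF fin sC] by auto
  then have "p_closed G ?C" using nilpotent_subgroup_iff[OF fin sC] by simp
  then have "?C \<subseteq> ?F" using fitting_subgroup_contains[OF CN] by simp
  then show ?thesis unfolding nilpotent_constrained_def FN using C by auto
qed

text \<open>Let \<open>W\<close> be nilpotent with \<open>V \<inter> N \<le> W \<le> N\<close>. A \<open>p\<close>-element \<open>x\<close> of \<open>W\<close> commutes with every
  \<open>q\<close>-element \<open>y\<close> of the Fitting subgroup of \<open>G\<close> for \<open>q \<noteq> p\<close>: their commutator \<open>c\<close> is a \<open>q\<close>-element of
  the nilpotent group \<open>W\<close>, so it commutes with \<open>x\<close>, and then it is a \<open>p\<close>-element too. So \<open>W\<close> is contained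
  in a conjugate of \<open>V\<close>, and comparing orders gives \<open>W = V \<inter> N\<close>.\<close>

lemma max_nilpotent_normal:
  assumes V: "max_nilpotent G V" and N: "N \<lhd> G"
  shows "max_nilpotent (G\<lparr>carrier := N\<rparr>) (V \<inter> N)"
proof -
  let ?F = "fitting_subgroup G"
  note sN = normal_invE(1)[OF N] and sF = normal_imp_subgroup[OF fitting_subgroup_normal]
  note clN = subgroup.m_closed[OF sN] subgroup.m_inv_closed[OF sN]
  have V': "subgroup V G" "p_closed G V" "?F \<subseteq> V" using V by (auto simp: max_nilpotent_def)
  have FN: "fitting_subgroup (G\<lparr>carrier := N\<rparr>) = ?F \<inter> N"
    using fitting_subgroup_subnormal[OF normal_subnormal[OF N]] .
  have VN: "subgroup (V \<inter> N) G" "p_closed G (V \<inter> N)"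
    using subgroups_Inter_pair[OF V'(1) sN] p_closed_subset[OF V'(2)] by auto
  have max: "W = V \<inter> N" if W: "subgroup W G" "W \<subseteq> N" "p_closed G W" "V \<inter> N \<subseteq> W" for W
  proof -
    note car = subgroup.mem_carrier[OF W(1)] fitting_carrier
    have "x \<in> mann_centralizer G p" if p: "prime p" and x: "x \<in> W" "p_element G p x" for p x
    proof -
      have "x \<otimes> y = y \<otimes> x" if y: "y \<in> ?F" "prime q" "q \<noteq> p" "p_element G q y" for q y
      proof -
        have xy: "x \<in> carrier G" "y \<in> carrier G" "x \<in> N" using x y car W(2) by auto
        let ?y = "y \<otimes> inv x \<otimes> inv y"
        define c where "c = x \<otimes> y \<otimes> inv x \<otimes> inv y"
        have c': "c = x \<otimes> ?y" unfolding c_def using xy by (simp add: m_assoc)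
        have cF: "c \<in> ?F" "p_element G q c" unfolding c_def
          using fitting_conj[OF xy(1) y(1)] p_element_conj[OF y(4) xy(1)] subgroup.m_closed[OF sF] subgroup.m_inv_closed[OF sF]
            p_closedD[OF p_closed_fitting_subgroup y(2)] y p_element_inv by blast+
        moreover have "c \<in> N" unfolding c' using clN normal_invE(2)[OF N] xy by blast
        ultimately have cW: "c \<in> W" using V'(3) W(4) by auto
        have xc: "x \<otimes> c = c \<otimes> x"
          using p_closed_commute_primary[OF W(1,3) p y(2) _ x cW cF(2)] y(3) by simp
        have cc: "c \<in> carrier G" using cW car by auto
        have "?y = inv x \<otimes> c" unfolding c' using xy by (simp add: inv_cancel_left)
        then have "x \<otimes> ?y = ?y \<otimes> x" using conj_commuting(2)[OF xy(1) cc xc] xy cc by (simp add: inv_cancel_left)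
        moreover have "p_element G p ?y" using p_element_conj[OF p_element_inv[OF x(2)] xy(2)] .
        ultimately have "p_element G p c" unfolding c' using x(2) p_element_commute_mult by blast
        then have "c = \<one>"
          using cF(2) coprime_distinct_primes_power[OF p y(2)] y(3) pow_coprime_one unfolding p_element_def by metis
        moreover have "x \<otimes> y = c \<otimes> (y \<otimes> x)" unfolding c_def using xy by (simp add: m_assoc inv_cancel_left)
        ultimately show ?thesis using xy by simp
      qed
      then show ?thesis unfolding mann_centralizer_def centralizer_def using x car by auto
    qed
    then obtain P where P: "mann_system G P" "W \<subseteq> mann_product G P"
      using mann_product_exists[OF W(1,3)] by metis
    obtain g where g: "g \<in> carrier G" "mann_product G P = conj_subgroup G V g"
      using max_nilpotent_conjugate[OF V mann_product_max_nilpotent[OF P(1)]] .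
    have "W \<subseteq> conj_subgroup G (V \<inter> N) g"
    proof
      fix w assume w: "w \<in> W"
      then obtain v where v: "v \<in> V" "w = inv g \<otimes> v \<otimes> g"
        using P(2) unfolding g(2) by (auto simp: conj_subgroup_def)
      have "v \<in> carrier G" using v subgroup.mem_carrier[OF V'(1)] by blast
      then have "v = g \<otimes> w \<otimes> inv g" using v g by (simp add: m_assoc inv_cancel_left)
      then have "v \<in> N" using normal_invE(2)[OF N g(1)] w W(2) by auto
      then show "w \<in> conj_subgroup G (V \<inter> N) g" using v conj_subgroup_mem by blast
    qed
    moreover have "finite (conj_subgroup G (V \<inter> N) g)"
      using finite_subgroup[OF fin subgroup_conj_subgroup[OF VN(1) g(1)]] .
    ultimately have "card W \<le> card (V \<inter> N)"
      using card_mono card_conj_subgroup[OF subgroup.subset[OF VN(1)] g(1)] by metis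
    then show ?thesis using W(4) finite_subgroup[OF fin W(1)] card_seteq by blast
  qed
  show ?thesis unfolding max_nilpotent_def FN subgroup_of_subgroup_iff[OF sN]
    using VN V'(3) max p_closed_sub[OF sN] by auto
qed

end

end

lemma max_nilpotent_subnormal:
  assumes fin: "finite (carrier G)" and con: "nilpotent_constrained G" and V: "max_nilpotent G V"
  shows "subnormal G N \<Longrightarrow>
    nilpotent_constrained (G\<lparr>carrier := N\<rparr>) \<and> max_nilpotent (G\<lparr>carrier := N\<rparr>) (V \<inter> N)"
proof (induction rule: subnormal.induct)
  case self
  have "V \<inter> carrier G = V" using V subgroup.subset by (auto simp: max_nilpotent_def)
  then show ?case using con V by simp
next
  case (step K N)
  have K: "subgroup K G" using step.hyps subnormal_subgroup by auto
  interpret K: group "G\<lparr>carrier := K\<rparr>" using K by (rule subgroup_imp_group)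
  have fK: "finite (carrier (G\<lparr>carrier := K\<rparr>))" using finite_subgroup[OF fin K] by simp
  have NK: "V \<inter> K \<inter> N = V \<inter> N" using step.hyps(2) normal_in_iff[OF K] by auto
  show ?case
    using K.constrained_normal[OF fK _ step.hyps(2)] K.max_nilpotent_normal[OF fK _ _ step.hyps(2)]
      step.IH NK by fastforce
qed

lemma constrained_subnormal:
  assumes fin: "finite (carrier G)" and con: "nilpotent_constrained G"
  shows "subnormal G N \<Longrightarrow> nilpotent_constrained (G\<lparr>carrier := N\<rparr>)"
  using max_nilpotent_exists[OF fin con] max_nilpotent_subnormal[OF fin con] by metis

text \<open>Being maximal over the Fitting subgroup is inherited by the intersections with subnormal
  subgroups, which is the injector condition. Conversely, an injector contains the Fitting subgroup
  because that is itself a nilpotent normal subgroup.\<close>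

theorem nilpotent_injector_iff:
  assumes fin: "finite (carrier G)" and con: "nilpotent_constrained G"
  shows "class_injector G nilpotent_group V \<longleftrightarrow> max_nilpotent G V"
proof
  let ?F = "fitting_subgroup G"
  assume "class_injector G nilpotent_group V"
  then have V: "subgroup V G" "\<And>N. subnormal G N \<Longrightarrow> maximal_in G (nilpotent_subgroups G) N (V \<inter> N)"
    unfolding class_injector_def injector_def nilpotent_subgroups_def by auto
  have F: "?F \<lhd> G" by (rule fitting_subgroup_normal[OF fin])
  have "?F \<in> nilpotent_subgroups G"
    using nilpotent_subgroups_iff[OF fin] normal_imp_subgroup[OF F] p_closed_fitting_subgroup[OF fin] by simp
  then have "V \<inter> ?F = ?F"
    using V(2)[OF normal_subnormal[OF F]] group.subgroup_self[OF subgroup_imp_group[OF normal_imp_subgroup[OF F]]]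
    unfolding maximal_in_def by auto
  then have FV: "?F \<subseteq> V" by auto
  have "V \<inter> carrier G = V" using subgroup.subset[OF V(1)] by auto
  then have "maximal_in G (nilpotent_subgroups G) (carrier G) V" using V(2)[OF subnormal.self] by simp
  then show "max_nilpotent G V"
    unfolding max_nilpotent_def maximal_in_def nilpotent_subgroups_iff[OF fin] using FV by auto
next
  assume V: "max_nilpotent G V"
  have "maximal_in G (nilpotent_subgroups G) N (V \<inter> N)" if N: "subnormal G N" for N
  proof -
    have sN: "subgroup N G" using N by (rule subnormal_subgroup)
    have "max_nilpotent (G\<lparr>carrier := N\<rparr>) (V \<inter> N)" using max_nilpotent_subnormal[OF fin con V N] by simp
    then show ?thesis
      unfolding maximal_in_def nilpotent_subgroups_iff[OF fin] max_nilpotent_def subgroup_of_subgroup_iff[OF sN]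
      using p_closed_sub[OF sN] by (auto 0 3)
  qed
  moreover have "subgroup V G" using V by (simp add: max_nilpotent_def)
  ultimately show "class_injector G nilpotent_group V"
    unfolding class_injector_def injector_def nilpotent_subgroups_def by auto
qed

end

section \<open>Groups with a normal \<open>p\<close>-complement\<close>

context group
begin

lemma class_radical_p'_normal:
  assumes fin: "finite (carrier G)"
  shows "class_radical (p'_group p) G \<lhd> G"
  unfolding class_radical_def
  by (rule normal_join_induct(1)[OF fin, of _ "\<lambda>_. True"]) auto

lemma class_radical_p'_torsion:
  fixes p :: nat
  assumes fin: "finite (carrier G)" and p: "prime p" and x: "x \<in> class_radical (p'_group p) G"
  shows "\<exists>n :: nat. \<not> p dvd n \<and> x [^] n = \<one>"
proof -
  have "\<exists>n :: nat. \<not> p dvd n \<and> x [^] n \<in> {\<one>}"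
  proof (rule p'_mod_join[OF fin p one_is_normal _ _ x[unfolded class_radical_def]])
    fix N x assume N: "N \<in> {N. N \<lhd> G \<and> p'_group p (G\<lparr>carrier := N\<rparr>)}" and x: "x \<in> N"
    then have sN: "subgroup N G" using normal_imp_subgroup by blast
    then show "\<exists>n :: nat. \<not> p dvd n \<and> x [^] n \<in> {\<one>}"
      using group.p'_group_iff[OF subgroup_imp_group[OF sN] p] N x finite_subgroup[OF fin sN]
      by (simp add: nat_pow_consistent[symmetric])
  qed auto
  then show ?thesis by simp
qed

lemma class_radical_p'_contains:
  fixes p :: nat
  assumes fin: "finite (carrier G)" and p: "prime p" and M: "M \<lhd> G"
    and tor: "\<And>x. x \<in> M \<Longrightarrow> \<exists>n :: nat. \<not> p dvd n \<and> x [^] n = \<one>"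
  shows "M \<subseteq> class_radical (p'_group p) G"
proof -
  have sM: "subgroup M G" using M by (rule normal_imp_subgroup)
  have "p'_group p (G\<lparr>carrier := M\<rparr>)"
    using group.p'_group_iff[OF subgroup_imp_group[OF sM] p] tor finite_subgroup[OF fin sM]
    by (simp add: nat_pow_consistent[symmetric])
  then show ?thesis unfolding class_radical_def subgroup_prod_def using M by (auto intro: generate.incl)
qed

text \<open>If the radical contains all elements of prime power order for the primes other than \<open>p\<close>, then
  only \<open>p\<close>-elements survive in the quotient.\<close>

lemma p_nilpotentI:
  assumes fin: "finite (carrier G)" and p: "prime p"
    and q: "\<And>q x. prime q \<Longrightarrow> q \<noteq> p \<Longrightarrow> p_element G q x \<Longrightarrow> x \<in> class_radical (p'_group p) G"
  shows "class_prod (p'_group p) (p_group p) G"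
proof -
  let ?O = "class_radical (p'_group p) G"
  have O: "?O \<lhd> G" by (rule class_radical_p'_normal[OF fin])
  interpret Q: group "G Mod ?O" using O by (rule normal.factorgroup_is_group)
  have finQ: "finite (carrier (G Mod ?O))" using fin by (simp add: carrier_FactGroup)
  have "p_element (G Mod ?O) p (?O #> x)" if x: "x \<in> carrier G" for x
  proof -
    obtain a m :: nat where m: "\<not> p dvd m" "x [^] (p ^ a * m) = \<one>" using pow_finite[OF fin x p] .
    have "x [^] (p ^ a) \<in> ?O"
    proof (rule primary_generation[OF normal_imp_subgroup[OF O]])
      show "x [^] (p ^ a) \<in> carrier G" using x by simp
      show "m > 0" using m(1) by (auto intro: Nat.gr0I)
      show "(x [^] (p ^ a)) [^] m = \<one>" using m(2) x by (simp add: nat_pow_pow)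
      show "(x [^] (p ^ a)) [^] j \<in> ?O"
        if "prime r" "r dvd m" "((x [^] (p ^ a)) [^] j) [^] (r ^ k) = \<one>" for r k and j :: nat
        using that m(1) x by (intro q[of r]) (auto simp: p_element_def)
    qed
    then show ?thesis using p_element_FactGroup[OF O x] by blast
  qed
  then have "p_group p (G Mod ?O)"
    unfolding Q.p_group_iff[OF p finQ] by (auto simp: carrier_FactGroup)
  then show ?thesis unfolding class_prod_def using fin is_group by simp
qed

text \<open>The elements of order a power of \<open>q\<close> lie in the normal \<open>p\<close>-complement.\<close>

lemma p_nilpotent_mult:
  fixes p q :: nat
  assumes nil: "class_prod (p'_group p) (p_group p) G" and pq: "prime p" "prime q" "p \<noteq> q"
    and x: "p_element G q x" and y: "p_element G q y"
  shows "\<exists>n :: nat. \<not> p dvd n \<and> (x \<otimes> y) [^] n = \<one>"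
proof -
  let ?O = "class_radical (p'_group p) G"
  have fin: "finite (carrier G)" and pg: "p_group p (G Mod ?O)" using nil by (auto simp: class_prod_def)
  have O: "?O \<lhd> G" by (rule class_radical_p'_normal[OF fin])
  interpret Q: group "G Mod ?O" using O by (rule normal.factorgroup_is_group)
  have finQ: "finite (carrier (G Mod ?O))" using fin by (simp add: carrier_FactGroup)
  have "z \<in> ?O" if z: "p_element G q z" for z
  proof -
    have zc: "z \<in> carrier G" using z by (simp add: p_element_def)
    obtain k where k: "z [^] (q ^ k) = \<one>" using z by (auto simp: p_element_def)
    have "p_element (G Mod ?O) p (?O #> z)" using pg Q.p_group_iff[OF pq(1) finQ] coset_in_carrier[OF O zc] by blast
    then obtain l where l: "z [^] (p ^ l) \<in> ?O" using p_element_FactGroup[OF O zc] by auto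
    have "z [^] (q ^ k) \<in> ?O" unfolding k using subgroup.one_closed[OF normal_imp_subgroup[OF O]] .
    then show ?thesis
      using pow_coprime_mem[OF normal_imp_subgroup[OF O] zc l] coprime_distinct_primes_power[OF pq] by blast
  qed
  then have "x \<otimes> y \<in> ?O" using x y subgroup.m_closed[OF normal_imp_subgroup[OF O]] by blast
  then show ?thesis by (rule class_radical_p'_torsion[OF fin pq(1)])
qed

end

section \<open>Hartley sets and the quotient by the \<open>h\<close>-radical\<close>

definition fitting_preimage :: "('a, 'b) monoid_scheme \<Rightarrow> (nat \<Rightarrow> 'a set set) \<Rightarrow> 'a set" where
  "fitting_preimage G h =
     {x \<in> carrier G. h_radical G h #>\<^bsub>G\<^esub> x \<in> fitting_subgroup (G Mod h_radical G h)}"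

context group
begin

lemma prime_power_torsion_normal:
  fixes q :: nat
  assumes R: "R \<lhd> G" and V: "subgroup V G" and q: "prime q" and nil: "p_closed (G Mod R) ((#>) R ` V)"
  shows "{v \<in> V. \<exists>j. v [^] (q ^ j) \<in> R} \<lhd> G\<lparr>carrier := V\<rparr>" (is "?M \<lhd> _")
proof -
  note sR = normal_imp_subgroup[OF R]
  note carV = subgroup.mem_carrier[OF V]
  have mult: "\<exists>k. (x \<otimes> y) [^] (q ^ k) \<in> R"
    if "x \<in> V" "y \<in> V" "\<exists>k. x [^] (q ^ k) \<in> R" "\<exists>k. y [^] (q ^ k) \<in> R" for x y
    using nil q that unfolding p_closed_coset_image[OF R subgroup.subset[OF V]] by metis
  show ?thesis unfolding normal_in_iff[OF V]
  proof (intro conjI ballI)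
    show "subgroup ?M G"
    proof (rule subgroupI)
      show "?M \<subseteq> carrier G" using carV by auto
      show "?M \<noteq> {}" using subgroup.one_closed[OF V] subgroup.one_closed[OF sR] by auto
      show "inv x \<in> ?M" if "x \<in> ?M" for x
        using that carV subgroup.m_inv_closed[OF V] subgroup.m_inv_closed[OF sR]
        by (auto simp: nat_pow_inv)
      show "x \<otimes> y \<in> ?M" if "x \<in> ?M" "y \<in> ?M" for x y
        using that mult[of x y] subgroup.m_closed[OF V] by simp
    qed
    show "x \<otimes> n \<otimes> inv x \<in> ?M" if x: "x \<in> V" and n: "n \<in> ?M" for x n
    proof -
      obtain j where j: "n \<in> V" "n [^] (q ^ j) \<in> R" using n by auto
      then have "(x \<otimes> n \<otimes> inv x) [^] (q ^ j) \<in> R"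
        using conj_pow[of x n "q ^ j"] x carV normal_invE(2)[OF R] by simp
      moreover have "x \<otimes> n \<otimes> inv x \<in> V"
        using x j(1) subgroup.m_closed[OF V] subgroup.m_inv_closed[OF V] by blast
      ultimately show ?thesis by auto
    qed
  qed auto
qed

context
  fixes h :: "nat \<Rightarrow> 'a set set"
  assumes fin: "finite (carrier G)" and h: "H_function G h" and full: "full G h"
begin

abbreviation G\<^sub>h where "G\<^sub>h \<equiv> h_radical G h"

lemma fitting_set_h: "prime p \<Longrightarrow> fitting_set G (h p)"
  using h by (simp add: H_function_def)

lemma h_component_normal:
  assumes "prime p"
  shows "radical G (h p) (carrier G) \<lhd> G"
  using radical_normal[OF fitting_set_h[OF assms] fin subgroup_self] by simp

lemma h_radical_normal: "G\<^sub>h \<lhd> G"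
  unfolding h_radical_def using h_component_normal
  by (intro normal_join_induct(1)[OF fin, of _ "\<lambda>_. True"]) auto

lemma h_component_subset: "prime p \<Longrightarrow> radical G (h p) (carrier G) \<subseteq> G\<^sub>h"
  unfolding h_radical_def subgroup_prod_def by (auto intro: generate.incl)

text \<open>For \<open>q \<noteq> p\<close> fullness makes the \<open>h(q)\<close>-radical of \<open>G\<close> a \<open>p'\<close>-group modulo its own
  \<open>h(p)\<close>-radical, which is contained in that of \<open>G\<close>.\<close>

lemma h_radical_p'_mod:
  assumes p: "prime p" and x: "x \<in> G\<^sub>h"
  shows "\<exists>n :: nat. \<not> p dvd n \<and> x [^] n \<in> radical G (h p) (carrier G)"
proof (rule p'_mod_join[OF fin p h_component_normal[OF p] _ _ x[unfolded h_radical_def]])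
  fix N assume N: "N \<in> {radical G (h p) (carrier G) |p. prime p}"
  then show "N \<lhd> G" using h_component_normal by auto
  obtain q where q: "prime q" "N = radical G (h q) (carrier G)" using N by auto
  fix x assume x: "x \<in> N"
  note NG = h_component_normal[OF q(1), folded q(2)]
  have sN: "subgroup N G" using NG by (rule normal_imp_subgroup)
  show "\<exists>n :: nat. \<not> p dvd n \<and> x [^] n \<in> radical G (h p) (carrier G)"
  proof (cases "q = p")
    case True
    have "\<not> p dvd 1" using p not_prime_unit by blast
    moreover have "x [^] (1 :: nat) \<in> radical G (h p) (carrier G)"
      using x q(2) True subgroup.mem_carrier[OF sN] by simp
    ultimately show ?thesis by blast
  next
    case False
    let ?S = "radical G (h p) N"
    let ?X = "G\<lparr>carrier := N\<rparr> Mod ?S"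
    have "N \<in> h q" unfolding q(2) using radical_in[OF fitting_set_h[OF q(1)] fin subgroup_self] .
    then have "p'_group p ?X"
      using full p q(1) False unfolding full_def fitting_comp_def by blast
    moreover have S: "?S \<lhd> G\<lparr>carrier := N\<rparr>" using radical_normal[OF fitting_set_h[OF p] fin sN] .
    moreover have "finite (carrier ?X)"
      using finite_subgroup[OF fin sN] by (simp add: carrier_FactGroup)
    moreover have "?S #> x \<in> carrier ?X" using x by (simp add: carrier_FactGroup)
    ultimately obtain n :: nat where n: "\<not> p dvd n"
      "(?S #> x) [^]\<^bsub>?X\<^esub> n = \<one>\<^bsub>?X\<^esub>"
      using group.p'_group_iff[OF normal.factorgroup_is_group[OF S] p] by blast
    then have "x [^] n \<in> ?S" using FactGroup_sub_pow[OF sN S x] by simp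
    then show ?thesis
      using n(1) radical_of_subnormal[OF fitting_set_h[OF p] fin normal_subnormal[OF NG]] by blast
  qed
qed

text \<open>By \<open>p_nilpotentI\<close> it has to be shown that for \<open>q \<noteq> p\<close> every \<open>q\<close>-element of \<open>V\<close> lies, modulo the
  \<open>h(p)\<close>-radical of \<open>V\<close>, in a normal \<open>p'\<close>-subgroup. The preimage \<open>M\<close> of the Sylow \<open>q\<close>-subgroup of
  \<open>V/G\<^sub>h\<close> does this: it is a \<open>q\<close>-group modulo \<open>G\<^sub>h\<close>, which is itself a \<open>p'\<close>-group modulo the
  \<open>h(p)\<close>-radical.\<close>

lemma HS_of_nilpotent_quotient:
  assumes V: "subgroup V G" "G\<^sub>h \<subseteq> V" and nil: "p_closed (G Mod G\<^sub>h) ((#>) G\<^sub>h ` V)"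
  shows "V \<in> HS G h"
proof -
  let ?H = "G\<lparr>carrier := V\<rparr>"
  note carV = subgroup.mem_carrier[OF V(1)]
  interpret V: group "?H" using V(1) by (rule subgroup_imp_group)
  have finV: "finite (carrier ?H)" using finite_subgroup[OF fin V(1)] by simp
  have "class_prod (p'_group p) (p_group p) (?H Mod radical G (h p) V)" if p: "prime p" for p
  proof -
    let ?S = "radical G (h p) V" and ?D = "radical G (h p) (carrier G)"
    let ?X = "?H Mod ?S"
    have S: "?S \<lhd> ?H" using radical_normal[OF fitting_set_h[OF p] fin V(1)] .
    have "?D \<lhd> ?H"
      using h_component_subset[OF p] V by (intro normal_restrict_supergroup h_component_normal p) auto
    then have DS: "?D \<subseteq> ?S"
      using radical_contains[OF fitting_set_h[OF p] fin radical_in[OF fitting_set_h[OF p] fin subgroup_self]] by blast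
    interpret X: group ?X using S by (rule normal.factorgroup_is_group)
    have finX: "finite (carrier ?X)" using finV by (simp add: carrier_FactGroup)
    show ?thesis
    proof (rule X.p_nilpotentI[OF finX p])
      fix q \<xi> assume q: "prime q" "q \<noteq> p" and \<xi>: "p_element ?X q \<xi>"
      obtain v where v: "v \<in> V" "\<xi> = ?S #> v" "p_element G q v"
      proof -
        obtain v0 where v0: "v0 \<in> V" "\<xi> = ?S #> v0" using \<xi> by (auto simp: p_element_def carrier_FactGroup)
        obtain k where k: "v0 [^] (q ^ k) \<in> ?S"
          using \<xi> FactGroup_sub_pow[OF V(1) S v0(1)] unfolding p_element_def v0(2) by auto
        have v0c: "v0 \<in> carrier ?H" using v0 by simp
        have "v0 [^]\<^bsub>?H\<^esub> (q ^ k) \<in> ?S" using k by (simp add: nat_pow_consistent[symmetric])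
        then obtain u :: nat where u: "p_element ?H q (v0 [^]\<^bsub>?H\<^esub> u)"
          "?S #>\<^bsub>?H\<^esub> v0 = ?S #>\<^bsub>?H\<^esub> (v0 [^]\<^bsub>?H\<^esub> u)"
          using V.p_element_lift[OF finV S q(1) v0c] by metis
        then show ?thesis
          using that[of "v0 [^] u"] v0(2) p_element_subgroup[OF V(1)]
          by (simp add: nat_pow_consistent[symmetric])
      qed
      define M where "M = {v \<in> V. \<exists>j. v [^] (q ^ j) \<in> G\<^sub>h}"
      have MV: "M \<lhd> ?H"
        unfolding M_def by (rule prime_power_torsion_normal[OF h_radical_normal V(1) q(1) nil])
      have "(#>) ?S ` V = carrier ?X" by (simp add: carrier_FactGroup)
      then have "?X\<lparr>carrier := (#>) ?S ` V\<rparr> = ?X" by simp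
      then have "(#>) ?S ` M \<lhd> ?X" using V.normal_coset_image[OF S V.subgroup_self, of M] MV by simp
      then have "(#>) ?S ` M \<subseteq> class_radical (p'_group p) ?X"
      proof (rule X.class_radical_p'_contains[OF finX p])
        fix \<eta> assume "\<eta> \<in> (#>) ?S ` M"
        then obtain m where m: "m \<in> M" "\<eta> = ?S #> m" by auto
        then obtain j where j: "m \<in> V" "m [^] (q ^ j) \<in> G\<^sub>h" by (auto simp: M_def)
        obtain n :: nat where n: "\<not> p dvd n" "(m [^] (q ^ j)) [^] n \<in> ?D" using h_radical_p'_mod[OF p j(2)] by blast
        have "m [^] (q ^ j * n) \<in> ?S" using n(2) DS j(1) carV by (auto simp: nat_pow_pow)
        then have "\<eta> [^]\<^bsub>?X\<^esub> (q ^ j * n) = \<one>\<^bsub>?X\<^esub>" unfolding m(2) using FactGroup_sub_pow[OF V(1) S j(1)] by blast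
        moreover have "\<not> p dvd q ^ j * n"
          using n(1) p q by (metis prime_dvd_mult_iff prime_dvd_power primes_dvd_imp_eq)
        ultimately show "\<exists>n :: nat. \<not> p dvd n \<and> \<eta> [^]\<^bsub>?X\<^esub> n = \<one>\<^bsub>?X\<^esub>" by blast
      qed
      moreover have "v \<in> M"
      proof -
        obtain k where "v [^] (q ^ k) = \<one>" using v(3) by (auto simp: p_element_def)
        then have "v [^] (q ^ k) \<in> G\<^sub>h" using subgroup.one_closed[OF normal_imp_subgroup[OF h_radical_normal]] by simp
        then show ?thesis using v(1) by (auto simp: M_def)
      qed
      ultimately show "\<xi> \<in> class_radical (p'_group p) ?X" using v(2) by blast
    qed
  qed
  then show ?thesis unfolding HS_def fitting_comp_def using V(1) by auto
qed

lemma HS_p_nilpotent: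
  assumes W: "W \<in> HS G h" and pq: "prime p" "prime q" "p \<noteq> q"
    and x: "x \<in> W" "p_element G q x" and y: "y \<in> W" "p_element G q y"
  shows "\<exists>n :: nat. \<not> p dvd n \<and> (x \<otimes> y) [^] n \<in> radical G (h p) W"
proof -
  let ?S = "radical G (h p) W"
  let ?X = "G\<lparr>carrier := W\<rparr> Mod ?S"
  have sW: "subgroup W G" and nil: "class_prod (p'_group p) (p_group p) ?X"
    using W pq(1) unfolding HS_def fitting_comp_def by auto
  have S: "?S \<lhd> G\<lparr>carrier := W\<rparr>" using radical_normal[OF fitting_set_h[OF pq(1)] fin sW] .
  interpret X: group ?X using S by (rule normal.factorgroup_is_group)
  have pel: "p_element ?X q (?S #> z)" if z: "z \<in> W" "p_element G q z" for z
  proof -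
    obtain k where "z [^] (q ^ k) = \<one>" using z(2) by (auto simp: p_element_def)
    then have "z [^] (q ^ k) \<in> ?S"
      using subgroup.one_closed[OF subgroup_radical[OF fitting_set_h[OF pq(1)] fin sW]] by simp
    then have "(?S #> z) [^]\<^bsub>?X\<^esub> (q ^ k) = \<one>\<^bsub>?X\<^esub>" using FactGroup_sub_pow[OF sW S z(1)] by simp
    moreover have "?S #> z \<in> carrier ?X" using z(1) by (simp add: carrier_FactGroup)
    ultimately show ?thesis unfolding p_element_def by blast
  qed
  obtain n :: nat where n: "\<not> p dvd n" "((?S #> x) \<otimes>\<^bsub>?X\<^esub> (?S #> y)) [^]\<^bsub>?X\<^esub> n = \<one>\<^bsub>?X\<^esub>"
    using X.p_nilpotent_mult[OF nil pq pel[OF x] pel[OF y]] by blast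
  have "(?S #> x) \<otimes>\<^bsub>?X\<^esub> (?S #> y) = ?S #> (x \<otimes> y)"
    using group.coset_mult[OF subgroup_imp_group[OF sW] S, of x y] x y by simp
  then have "(x \<otimes> y) [^] n \<in> ?S"
    using n(2) FactGroup_sub_pow[OF sW S subgroup.m_closed[OF sW x(1) y(1)], of n] by simp
  then show ?thesis using n(1) by blast
qed

context
  assumes con: "nilpotent_constrained (G Mod h_radical G h)"
begin

lemma finite_quotient: "finite (carrier (G Mod G\<^sub>h))"
  using fin by (simp add: carrier_FactGroup)

lemma fitting_preimage_normal: "fitting_preimage G h \<lhd> G"
  and h_radical_subset_fitting_preimage: "G\<^sub>h \<subseteq> fitting_preimage G h"
  and fitting_preimage_image: "(#>) G\<^sub>h ` fitting_preimage G h = fitting_subgroup (G Mod G\<^sub>h)"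
proof -
  interpret Q: group "G Mod G\<^sub>h" using h_radical_normal by (rule normal.factorgroup_is_group)
  have F: "fitting_subgroup (G Mod G\<^sub>h) \<lhd> G Mod G\<^sub>h" by (rule Q.fitting_subgroup_normal[OF finite_quotient])
  note pre = subgroup_coset_preimage[OF h_radical_normal normal_imp_subgroup[OF F]]
  show "G\<^sub>h \<subseteq> fitting_preimage G h" "(#>) G\<^sub>h ` fitting_preimage G h = fitting_subgroup (G Mod G\<^sub>h)"
    using pre(2,3) by (simp_all add: fitting_preimage_def)
  show "fitting_preimage G h \<lhd> G"
    unfolding fitting_preimage_def by (rule normal_coset_preimage[OF h_radical_normal F])
qed

text \<open>The place where the constraint enters. Let \<open>S\<close> be the \<open>h(p)\<close>-radical of \<open>W\<close>, \<open>F\<close> the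
  intersection of \<open>N\<close> with the preimage of the Fitting subgroup, and \<open>T = S \<inter> F\<close>. As a subnormal subgroup of \<open>G\<close> in
  \<open>h(p)\<close>, \<open>T\<close> lies in \<open>G\<^sub>h\<close>. Since \<open>[S, F] \<le> T\<close>, the image of \<open>S\<close> centralizes the Fitting subgroup of the
  image of \<open>N\<close> and hence lies in it. So \<open>S \<le> F\<close>, that is, \<open>S = T\<close>.\<close>

lemma HS_radical_subset:
  assumes N: "subnormal G N" and W: "W \<in> HS G h" "W \<subseteq> N" "fitting_preimage G h \<inter> N \<subseteq> W" and p: "prime p"
  shows "radical G (h p) W \<subseteq> G\<^sub>h"
proof -
  let ?S = "radical G (h p) W" and ?F = "fitting_preimage G h \<inter> N"
  interpret Q: group "G Mod G\<^sub>h" using h_radical_normal by (rule normal.factorgroup_is_group)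
  note fs = fitting_set_h[OF p]
  have sN: "subgroup N G" using N by (rule subnormal_subgroup)
  have sW: "subgroup W G" using W(1) p unfolding HS_def fitting_comp_def by auto
  have S: "subgroup ?S G" "?S \<subseteq> W" "\<And>x s. x \<in> W \<Longrightarrow> s \<in> ?S \<Longrightarrow> x \<otimes> s \<otimes> inv x \<in> ?S"
    using radical_normal[OF fs fin sW] normal_in_iff[OF sW] by auto
  have FN: "?F \<lhd> G\<lparr>carrier := N\<rparr>" using normal_Int_subgroup[OF sN fitting_preimage_normal] .
  have F: "subgroup ?F G" "\<And>x f. x \<in> N \<Longrightarrow> f \<in> ?F \<Longrightarrow> x \<otimes> f \<otimes> inv x \<in> ?F"
    using FN normal_in_iff[OF sN] by auto
  note car = subgroup.mem_carrier[OF sN] subgroup.mem_carrier[OF sW]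
  let ?T = "?S \<inter> ?F"
  have sT: "subgroup ?T G" using subgroups_Inter_pair[OF S(1) F(1)] .
  have "?T \<lhd> G\<lparr>carrier := ?S\<rparr>" unfolding normal_in_iff[OF S(1)] using sT S F(2) W(2) by blast
  then have Th: "?T \<in> h p" using fitting_set_normal[OF fs fin radical_in[OF fs fin sW]] by blast
  have "?T \<lhd> G\<lparr>carrier := ?F\<rparr>" unfolding normal_in_iff[OF F(1)] using sT S(3) F(2) W(2,3) by blast
  then have "subnormal G ?T" using subnormal.step[OF subnormal.step[OF N FN]] by blast
  then have "?T \<subseteq> radical G (h p) (carrier G)" using subnormal_in_radical[OF fs fin _ Th] by blast
  then have TR: "?T \<subseteq> G\<^sub>h" using h_component_subset[OF p] by blast
  have "?S \<subseteq> ?F"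
  proof
    fix w assume w: "w \<in> ?S"
    then have wW: "w \<in> W" "w \<in> N" "w \<in> carrier G" using S(2) W(2) car by auto
    let ?N = "(#>) G\<^sub>h ` N"
    let ?Q = "(G Mod G\<^sub>h)\<lparr>carrier := ?N\<rparr>"
    have subN: "subnormal (G Mod G\<^sub>h) ?N" by (rule subnormal_coset_image[OF h_radical_normal N])
    have fit: "fitting_subgroup ?Q = fitting_subgroup (G Mod G\<^sub>h) \<inter> ?N"
      by (rule Q.fitting_subgroup_subnormal[OF finite_quotient subN])
    have "(G\<^sub>h #> w) \<otimes>\<^bsub>G Mod G\<^sub>h\<^esub> y = y \<otimes>\<^bsub>G Mod G\<^sub>h\<^esub> (G\<^sub>h #> w)" if y: "y \<in> fitting_subgroup (G Mod G\<^sub>h) \<inter> ?N" for y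
    proof -
      obtain f where f: "f \<in> N" "y = G\<^sub>h #> f" using y by auto
      then have fF: "f \<in> ?F" using y car by (auto simp: fitting_preimage_def)
      then have fW: "f \<in> W" using W(3) by blast
      have "w \<otimes> f \<otimes> inv w \<otimes> inv f = w \<otimes> (f \<otimes> inv w \<otimes> inv f)" using wW f car by (simp add: m_assoc)
      then have "w \<otimes> f \<otimes> inv w \<otimes> inv f \<in> ?S"
        using S(3)[OF fW subgroup.m_inv_closed[OF S(1) w]] w subgroup.m_closed[OF S(1)] by simp
      moreover have "w \<otimes> f \<otimes> inv w \<otimes> inv f \<in> ?F"
        using F(2)[OF wW(2) fF] fF subgroup.m_closed[OF F(1)] subgroup.m_inv_closed[OF F(1)] by blast
      ultimately have "w \<otimes> f \<otimes> inv w \<otimes> inv f \<in> G\<^sub>h" using TR by blast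
      then show ?thesis unfolding f(2) using coset_commute_iff[OF h_radical_normal, of w f] wW f car by blast
    qed
    then have "G\<^sub>h #> w \<in> centralizer ?Q (fitting_subgroup ?Q)"
      unfolding fit using wW(2) by (simp add: centralizer_def del: mult_FactGroup)
    then have "G\<^sub>h #> w \<in> fitting_subgroup ?Q"
      using Q.constrained_subnormal[OF finite_quotient con subN] unfolding nilpotent_constrained_def by blast
    then show "w \<in> ?F" unfolding fit using wW by (auto simp: fitting_preimage_def)
  qed
  then show ?thesis using TR by blast
qed

text \<open>If \<open>x\<close> and \<open>y\<close> are \<open>p\<close>-elements then for every prime \<open>q \<noteq> p\<close> the \<open>q\<close>-nilpotency of \<open>W\<close> modulo its
  \<open>h(q)\<close>-radical bounds the order of \<open>x \<otimes> y\<close> by a number prime to \<open>q\<close>; modulo \<open>G\<^sub>h\<close> all these bounds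
  hold together.\<close>

lemma HS_nilpotent_quotient:
  assumes N: "subnormal G N" and W: "W \<in> HS G h" "W \<subseteq> N" "fitting_preimage G h \<inter> N \<subseteq> W"
  shows "p_closed (G Mod G\<^sub>h) ((#>) G\<^sub>h ` W)"
proof -
  interpret Q: group "G Mod G\<^sub>h" using h_radical_normal by (rule normal.factorgroup_is_group)
  have "subgroup W G" using W(1) two_is_prime_nat unfolding HS_def fitting_comp_def by blast
  then have sW: "subgroup W G" .
  note car = subgroup.mem_carrier[OF sW]
  have "\<exists>k. (x \<otimes> y) [^] (p ^ k) \<in> G\<^sub>h"
    if p: "prime p" and x: "x \<in> W" "\<exists>k. x [^] (p ^ k) \<in> G\<^sub>h" and y: "y \<in> W" "\<exists>k. y [^] (p ^ k) \<in> G\<^sub>h"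
    for p :: nat and x y
  proof -
    have lift: "\<exists>z'\<in>W. p_element G p z' \<and> G\<^sub>h #> z = G\<^sub>h #> z'" if z: "z \<in> W" "\<exists>k. z [^] (p ^ k) \<in> G\<^sub>h" for z
      using p_element_lift[OF fin h_radical_normal p car[OF z(1)]] z(2) pow_mem[OF sW z(1)] by metis
    obtain x' where x': "x' \<in> W" "p_element G p x'" "G\<^sub>h #> x = G\<^sub>h #> x'" using lift[OF x] by blast
    obtain y' where y': "y' \<in> W" "p_element G p y'" "G\<^sub>h #> y = G\<^sub>h #> y'" using lift[OF y] by blast
    have xyc: "x' \<otimes> y' \<in> carrier G" using x' y' car by blast
    have "p_element (G Mod G\<^sub>h) p (G\<^sub>h #> (x' \<otimes> y'))"
    proof (rule Q.p_elementI[OF finite_quotient p coset_in_carrier[OF h_radical_normal xyc]])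
      fix q :: nat assume q: "prime q" "q \<noteq> p"
      obtain n :: nat where n: "\<not> q dvd n" "(x' \<otimes> y') [^] n \<in> radical G (h q) W"
        using HS_p_nilpotent[OF W(1) q(1) p q(2) x'(1,2) y'(1,2)] by blast
      then have "(x' \<otimes> y') [^] n \<in> G\<^sub>h" using HS_radical_subset[OF N W q(1)] by blast
      then show "\<exists>n :: nat. \<not> q dvd n \<and> (G\<^sub>h #> (x' \<otimes> y')) [^]\<^bsub>G Mod G\<^sub>h\<^esub> n = \<one>\<^bsub>G Mod G\<^sub>h\<^esub>"
        using n(1) FactGroup_pow_eq_one[OF h_radical_normal xyc] by blast
    qed
    moreover have "G\<^sub>h #> (x' \<otimes> y') = G\<^sub>h #> (x \<otimes> y)"
      using coset_mult[OF h_radical_normal] x'(1,3) y'(1,3) x(1) y(1) car by metis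
    ultimately show ?thesis using p_element_FactGroup[OF h_radical_normal, of "x \<otimes> y" p] x(1) y(1) car by simp
  qed
  then show ?thesis
    unfolding p_closed_coset_image[OF h_radical_normal subgroup.subset[OF sW]] by blast
qed

lemma fitting_preimage_in_HS: "fitting_preimage G h \<in> HS G h"
proof -
  interpret Q: group "G Mod G\<^sub>h" using h_radical_normal by (rule normal.factorgroup_is_group)
  show ?thesis
    using HS_of_nilpotent_quotient[OF normal_imp_subgroup[OF fitting_preimage_normal] h_radical_subset_fitting_preimage]
      Q.p_closed_fitting_subgroup[OF finite_quotient] fitting_preimage_image by simp
qed

context
  assumes fH: "fitting_set G (HS G h)"
begin

lemma fitting_preimage_subset_radical: "fitting_preimage G h \<subseteq> radical G (HS G h) (carrier G)"
  using radical_contains[OF fH fin fitting_preimage_in_HS, of "carrier G"] fitting_preimage_normal by simp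

lemma maximal_HS_quotient:
  assumes V: "maximal_in G (HS G h) (carrier G) V" "fitting_preimage G h \<subseteq> V"
  shows "max_nilpotent (G Mod G\<^sub>h) ((#>) G\<^sub>h ` V)"
proof -
  have V': "subgroup V G" "V \<in> HS G h"
    "\<And>W. V \<subseteq> W \<Longrightarrow> subgroup W G \<Longrightarrow> W \<in> HS G h \<Longrightarrow> V = W"
    using V(1) by (auto simp: maximal_in_def)
  have RV: "G\<^sub>h \<subseteq> V" using h_radical_subset_fitting_preimage V(2) by blast
  show ?thesis unfolding max_nilpotent_def
  proof (intro conjI allI impI)
    show "subgroup ((#>) G\<^sub>h ` V) (G Mod G\<^sub>h)" by (rule subgroup_coset_image[OF h_radical_normal V'(1)])
    show "p_closed (G Mod G\<^sub>h) ((#>) G\<^sub>h ` V)"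
      using HS_nilpotent_quotient[OF subnormal.self V'(2)] V(2) subgroup.subset[OF V'(1)] by blast
    show "fitting_subgroup (G Mod G\<^sub>h) \<subseteq> (#>) G\<^sub>h ` V" using fitting_preimage_image V(2) by blast
    fix U assume U: "subgroup U (G Mod G\<^sub>h)" "p_closed (G Mod G\<^sub>h) U" "(#>) G\<^sub>h ` V \<subseteq> U"
    let ?W = "{x \<in> carrier G. G\<^sub>h #> x \<in> U}"
    note pre = subgroup_coset_preimage[OF h_radical_normal U(1)]
    have "?W \<in> HS G h" using HS_of_nilpotent_quotient[OF pre(1,2)] pre(3) U(2) by simp
    moreover have "V \<subseteq> ?W" using U(3) subgroup.subset[OF V'(1)] by blast
    ultimately have "V = ?W" using V'(3) pre(1) by blast
    then show "U = (#>) G\<^sub>h ` V" using pre(3) by simp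
  qed
qed

text \<open>A member \<open>W\<close> of the Hartley set between \<open>V \<inter> N\<close> and \<open>N\<close> has a nilpotent image, which cannot be
  larger than that of \<open>V \<inter> N\<close>. As \<open>G\<^sub>h \<le> V\<close>, this puts \<open>W\<close> into \<open>V\<close>.\<close>

lemma max_nilpotent_quotient_injector:
  assumes V: "subgroup V G" "G\<^sub>h \<subseteq> V" and max: "max_nilpotent (G Mod G\<^sub>h) ((#>) G\<^sub>h ` V)"
  shows "injector G (HS G h) V"
  unfolding injector_def
proof (intro conjI allI impI)
  interpret Q: group "G Mod G\<^sub>h" using h_radical_normal by (rule normal.factorgroup_is_group)
  have "p_closed (G Mod G\<^sub>h) ((#>) G\<^sub>h ` V)" using max by (simp add: max_nilpotent_def)
  then have VH: "V \<in> HS G h" by (rule HS_of_nilpotent_quotient[OF V])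
  have FV: "fitting_preimage G h \<subseteq> V"
    using max coset_image_subset_iff[OF h_radical_normal V subgroup.subset[OF normal_imp_subgroup[OF fitting_preimage_normal]]]
    unfolding max_nilpotent_def fitting_preimage_image by blast
  show "subgroup V G" by (rule V(1))
  fix N assume N: "subnormal G N"
  have sN: "subgroup N G" using N by (rule subnormal_subgroup)
  have "V \<inter> N = W" if W: "V \<inter> N \<subseteq> W" "subgroup W G" "W \<subseteq> N" "W \<in> HS G h" for W
  proof -
    have "p_closed (G Mod G\<^sub>h) ((#>) G\<^sub>h ` W)" using HS_nilpotent_quotient[OF N W(4,3)] W(1) FV by blast
    moreover have "max_nilpotent ((G Mod G\<^sub>h)\<lparr>carrier := (#>) G\<^sub>h ` N\<rparr>) ((#>) G\<^sub>h ` V \<inter> (#>) G\<^sub>h ` N)"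
      using Q.max_nilpotent_subnormal[OF finite_quotient con max subnormal_coset_image[OF h_radical_normal N]] by blast
    moreover have "subgroup ((#>) G\<^sub>h ` W) ((G Mod G\<^sub>h)\<lparr>carrier := (#>) G\<^sub>h ` N\<rparr>)"
      using Q.subgroup_of_subgroup_iff[OF subgroup_coset_image[OF h_radical_normal sN]]
        subgroup_coset_image[OF h_radical_normal W(2)] W(3) by blast
    moreover have "(#>) G\<^sub>h ` V \<inter> (#>) G\<^sub>h ` N = (#>) G\<^sub>h ` (V \<inter> N)"
      by (rule coset_image_Int[OF h_radical_normal V subgroup.subset[OF sN]])
    ultimately have "(#>) G\<^sub>h ` W = (#>) G\<^sub>h ` (V \<inter> N)"
      using W(1,3) Q.p_closed_sub[OF subgroup_coset_image[OF h_radical_normal sN]]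
      unfolding max_nilpotent_def by (metis image_mono)
    then have "W \<subseteq> V"
      using coset_image_subset_iff[OF h_radical_normal V subgroup.subset[OF W(2)]] by blast
    then show ?thesis using W(1,3) by blast
  qed
  then show "maximal_in G (HS G h) N (V \<inter> N)"
    unfolding maximal_in_def subgroup_of_subgroup_iff[OF sN]
    using subnormal_Int_in_fitting_set[OF fH fin VH N] subgroups_Inter_pair[OF V(1) sN] by auto
qed

end

end

end

lemma injector_maximal:
  assumes "injector G \<F> V"
  shows "maximal_in G \<F> (carrier G) V"
proof -
  have "V \<inter> carrier G = V" using assms subgroup.subset unfolding injector_def by blast
  then show ?thesis using assms subnormal.self unfolding injector_def by metis
qed

lemma injector_contains_radical:
  assumes F: "fitting_set G \<F>" and fin: "finite (carrier G)" and V: "injector G \<F> V"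
  shows "radical G \<F> (carrier G) \<subseteq> V"
proof -
  let ?R = "radical G \<F> (carrier G)"
  have R: "?R \<lhd> G" "?R \<in> \<F>" using radical_normal[OF F fin subgroup_self] radical_in[OF F fin subgroup_self] by auto
  then have "maximal_in G \<F> ?R (V \<inter> ?R)" using V normal_subnormal unfolding injector_def by blast
  moreover have "subgroup ?R (G\<lparr>carrier := ?R\<rparr>)"
    using group.subgroup_self[OF subgroup_imp_group[OF normal_imp_subgroup[OF R(1)]]] by simp
  ultimately have "V \<inter> ?R = ?R" using R(2) unfolding maximal_in_def by blast
  then show ?thesis by blast
qed

end

section \<open>Injectors for a Hartley set\<close>

theorem theorem1p5:
  fixes G :: "('a, 'b) monoid_scheme" (structure)
    and \<H> :: "'a set set"
    and h :: "nat \<Rightarrow> 'a set set"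
  assumes "group G" and "finite (carrier G)"
    and "hartley_set_defined_by G \<H> h"
    and "integrated \<H> h" and "full G h"
    and "nilpotent_constrained (G Mod h_radical G h)"
  shows
    "(\<forall>V. subgroup V G \<longrightarrow>
        (injector G \<H> V \<longleftrightarrow>
         h_radical G h \<subseteq> V \<and>
         class_injector (G Mod h_radical G h) nilpotent_group
           (carrier (G\<lparr>carrier := V\<rparr> Mod h_radical G h)))) \<and>
     ((\<exists>V. injector G \<H> V) \<and>
      (\<forall>V W. injector G \<H> V \<longrightarrow> injector G \<H> W \<longrightarrow>
         (\<exists>x\<in>carrier G. W = conj_subgroup G V x))) \<and>
     (\<forall>V. subgroup V G \<longrightarrow>
        (injector G \<H> V \<longleftrightarrow>
         maximal_in G \<H> (carrier G) V \<and> radical G \<H> (carrier G) \<subseteq> V))"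
proof -
  let ?R = "h_radical G h"
  let ?Q = "G Mod ?R"
  interpret group G by (rule assms(1))
  note fin = assms(2) and con = assms(6)
  have h: "H_function G h" and \<H>: "\<H> = HS G h" and fH: "fitting_set G (HS G h)"
    using assms(3) by (auto simp: hartley_set_defined_by_def)
  note std = fin h assms(5)
  note R = h_radical_normal[OF std]
  interpret Q: group ?Q using R by (rule normal.factorgroup_is_group)
  have finQ: "finite (carrier ?Q)" by (rule finite_quotient[OF std con])
  have im: "carrier (G\<lparr>carrier := V\<rparr> Mod ?R) = (#>) ?R ` V" for V by (simp add: carrier_FactGroup)
  have quot: "max_nilpotent ?Q ((#>) ?R ` V)" "?R \<subseteq> V"
    if "maximal_in G \<H> (carrier G) V" "radical G \<H> (carrier G) \<subseteq> V" for V
    using that maximal_HS_quotient[OF std con fH] fitting_preimage_subset_radical[OF std con fH]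
      h_radical_subset_fitting_preimage[OF std con] unfolding \<H> by blast+
  have fwd: "injector G \<H> V" if "subgroup V G" "?R \<subseteq> V" "max_nilpotent ?Q ((#>) ?R ` V)" for V
    unfolding \<H> using max_nilpotent_quotient_injector[OF std con fH that] .
  have inj: "subgroup V G" "maximal_in G \<H> (carrier G) V" "radical G \<H> (carrier G) \<subseteq> V"
    if "injector G \<H> V" for V
    using that injector_maximal injector_contains_radical[OF fH fin] unfolding \<H> injector_def by auto
  have 1: "injector G \<H> V \<longleftrightarrow> ?R \<subseteq> V \<and> class_injector ?Q nilpotent_group (carrier (G\<lparr>carrier := V\<rparr> Mod ?R))"
    if "subgroup V G" for V
    unfolding im Q.nilpotent_injector_iff[OF finQ con] using that inj[of V] quot[of V] fwd[of V] by blast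
  have 3: "injector G \<H> V \<longleftrightarrow> maximal_in G \<H> (carrier G) V \<and> radical G \<H> (carrier G) \<subseteq> V"
    if "subgroup V G" for V
    using that inj[of V] quot[of V] fwd[of V] by blast
  have ex: "\<exists>V. injector G \<H> V"
  proof -
    obtain U where U: "max_nilpotent ?Q U" using Q.max_nilpotent_exists[OF finQ con] .
    then have sU: "subgroup U ?Q" by (simp add: max_nilpotent_def)
    note pre = subgroup_coset_preimage[OF R sU]
    show ?thesis using fwd[OF pre(1,2)] U pre(3) by auto
  qed
  have conj: "\<exists>x\<in>carrier G. W = conj_subgroup G V x" if V: "injector G \<H> V" and W: "injector G \<H> W" for V W
  proof -
    note V' = inj[OF V] quot[OF inj(2,3)[OF V]] and W' = inj[OF W] quot[OF inj(2,3)[OF W]]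
    obtain \<xi> where \<xi>: "\<xi> \<in> carrier ?Q" "(#>) ?R ` W = conj_subgroup ?Q ((#>) ?R ` V) \<xi>"
      using Q.max_nilpotent_conjugate[OF finQ con V'(4) W'(4)] .
    obtain x where x: "x \<in> carrier G" "\<xi> = ?R #> x" using \<xi>(1) by (auto simp: carrier_FactGroup)
    \<comment> \<open>Both \<open>W\<close> and the conjugate of \<open>V\<close> contain the \<open>h\<close>-radical and have the same image.\<close>
    let ?V = "conj_subgroup G V x"
    have sV: "subgroup ?V G" using V'(1) x(1) by (rule subgroup_conj_subgroup)
    have eq: "(#>) ?R ` W = (#>) ?R ` ?V"
      unfolding \<xi>(2) x(2) using conj_coset_image[OF R subgroup.subset[OF V'(1)] x(1)] .
    have "conj_subgroup G ?R x = ?R"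
      using normal.inv_op_closed1[OF R] normal.inv_op_closed2[OF R] x(1) subgroup.subset[OF normal_imp_subgroup[OF R]]
      by (intro conj_subgroup_fixed) auto
    then have RV: "?R \<subseteq> ?V" using conj_subgroup_mono[OF V'(5), of x] by simp
    have "W = ?V"
      using coset_image_subset_iff[OF R sV RV subgroup.subset[OF W'(1)]]
        coset_image_subset_iff[OF R W'(1,5) subgroup.subset[OF sV]] eq by blast
    then show ?thesis using x(1) by blast
  qed
  show ?thesis
  proof (intro conjI allI impI)
    show "\<exists>V. injector G \<H> V" by (rule ex)
    show "\<exists>x\<in>carrier G. W = conj_subgroup G V x" if "injector G \<H> V" "injector G \<H> W" for V W
      using that by (rule conj)
  qed (use 1 3 in blast)+
qed

end
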